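(* Let $p$ be an odd prime, $\mathbb{F}_p$ the field with $p$ elements, $k\ge 2$ an integer, $d=2k+1$, and $A\subset \mathbb{F}_p$. Put $\mathcal{E}=A^d\subset\mathbb{F}_p^d$ and $\varepsilon=d\cdot \frac{2^{k+2}-2^{k+1}-3}{2^{k+3}-6}$. There is a constant $C>0$ (independent of $p$ and $A$) such that if $|\mathcal{E}|\ge C\, p^{\frac{d}{2}-\varepsilon}$, then \[\left\vert\frac{\Delta(\mathcal{E})}{\Delta(\mathcal{E})}\right\vert\ge \frac{p}{3}.\]
   Context: For $\mathbf{x}=(x_1,\dots,x_d),\mathbf{y}=(y_1,\dots,y_d)\in\mathbb{F}_p^d$, the distance is $\|\mathbf{x}-\mathbf{y}\|=(x_1-y_1)^2+\cdots+(x_d-y_d)^2\in\mathbb{F}_p$. For $\mathcal{E}\subset\mathbb{F}_p^d$, the distance set is $\Delta(\mathcal{E})=\{\|\mathbf{x}-\mathbf{y}\|:\mathbf{x},\mathbf{y}\in\mathcal{E}\}$, and its quotient set is $\frac{\Delta(\mathcal{E})}{\Delta(\mathcal{E})}=\{a/b: a,b\in\Delta(\mathcal{E}),\ b\neq 0\}$. *)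

theory Defs
  imports Complex_Main "HOL-Library.FuncSet" "HOL-Computational_Algebra.Primes"
begin

text \<open>F_p is modelled by the residues {0..<p} of int with arithmetic mod p;
  F_p^d by functions {0..<d} -> {0..<p} (extensional, PiE).\<close>

definition fp_dist :: "int \<Rightarrow> nat \<Rightarrow> (nat \<Rightarrow> int) \<Rightarrow> (nat \<Rightarrow> int) \<Rightarrow> int" where
  "fp_dist p d x y = (\<Sum>i<d. (x i - y i)^2) mod p"

definition dist_set :: "int \<Rightarrow> nat \<Rightarrow> (nat \<Rightarrow> int) set \<Rightarrow> int set" where
  "dist_set p d E = {fp_dist p d x y | x y. x \<in> E \<and> y \<in> E}"

definition quot_set :: "int \<Rightarrow> int set \<Rightarrow> int set" where
  "quot_set p D = {c \<in> {0..<p}. \<exists>a\<in>D. \<exists>b\<in>D. b \<noteq> 0 \<and> (c * b) mod p = a}"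

end

theory Submission
  imports Defs "HOL-Computational_Algebra.Computational_Algebra" "HOL-Computational_Algebra.Field_as_Ring"
    "Berlekamp_Zassenhaus.Finite_Field" "HOL-Analysis.Convex"
begin

text \<open>Write D(j) for the distance set of the j-fold power of A. Since D(2k+1) contains X + Y with X = D(k)
  and Y = D(k+1), a second moment computation over all ratios c shows that most c are quotients of
  elements of X + Y as soon as |X||Y| is at least 3p. The required size comes from iterating
  |D + (A - A)^2| >> |A||D|^(1/2), which gives |D(j)| >> |A|^(2 - 2/2^j).

  This expansion follows from Rudnev's point-plane incidence bound, proved here by the polynomial method.
  By Cauchy-Schwarz it suffices to bound the number of solutions of x + (y - z)^2 = x' + (y' - z')^2,
  which count the intersections between two families of lines in 3-space, one lying in planes u = const
  and one in planes v = const. A surface of degree about the square root of the number of lines of the first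
  family contains all of them. On an irreducible component h = h(u,v), either h_uu = 0, and then the
  slopes h_v along a line of the second family are a linear function of u, so that the lines of the first
  family meeting it come from collinear points; or Bezout leaves only few lines of the second family on the
  component. Lines that are not on the surface meet it rarely, and the few exceptional ones are treated by induction.
  The characteristic enters because a rational function of degree below p with zero second derivative
  is linear.\<close>

text \<open>The exponent is the break-even point of the last step. The growth bounds give
  |D(k)||D(k+1)| >> |A|^(4 - 3/2^k), which reaches p once |A| is about p^\<beta> with \<beta> =
  2^k/(4 * 2^k - 3), and d/2 - \<epsilon> equals d * \<beta>. The polynomial method tolerates only
  degrees well below p, while the surfaces used have degree of order up to |A|^2. So A is first
  thinned to about p^\<beta> elements, which keeps |A|^2 below p because \<beta> \<le> 3/8. All
  geometry is reduced to counting roots of polynomials in one variable over a suitable domain. For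
  this, the lines of each family must lie in pairwise different parallel planes. The change of
  coordinates that achieves it contains a parameter avoiding the roots of many polynomials, and
  these could exhaust the field with p elements. The base field is therefore the field of rational
  functions over it: infinite, of the same characteristic, and containing the residues.\<close>

hide_const (open) up_ring.monom up_ring.coeff module.smult

section \<open>Polynomials in three variables and their total degree\<close>

text \<open>Elimination by cross-multiplication stays inside an integral domain. This matters for
  the eliminant below, whose unknown coefficients are polynomials in u.\<close>

lemma homogeneous_system_nontrivial:
  fixes c :: "'e \<Rightarrow> 'u \<Rightarrow> 'a::idom"
  assumes "finite E" "finite U" "card E < card U"
  shows "\<exists>x. (\<exists>u\<in>U. x u \<noteq> 0) \<and> (\<forall>e\<in>E. (\<Sum>u\<in>U. c e u * x u) = 0)"
  using assms
proof (induction E arbitrary: c U rule: finite_induct)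
  case empty
  then obtain u where "u \<in> U" by fastforce
  then show ?case by (intro exI[of _ "\<lambda>_. 1"]) auto
next
  case (insert e E)
  show ?case
  proof (cases "\<forall>u\<in>U. c e u = 0")
    case True
    obtain x where "\<exists>u\<in>U. x u \<noteq> 0" "\<forall>f\<in>E. (\<Sum>u\<in>U. c f u * x u) = 0"
      using insert.IH[of U c] insert.prems insert.hyps by auto
    with True show ?thesis by (intro exI[of _ x]) auto
  next
    case False
    then obtain u0 where u0: "u0 \<in> U" "c e u0 \<noteq> 0" by auto
    let ?c = "\<lambda>f u. c e u0 * c f u - c f u0 * c e u"
    have "card E < card (U - {u0})"
      using insert.prems insert.hyps u0 by simp
    then obtain y where y: "\<exists>u\<in>U - {u0}. y u \<noteq> 0"
        "\<forall>f\<in>E. (\<Sum>u\<in>U - {u0}. ?c f u * y u) = 0"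
      using insert.IH[of "U - {u0}" ?c] insert.prems by auto
    \<comment> \<open>Back-substitution: scaling all other coordinates by the pivot
      \<open>c e u0\<close> makes equation \<open>e\<close> hold without dividing by it.\<close>
    define x where "x = (\<lambda>u. if u = u0 then - (\<Sum>u\<in>U - {u0}. c e u * y u) else c e u0 * y u)"
    have split: "(\<Sum>u\<in>U. c f u * x u) = (\<Sum>u\<in>U - {u0}. ?c f u * y u)" for f
    proof -
      have "(\<Sum>u\<in>U. c f u * x u) = c f u0 * x u0 + (\<Sum>u\<in>U - {u0}. c f u * x u)"
        using u0 insert.prems by (simp add: sum.remove)
      also have "(\<Sum>u\<in>U - {u0}. c f u * x u) = (\<Sum>u\<in>U - {u0}. c f u * (c e u0 * y u))"
        by (rule sum.cong) (auto simp: x_def)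
      also have "c f u0 * x u0 = (\<Sum>u\<in>U - {u0}. - (c f u0 * (c e u * y u)))"
        by (simp add: x_def sum_distrib_left sum_negf)
      finally show ?thesis
        by (simp add: sum.distrib[symmetric] algebra_simps)
    qed
    have "(\<Sum>u\<in>U - {u0}. ?c e u * y u) = 0" by (simp add: mult.commute)
    moreover have "\<exists>u\<in>U. x u \<noteq> 0" using y(1) u0 by (auto simp: x_def)
    ultimately show ?thesis using split y(2) by (intro exI[of _ x]) auto
  qed
qed

section \<open>Evaluation of nested polynomials through ring homomorphisms\<close>

definition is_hom :: "('a::comm_ring_1 \<Rightarrow> 'b::comm_ring_1) \<Rightarrow> bool" where
  "is_hom f \<longleftrightarrow> f 0 = 0 \<and> f 1 = 1 \<and> (\<forall>x y. f (x + y) = f x + f y) \<and> (\<forall>x y. f (x * y) = f x * f y)"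

text \<open>The map on coefficients may itself evaluate an inner layer, so iterating
  \<open>evp\<close> evaluates a polynomial in several variables.\<close>

definition evp :: "('a::comm_ring_1 \<Rightarrow> 'b::comm_ring_1) \<Rightarrow> 'b \<Rightarrow> 'a poly \<Rightarrow> 'b" where
  "evp f x q = poly (map_poly f q) x"

lemma evp_0 [simp]: "evp f x 0 = 0"
  by (simp add: evp_def)

lemma evp_pCons: "f 0 = 0 \<Longrightarrow> evp f x (pCons a q) = f a + x * evp f x q"
  by (cases "a = 0 \<and> q = 0") (auto simp: evp_def map_poly_pCons)

lemma evp_add:
  assumes "f 0 = 0" "\<And>x y. f (x + y) = f x + f y"
  shows "evp f x (p + q) = evp f x p + evp f x q"
  by (induction p q rule: poly_induct2) (auto simp: evp_pCons assms algebra_simps)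

lemma is_hom_evp:
  assumes "is_hom f" shows "is_hom (evp f x)"
proof -
  have f: "f 0 = 0" "f 1 = 1" "\<And>x y. f (x + y) = f x + f y" "\<And>x y. f (x * y) = f x * f y"
    using assms by (auto simp: is_hom_def)
  note add = evp_add[of f, OF f(1,3)]
  have smult: "evp f x (smult a q) = f a * evp f x q" for a q
    by (induction q) (auto simp: evp_pCons f algebra_simps)
  have "evp f x (p * q) = evp f x p * evp f x q" for p q
    by (induction p) (auto simp: evp_pCons f add smult algebra_simps)
  moreover have "evp f x 1 = 1" by (simp add: one_pCons evp_pCons f)
  ultimately show ?thesis by (auto simp: is_hom_def add)
qed

lemma evp_sum:
  assumes "f 0 = 0" "degree q \<le> n"
  shows "evp f x q = (\<Sum>i\<le>n. f (coeff q i) * x ^ i)"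
proof -
  have "evp f x q = (\<Sum>i\<le>n. coeff (map_poly f q) i * x ^ i)"
    unfolding evp_def poly_altdef using assms(2) map_poly_degree_leq[of f q]
    by (intro sum.mono_neutral_left) (auto simp: coeff_eq_0)
  then show ?thesis by (simp add: coeff_map_poly assms)
qed

text \<open>The variables are u, v, h from the innermost to the outermost polynomial layer.\<close>

type_synonym 'a poly3 = "'a poly poly poly"

definition c3 :: "'a::zero poly3 \<Rightarrow> nat \<Rightarrow> nat \<Rightarrow> nat \<Rightarrow> 'a" where
  "c3 F i j k = coeff (coeff (coeff F k) j) i"

lemma c3_eqI: "(\<And>i j k. c3 F i j k = c3 G i j k) \<Longrightarrow> F = G"
  by (simp add: c3_def poly_eq_iff)

lemma c3_add: "c3 (F + G) i j k = c3 F i j k + c3 G i j k"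
  by (simp add: c3_def)

lemma c3_sum: "c3 (sum f A) i j k = (\<Sum>a\<in>A. c3 (f a) i j k)"
  by (simp add: c3_def coeff_sum)

definition ev3 :: "('a::comm_ring_1 \<Rightarrow> 'b::comm_ring_1) \<Rightarrow> 'b \<Rightarrow> 'b \<Rightarrow> 'b \<Rightarrow> 'a poly3 \<Rightarrow> 'b" where
  "ev3 f U V H = evp (evp (evp f U) V) H"

lemma is_hom_ev3: "is_hom f \<Longrightarrow> is_hom (ev3 f U V H)"
  unfolding ev3_def by (intro is_hom_evp)

lemma c3_bound: "\<exists>n. degree F \<le> n \<and> (\<forall>k. degree (coeff F k) \<le> n) \<and> (\<forall>k j. degree (coeff (coeff F k) j) \<le> n)"
proof -
  define n where "n = degree F + (\<Sum>k\<le>degree F. degree (coeff F k) + (\<Sum>j\<le>degree (coeff F k). degree (coeff (coeff F k) j)))"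
  have 1: "degree (coeff F k) \<le> n \<and> degree (coeff (coeff F k) j) \<le> n" for k j
  proof (cases "k \<le> degree F")
    case True
    have a: "degree (coeff F k) + (\<Sum>j\<le>degree (coeff F k). degree (coeff (coeff F k) j)) \<le> n"
      unfolding n_def using True
      by (intro trans_le_add2 member_le_sum[of k "{..degree F}" "\<lambda>k. degree (coeff F k) + (\<Sum>j\<le>degree (coeff F k). degree (coeff (coeff F k) j))"]) auto
    show ?thesis
    proof (cases "j \<le> degree (coeff F k)")
      case True
      then have "degree (coeff (coeff F k) j) \<le> (\<Sum>j\<le>degree (coeff F k). degree (coeff (coeff F k) j))"
        by (intro member_le_sum) auto
      with a show ?thesis by linarith
    next
      case False
      with a show ?thesis by (simp add: coeff_eq_0)
    qed
  next
    case False then show ?thesis by (simp add: coeff_eq_0)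
  qed
  have "degree F \<le> n" by (simp add: n_def)
  with 1 show ?thesis by blast
qed

lemma ev3_sum:
  assumes "is_hom f" "degree F \<le> n" "\<And>k. degree (coeff F k) \<le> n" "\<And>k j. degree (coeff (coeff F k) j) \<le> n"
  shows "ev3 f U V H F = (\<Sum>k\<le>n. \<Sum>j\<le>n. \<Sum>i\<le>n. f (c3 F i j k) * U ^ i * V ^ j * H ^ k)"
proof -
  have 0: "f 0 = 0" using assms(1) by (simp add: is_hom_def)
  show ?thesis unfolding ev3_def c3_def
    by (simp add: evp_sum[OF _ assms(2)] evp_sum[OF _ assms(3)] evp_sum[OF _ assms(4)] 0 sum_distrib_right)
qed

lemma ev3_sum_ex:
  assumes "is_hom f"
  shows "\<exists>n. (\<forall>U V H. ev3 f U V H F = (\<Sum>k\<le>n. \<Sum>j\<le>n. \<Sum>i\<le>n. f (c3 F i j k) * U ^ i * V ^ j * H ^ k))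
     \<and> (\<forall>i j k. c3 F i j k \<noteq> 0 \<longrightarrow> i \<le> n \<and> j \<le> n \<and> k \<le> n)"
proof -
  obtain n where n: "degree F \<le> n" "\<And>k. degree (coeff F k) \<le> n" "\<And>k j. degree (coeff (coeff F k) j) \<le> n"
    using c3_bound[of F] by blast
  have "i \<le> n \<and> j \<le> n \<and> k \<le> n" if "c3 F i j k \<noteq> 0" for i j k
  proof (intro conjI)
    show "i \<le> n" using that n(3)[of k j] by (auto simp: c3_def dest: le_degree)
    have "coeff (coeff F k) j \<noteq> 0" using that by (auto simp: c3_def)
    then show "j \<le> n" using n(2)[of k] le_degree by fastforce
    have "coeff F k \<noteq> 0" using that by (auto simp: c3_def)
    then show "k \<le> n" using n(1) le_degree by fastforce
  qed
  with ev3_sum[OF assms n] show ?thesis by blast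
qed

definition emb3t :: "'a::comm_ring_1 \<Rightarrow> 'a poly3 poly" where
  "emb3t c = [:[:[:[:c:]:]:]:]"

text \<open>Substituting tu, tv, th turns the total degree into the degree in the outermost variable t, which is additive on products.\<close>

definition homogenize :: "'a::comm_ring_1 poly3 \<Rightarrow> 'a poly3 poly" where
  "homogenize = ev3 emb3t (monom [:[:monom 1 1:]:] 1) (monom [:monom 1 1:] 1) (monom (monom 1 1) 1)"

definition tdeg :: "'a::comm_ring_1 poly3 \<Rightarrow> nat" where
  "tdeg F = degree (homogenize F)"

lemma is_hom_emb3t: "is_hom emb3t"
  by (simp add: is_hom_def emb3t_def one_pCons)

lemma mult_monom_power: "(monom a 1 :: 'b::comm_ring_1 poly) ^ i = monom (a ^ i) i"
  by (simp add: monom_power)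

text \<open>The coefficient of t^n is the homogeneous component of degree n, so the degree in t is
  the largest total degree of a monomial that occurs.\<close>

lemma c3_homogenize:
  "c3 (coeff (homogenize F) n) i j k = (if i + j + k = n then c3 F i j k else 0)"
proof -
  obtain N where N: "homogenize F = (\<Sum>k\<le>N. \<Sum>j\<le>N. \<Sum>i\<le>N. emb3t (c3 F i j k) * monom [:[:monom 1 1:]:] 1 ^ i
       * monom [:monom 1 1:] 1 ^ j * monom (monom 1 1) 1 ^ k)"
     and bd: "\<And>i j k. c3 F i j k \<noteq> 0 \<Longrightarrow> i \<le> N \<and> j \<le> N \<and> k \<le> N"
    using ev3_sum_ex[OF is_hom_emb3t, of F] unfolding homogenize_def by blast
  have mm: "emb3t c * monom [:[:monom 1 1:]:] 1 ^ i' * monom [:monom 1 1:] 1 ^ j' * monom (monom 1 1) 1 ^ k'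
     = monom (monom (monom (monom c i') j') k') (i' + j' + k')" for c :: 'a and i' j' k'
  proof -
    have 1: "emb3t c = monom [:[:[:c:]:]:] 0" by (simp add: emb3t_def monom_0)
    have 2: "[:[:[:c:]:]:] * [:[:monom 1 1:]:] ^ i' * [:monom 1 1:] ^ j' * (monom 1 1) ^ k' = monom (monom (monom c i') j') k'"
      by (simp add: monom_power monom_0[symmetric] mult_monom)
    show ?thesis
      unfolding 1 mult_monom_power mult_monom 2[symmetric] by simp
  qed
  have "c3 (coeff (homogenize F) n) i j k = (\<Sum>k'\<le>N. \<Sum>j'\<le>N. \<Sum>i'\<le>N.
     c3 (coeff (monom (monom (monom (monom (c3 F i' j' k') i') j') k') (i' + j' + k')) n) i j k)"
    unfolding N mm by (simp add: coeff_sum c3_sum)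
  also have "\<dots> = (\<Sum>k'\<le>N. \<Sum>j'\<le>N. \<Sum>i'\<le>N. if k' = k then if j' = j then if i' = i then 
       (if i + j + k = n then c3 F i j k else 0) else 0 else 0 else 0)"
    by (intro sum.cong) (auto simp: c3_def)
  also have "\<dots> = (if i + j + k = n then c3 F i j k else 0)"
  proof -
    define X where "X = (if i + j + k = n then c3 F i j k else 0)"
    have 1: "(\<Sum>i'\<le>N. if k' = k then if j' = j then if i' = i then X else 0 else 0 else 0)
        = (if k' = k then if j' = j then if i \<le> N then X else 0 else 0 else 0)" for k' j'
      by simp
    have 2: "(\<Sum>j'\<le>N. if k' = k then if j' = j then if i \<le> N then X else 0 else 0 else 0)
        = (if k' = k then if j \<le> N then if i \<le> N then X else 0 else 0 else 0)" for k'
      by simp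
    show ?thesis unfolding X_def[symmetric] 1 2 using bd[of i j k] by (auto simp: X_def)
  qed
  finally show ?thesis .
qed

lemma tdeg_le_iff: "tdeg F \<le> n \<longleftrightarrow> (\<forall>i j k. c3 F i j k \<noteq> 0 \<longrightarrow> i + j + k \<le> n)"
proof
  assume a: "tdeg F \<le> n"
  show "\<forall>i j k. c3 F i j k \<noteq> 0 \<longrightarrow> i + j + k \<le> n"
  proof (intro allI impI, rule ccontr)
    fix i j k assume c: "c3 F i j k \<noteq> 0" "\<not> i + j + k \<le> n"
    then have "coeff (homogenize F) (i + j + k) = 0" using a by (simp add: tdeg_def coeff_eq_0)
    then show False using c c3_homogenize[of F "i + j + k" i j k] by (simp add: c3_def)
  qed
next
  assume a: "\<forall>i j k. c3 F i j k \<noteq> 0 \<longrightarrow> i + j + k \<le> n"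
  show "tdeg F \<le> n" unfolding tdeg_def
  proof (rule degree_le, intro allI impI)
    fix m assume "n < m"
    then show "coeff (homogenize F) m = 0"
    proof (intro c3_eqI)
      fix i j k
      have "c3 F i j k = 0" if "i + j + k = m" using a that \<open>n < m\<close> by (metis not_le)
      then show "c3 (coeff (homogenize F) m) i j k = c3 0 i j k"
        unfolding c3_homogenize by (simp add: c3_def)
    qed
  qed
qed

lemma tdeg_coeff: "c3 F i j k \<noteq> 0 \<Longrightarrow> i + j + k \<le> tdeg F"
  using tdeg_le_iff by blast

lemma homogenize_eq_0_iff: "homogenize F = 0 \<longleftrightarrow> F = 0"
proof
  assume "homogenize F = 0"
  then have "c3 F i j k = 0" for i j k
    using c3_homogenize[of F "i + j + k" i j k] by (simp add: c3_def)
  then show "F = 0" by (intro c3_eqI) (simp add: c3_def)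
next
  show "F = 0 \<Longrightarrow> homogenize F = 0" by (simp add: homogenize_def ev3_def)
qed

lemma tdeg_mult:
  fixes F G :: "'a::idom poly3"
  assumes "F \<noteq> 0" "G \<noteq> 0" shows "tdeg (F * G) = tdeg F + tdeg G"
proof -
  have "homogenize (F * G) = homogenize F * homogenize G"
    using is_hom_ev3[OF is_hom_emb3t] unfolding homogenize_def is_hom_def by blast
  then show ?thesis unfolding tdeg_def using assms by (simp add: degree_mult_eq homogenize_eq_0_iff)
qed

lemma tdeg_mult_le:
  fixes F G :: "'a::idom poly3"
  shows "tdeg (F * G) \<le> tdeg F + tdeg G"
proof (cases "F = 0 \<or> G = 0")
  case True then have "F * G = 0" by auto
  then have "homogenize (F * G) = 0" by (simp only: homogenize_eq_0_iff)
  then show ?thesis by (simp add: tdeg_def)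
qed (simp add: tdeg_mult)

lemma tdeg_add_le: "tdeg F \<le> n \<Longrightarrow> tdeg G \<le> n \<Longrightarrow> tdeg (F + G) \<le> n"
  unfolding tdeg_le_iff c3_add by (metis add.right_neutral)

lemma tdeg_diff_le: 
  fixes F G :: "'a::comm_ring_1 poly3"
  shows "tdeg F \<le> n \<Longrightarrow> tdeg G \<le> n \<Longrightarrow> tdeg (F - G) \<le> n"
  unfolding tdeg_le_iff c3_def by (simp, metis)

lemma degree_le_tdeg: "degree F \<le> tdeg F"
proof (rule degree_le, intro allI impI)
  fix k assume "tdeg F < k"
  then have "c3 F i j k = 0" for i j using tdeg_coeff[of F i j k] by fastforce
  then show "coeff F k = 0" by (simp add: c3_def poly_eq_iff)
qed

lemma degree_coeff_le_tdeg: "degree (coeff F k) \<le> tdeg F"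
proof (rule degree_le, intro allI impI)
  fix j assume "tdeg F < j"
  then have "c3 F i j k = 0" for i using tdeg_coeff[of F i j k] by fastforce
  then show "coeff (coeff F k) j = 0" by (simp add: c3_def poly_eq_iff)
qed

lemma degree_coeff_coeff_le_tdeg: "degree (coeff (coeff F k) j) \<le> tdeg F"
proof (rule degree_le, intro allI impI)
  fix i assume "tdeg F < i"
  then have "c3 F i j k = 0" using tdeg_coeff[of F i j k] by fastforce
  then show "coeff (coeff (coeff F k) j) i = 0" by (simp add: c3_def)
qed

section \<open>Restriction to lines and partial derivatives\<close>

lemma hom_evp:
  assumes "is_hom g" "f 0 = 0"
  shows "g (evp f x q) = evp (g \<circ> f) (g x) q"
proof -
  have g: "g 0 = 0" "\<And>x y. g (x + y) = g x + g y" "\<And>x y. g (x * y) = g x * g y"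
    using assms by (auto simp: is_hom_def)
  have f: "(g \<circ> f) 0 = 0" by (simp add: g assms)
  show ?thesis
  proof (induction q)
    case (pCons a q)
    then show ?case unfolding evp_pCons[of f, OF assms(2)] evp_pCons[of "g \<circ> f", OF f] by (simp add: g comp_def)
  qed (simp add: g)
qed

lemma hom_ev3:
  assumes g: "is_hom g" and f: "is_hom f"
  shows "g (ev3 f U V H F) = ev3 (g \<circ> f) (g U) (g V) (g H) F"
proof -
  have f0: "f 0 = 0" using f by (simp add: is_hom_def)
  have 1: "g \<circ> evp f U = evp (g \<circ> f) (g U)" by (rule ext) (simp add: hom_evp[of g f, OF g f0])
  have 2: "g \<circ> evp (evp f U) V = evp (evp (g \<circ> f) (g U)) (g V)"
    by (rule ext) (simp add: hom_evp[of g, OF g] 1)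
  show ?thesis unfolding ev3_def by (simp add: hom_evp[of g, OF g] 2)
qed

text \<open>Restriction to the curve (U(w), V(w), H(w)); the result is a polynomial in the curve
  parameter w.\<close>

definition sub3 :: "'a::comm_ring_1 poly \<Rightarrow> 'a poly \<Rightarrow> 'a poly \<Rightarrow> 'a poly3 \<Rightarrow> 'a poly" where
  "sub3 = ev3 (\<lambda>c. [:c:])"

lemma is_hom_const: "is_hom (\<lambda>c. [:c:])"
  by (simp add: is_hom_def one_pCons)

lemma is_hom_sub3: "is_hom (sub3 U V H)"
  unfolding sub3_def by (rule is_hom_ev3[OF is_hom_const])

lemma sub3_simps:
  "sub3 U V H 0 = 0" "sub3 U V H 1 = 1"
  "sub3 U V H (F + G) = sub3 U V H F + sub3 U V H G"
  "sub3 U V H (F * G) = sub3 U V H F * sub3 U V H G"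
  using is_hom_sub3[of U V H] by (auto simp: is_hom_def)

lemma sub3_diff: "sub3 U V H (F - G) = sub3 U V H F - sub3 U V H G"
  using sub3_simps(3)[of U V H "F - G" G] by (simp add: algebra_simps)

lemma poly_sub3:
  "poly (sub3 U V H F) w = ev3 (\<lambda>c. c) (poly U w) (poly V w) (poly H w) F"
proof -
  have "is_hom (\<lambda>q. poly q w)" by (simp add: is_hom_def)
  from hom_ev3[OF this is_hom_const, of U V H F] show ?thesis
    by (simp add: sub3_def comp_def)
qed

lemma degree_sub3_le:
  fixes F :: "'a::idom poly3"
  assumes "degree U \<le> 1" "degree V \<le> 1" "degree H \<le> 1"
  shows "degree (sub3 U V H F) \<le> tdeg F"
proof -
  obtain n where n: "sub3 U V H F = (\<Sum>k\<le>n. \<Sum>j\<le>n. \<Sum>i\<le>n. [:c3 F i j k:] * U ^ i * V ^ j * H ^ k)"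
    using ev3_sum_ex[OF is_hom_const, of F] unfolding sub3_def by blast
  have pw: "degree (Q ^ i) \<le> i" if "degree Q \<le> 1" for Q :: "'a poly" and i
    using degree_power_le[of Q i] mult_le_mono1[OF that, of i] by (simp only: nat_mult_1)
  have "degree ([:c3 F i j k:] * U ^ i * V ^ j * H ^ k) \<le> tdeg F" for i j k
  proof (cases "c3 F i j k = 0")
    case False
    have "degree ([:c3 F i j k:] * U ^ i * V ^ j * H ^ k) \<le> degree [:c3 F i j k:] + degree (U ^ i) + degree (V ^ j) + degree (H ^ k)"
      using degree_mult_le[of "[:c3 F i j k:] * U ^ i * V ^ j" "H ^ k"]
        degree_mult_le[of "[:c3 F i j k:] * U ^ i" "V ^ j"] degree_mult_le[of "[:c3 F i j k:]" "U ^ i"]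
      by linarith
    also have "\<dots> \<le> 0 + i + j + k" using pw assms by (intro add_mono) auto
    also have "\<dots> \<le> tdeg F" using tdeg_coeff[OF False] by simp
    finally show ?thesis .
  qed simp
  then show ?thesis unfolding n by (intro degree_sum_le) auto
qed

text \<open>The chain rule for an arbitrary derivation on the target. Applied once per layer it
  produces one term for each variable, which yields \<open>pderiv_sub3\<close>.\<close>

lemma evp_derivation:
  assumes f: "is_hom f" and D: "\<And>x y. D (x + y) = D x + D y" "\<And>x y. D (x * y) = x * D y + y * D x"
  shows "D (evp f x q) = evp (\<lambda>r. D (f r)) x q + evp f x (pderiv q) * D x"
proof -
  have f0: "f 0 = 0" using f by (simp add: is_hom_def)
  have D0: "D 0 = 0" using D(1)[of 0 0] by simp
  have Df0: "D (f 0) = 0" by (simp add: f0 D0)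
  note add = is_hom_evp[OF f, of x, unfolded is_hom_def]
  show ?thesis
  proof (induction q)
    case (pCons a q)
    then show ?case using add
      by (simp add: evp_pCons[of f, OF f0] evp_pCons[of "\<lambda>r. D (f r)", OF Df0] D f0 pderiv_pCons algebra_simps)
  qed (simp add: D0)
qed

lemma evp_fun_add:
  "g 0 = 0 \<Longrightarrow> h 0 = 0 \<Longrightarrow> evp (\<lambda>r. g r + h r) x q = evp g x q + evp h x q"
  by (induction q) (auto simp: evp_pCons algebra_simps)

lemma evp_map_mult:
  assumes "f 0 = 0" "d 0 = 0"
  shows "evp (\<lambda>r. f (d r) * z) x q = evp f x (map_poly d q) * z"
proof (induction q)
  case (pCons a q)
  then show ?case using assms by (simp add: evp_pCons map_poly_pCons algebra_simps)
qed simp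

section \<open>Partial derivatives and the equation of vanishing second derivative\<close>

abbreviation dh :: "'a::idom poly3 \<Rightarrow> 'a poly3" where "dh \<equiv> pderiv"
definition dv :: "'a::idom poly3 \<Rightarrow> 'a poly3" where "dv = map_poly pderiv"
definition du :: "'a::idom poly3 \<Rightarrow> 'a poly3" where "du = map_poly (map_poly pderiv)"

lemma pderiv_sub3:
  fixes F :: "'a::idom poly3"
  shows "pderiv (sub3 U V H F) = sub3 U V H (du F) * pderiv U + sub3 U V H (dv F) * pderiv V + sub3 U V H (dh F) * pderiv H"
proof -
  let ?f0 = "\<lambda>c::'a. [:c:]"
  let ?f1 = "evp ?f0 U" let ?f2 = "evp ?f1 V"
  have h0: "is_hom ?f0" by (rule is_hom_const)
  have h1: "is_hom ?f1" and h2: "is_hom ?f2" by (intro is_hom_evp h0)+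
  note D = evp_derivation[where D = pderiv, OF _ pderiv_add pderiv_mult]
  have z: "evp (\<lambda>_. 0) x q = (0 :: 'a poly)" for x and q :: "'a poly"
    by (induction q) (auto simp: evp_pCons)
  have 1: "pderiv (?f1 r) = ?f1 (pderiv r) * pderiv U" for r
    by (subst D[OF h0]) (simp add: z)
  have 2: "pderiv (?f2 q) = ?f2 (map_poly pderiv q) * pderiv U + ?f2 (pderiv q) * pderiv V" for q
    by (subst D[OF h1]) (simp add: 1 evp_map_mult)
  show ?thesis unfolding sub3_def ev3_def du_def dv_def
    by (subst D[OF h2]) (simp add: 2 evp_map_mult evp_fun_add)
qed

lemma map_poly_derivation:
  fixes d :: "'a::comm_ring_1 \<Rightarrow> 'a"
  assumes d: "d 0 = 0" "\<And>x y. d (x + y) = d x + d y" "\<And>x y. d (x * y) = x * d y + y * d x"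
  shows "map_poly d (p + q) = map_poly d p + map_poly d q"
    and "map_poly d (p * q) = p * map_poly d q + q * map_poly d p"
proof -
  have pc: "map_poly d (pCons a p) = pCons (d a) (map_poly d p)" for a p
    by (cases "a = 0 \<and> p = 0") (auto simp: map_poly_pCons d)
  show add: "map_poly d (p + q) = map_poly d p + map_poly d q" for p q
    by (induction p q rule: poly_induct2) (auto simp: pc d)
  have sm: "map_poly d (smult a q) = smult a (map_poly d q) + smult (d a) q" for a q
    by (induction q) (auto simp: pc d)
  show "map_poly d (p * q) = p * map_poly d q + q * map_poly d p"
    by (induction p) (auto simp: pc d add sm algebra_simps)
qed

lemma dv_add: "dv (p + q) = dv p + dv q" and dv_mult: "dv (p * q) = p * dv q + q * dv p"
  unfolding dv_def by (intro map_poly_derivation; simp add: pderiv_add pderiv_mult)+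

lemma c3_dh: "c3 (dh F) i j k = of_nat (Suc k) * c3 F i j (Suc k)"
proof -
  have "coeff (coeff (of_nat (Suc k) * X) j) i = of_nat (Suc k) * coeff (coeff X j) i" for X :: "'a poly poly"
    by (simp add: of_nat_poly)
  then show ?thesis by (simp add: c3_def coeff_pderiv)
qed


lemma c3_dv: "c3 (dv F) i j k = of_nat (Suc j) * c3 F i (Suc j) k"
proof -
  have "coeff (of_nat (Suc j) * X) i = of_nat (Suc j) * coeff X i" for X :: "'a poly"
    by (simp add: of_nat_poly)
  then show ?thesis by (simp add: c3_def dv_def coeff_map_poly coeff_pderiv)
qed

lemma c3_du: "c3 (du F) i j k = of_nat (Suc i) * c3 F (Suc i) j k"
  by (simp add: c3_def du_def coeff_map_poly coeff_pderiv)

lemma partials_commute: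
  "dh (dv F) = dv (dh F)" "dh (du F) = du (dh F)" "dv (du F) = du (dv F)"
  by (intro c3_eqI; simp only: c3_dh c3_dv c3_du mult_ac)+

lemma tdeg_partials: "tdeg (dh F) \<le> tdeg F" "tdeg (dv F) \<le> tdeg F" "tdeg (du F) \<le> tdeg F"
proof -
  have "i + j + k \<le> tdeg F" if "c3 F i j (Suc k) \<noteq> 0 \<or> c3 F i (Suc j) k \<noteq> 0 \<or> c3 F (Suc i) j k \<noteq> 0" for i j k
    using that tdeg_coeff by fastforce
  then show "tdeg (dh F) \<le> tdeg F" "tdeg (dv F) \<le> tdeg F" "tdeg (du F) \<le> tdeg F"
    unfolding tdeg_le_iff c3_dh c3_dv c3_du by auto
qed

text \<open>Up to a power of the derivative with respect to h, this is the second derivative with respect to u of the function h(u,v) defined implicitly by F = 0.\<close>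

definition flec :: "'a::idom poly3 \<Rightarrow> 'a poly3" where
  "flec F = du (du F) * (dh F * dh F) - (du F * dh F * du (dh F) + du F * dh F * du (dh F)) + du F * du F * dh (dh F)"

lemma tdeg_flec: "tdeg (flec F) \<le> 3 * tdeg F"
proof -
  let ?n = "tdeg F"
  have m: "tdeg (A * (B * C)) \<le> 3 * ?n" if "tdeg A \<le> ?n" "tdeg B \<le> ?n" "tdeg C \<le> ?n" for A B C :: "'a poly3"
    using tdeg_mult_le[of A "B * C"] tdeg_mult_le[of B C] that by linarith
  have m': "tdeg (A * B * C) \<le> 3 * ?n" if "tdeg A \<le> ?n" "tdeg B \<le> ?n" "tdeg C \<le> ?n" for A B C :: "'a poly3"
    using m[OF that] by (simp add: mult.assoc)
  note d = tdeg_partials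
  have d2: "tdeg (du (du F)) \<le> ?n" "tdeg (du (dh F)) \<le> ?n" "tdeg (dh (dh F)) \<le> ?n"
    using d order_trans by blast+
  show ?thesis unfolding flec_def
    by (intro tdeg_add_le tdeg_diff_le m m' d d2)
qed

text \<open>The triple (a, b, c) encodes the line u = a, h = b v + c, and in the second family (d, e, f) encodes v = d, h = e u + f.\<close>

definition on1 :: "'a::idom \<times> 'a \<times> 'a \<Rightarrow> 'a poly3 \<Rightarrow> 'a poly" where
  "on1 l = (case l of (a, b, c) \<Rightarrow> sub3 [:a:] [:0, 1:] [:c, b:])"

definition on2 :: "'a::idom \<times> 'a \<times> 'a \<Rightarrow> 'a poly3 \<Rightarrow> 'a poly" where
  "on2 m = (case m of (d, e, f) \<Rightarrow> sub3 [:0, 1:] [:d:] [:f, e:])"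

lemma on1_simps:
  "on1 l 0 = 0" "on1 l 1 = 1" "on1 l (F + G) = on1 l F + on1 l G" "on1 l (F * G) = on1 l F * on1 l G"
  by (auto simp: on1_def sub3_simps split: prod.splits)

lemma on2_simps:
  "on2 m 0 = 0" "on2 m 1 = 1" "on2 m (F + G) = on2 m F + on2 m G" "on2 m (F * G) = on2 m F * on2 m G"
  "on2 m (F - G) = on2 m F - on2 m G"
  by (auto simp: on2_def sub3_simps sub3_diff split: prod.splits)

lemma degree_on: "degree (on1 l F) \<le> tdeg F" "degree (on2 m F) \<le> tdeg F"
  by (auto simp: on1_def on2_def split: prod.splits intro!: degree_sub3_le)

lemma poly_on1_on2:
  assumes "b * d + c = e * a + f"
  shows "poly (on1 (a, b, c) F) d = poly (on2 (d, e, f) F) a"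
proof -
  have "c + d * b = f + a * e" using assms by (simp add: algebra_simps)
  then show ?thesis by (simp add: on1_def on2_def poly_sub3)
qed

lemma pderiv_on1: "pderiv (on1 (a, b, c) F) = on1 (a, b, c) (dv F) + [:b:] * on1 (a, b, c) (dh F)"
  by (simp add: on1_def pderiv_sub3 pderiv_pCons algebra_simps)

lemma pderiv_on2: "pderiv (on2 (d, e, f) F) = on2 (d, e, f) (du F) + [:e:] * on2 (d, e, f) (dh F)"
  by (simp add: on2_def pderiv_sub3 pderiv_pCons algebra_simps)

text \<open>The quotient of the two restricted derivatives is the slope in direction v along the line; its second derivative vanishes because h_uuv is the v-derivative of h_uu = 0.\<close>

lemma second_order_along_line:
  fixes P :: "'a::idom poly3"
  assumes dvd: "P dvd flec P" and on: "on2 (d, e, f) P = 0"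
  defines "\<phi> \<equiv> on2 (d, e, f) (dv P)" and "\<psi> \<equiv> on2 (d, e, f) (dh P)"
  shows "\<psi> * (pderiv (pderiv \<phi>) * \<psi> * \<psi> - 2 * pderiv \<phi> * pderiv \<psi> * \<psi> - \<phi> * \<psi> * pderiv (pderiv \<psi>)
     + 2 * \<phi> * pderiv \<psi> * pderiv \<psi>) = 0"
proof -
  let ?E = "on2 (d, e, f)"
  obtain Q where Q: "flec P = P * Q" using dvd by (auto simp: dvd_def)
  \<comment> \<open>Where P vanishes, the product rule leaves only the terms in which P is
    differentiated.\<close>
  have v: "?E (dv (flec P)) = \<phi> * ?E Q" and h: "?E (dh (flec P)) = \<psi> * ?E Q"
    unfolding Q by (simp_all add: dv_mult pderiv_mult on2_simps on \<phi>_def \<psi>_def mult.commute)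
  \<comment> \<open>Up to the factor \<psi> this is the v-derivative of \<open>flec P\<close> along
    the surface, as h_v = -\<phi>/\<psi>; \<open>flec P\<close> is zero on the whole
    surface.\<close>
  then have key: "?E (dv (flec P)) * \<psi> - \<phi> * ?E (dh (flec P)) = 0" by simp
  define e' where "e' = [:e:]"
  have e': "pderiv e' = 0" by (simp add: e'_def)
  note D = pderiv_on2[of d e f, folded e'_def]
  define pu puu puh phh puv pvh where "pu = ?E (du P)" and "puu = ?E (du (du P))" and "puh = ?E (du (dh P))"
    and "phh = ?E (dh (dh P))" and "puv = ?E (du (dv P))" and "pvh = ?E (dv (dh P))"
  define puuv puvh pvhh puuh puhh phhh where "puuv = ?E (du (du (dv P)))" and "puvh = ?E (du (dv (dh P)))"
    and "pvhh = ?E (dv (dh (dh P)))" and "puuh = ?E (du (du (dh P)))" and "puhh = ?E (du (dh (dh P)))"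
    and "phhh = ?E (dh (dh (dh P)))"
  note defs = pu_def puu_def puh_def phh_def puv_def pvh_def puuv_def puvh_def pvhh_def puuh_def puhh_def phhh_def \<phi>_def \<psi>_def
  \<comment> \<open>P is identically zero on the line, hence so is its derivative P_u + e P_h along
    it.\<close>
  have pu: "pu = - (e' * \<psi>)" using D[of P] on by (simp add: defs eq_neg_iff_add_eq_0)
  have dpsi: "pderiv \<psi> = puh + e' * phh" by (simp add: defs D partials_commute)
  have dphi: "pderiv \<phi> = puv + e' * pvh" by (simp add: defs D partials_commute)
  have ddpsi: "pderiv (pderiv \<psi>) = puuh + 2 * e' * puhh + e' * e' * phhh"
    unfolding dpsi by (simp add: pderiv_add pderiv_mult e' defs D partials_commute algebra_simps)
  have ddphi: "pderiv (pderiv \<phi>) = puuv + 2 * e' * puvh + e' * e' * pvhh"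
    unfolding dphi by (simp add: pderiv_add pderiv_mult e' defs D partials_commute algebra_simps)
  have "pderiv pu = puu + e' * puh" by (simp add: defs D partials_commute)
  then have puu: "puu = - 2 * e' * puh - e' * e' * phh"
    unfolding pu pderiv_minus pderiv_mult e' dpsi by Groebner_Basis.algebra
  have dv_diff: "dv (A - B) = dv A - dv B" for A B :: "'a poly3"
    using dv_add[of "A - B" B] by (simp add: algebra_simps)
  have E1: "?E (dv (flec P)) = puuv * \<psi> * \<psi> + 2 * puu * \<psi> * pvh - 2 * (puv * \<psi> * puh + pu * pvh * puh + pu * \<psi> * puvh)
     + 2 * pu * puv * phh + pu * pu * pvhh"
    unfolding flec_def dv_add dv_diff dv_mult on2_simps partials_commute defs[symmetric] by Groebner_Basis.algebra
  have E2: "?E (dh (flec P)) = puuh * \<psi> * \<psi> + 2 * puu * \<psi> * phh - 2 * (puh * \<psi> * puh + pu * phh * puh + pu * \<psi> * puhh)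
     + 2 * pu * puh * phh + pu * pu * phhh"
    unfolding flec_def pderiv_add pderiv_diff pderiv_mult on2_simps partials_commute defs[symmetric] by Groebner_Basis.algebra
  have "?E (dv (flec P)) * \<psi> - \<phi> * ?E (dh (flec P)) = \<psi> * (pderiv (pderiv \<phi>) * \<psi> * \<psi> - 2 * pderiv \<phi> * pderiv \<psi> * \<psi> - \<phi> * \<psi> * pderiv (pderiv \<psi>)
     + 2 * \<phi> * pderiv \<psi> * pderiv \<psi>)"
    unfolding E1 E2 ddphi ddpsi unfolding dphi dpsi pu puu by Groebner_Basis.algebra
  with key show ?thesis by simp
qed

section \<open>Rational functions with vanishing derivatives in large characteristic\<close>

lemma coeff_mult_top:
  fixes A B :: "'a::comm_ring_1 poly"
  assumes "degree A \<le> m" "degree B \<le> n"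
  shows "coeff (A * B) (m + n) = coeff A m * coeff B n"
proof -
  have "coeff (A * B) (m + n) = (\<Sum>i\<le>m + n. coeff A i * coeff B (m + n - i))" by (simp add: coeff_mult)
  also have "\<dots> = (\<Sum>i\<le>m + n. if i = m then coeff A m * coeff B n else 0)"
  proof (rule sum.cong)
    fix i assume "i \<in> {..m + n}"
    show "coeff A i * coeff B (m + n - i) = (if i = m then coeff A m * coeff B n else 0)"
    proof (cases i m rule: linorder_cases)
      case less then have "coeff B (m + n - i) = 0" using assms by (intro coeff_eq_0) linarith
      with less show ?thesis by simp
    next
      case greater then have "coeff A i = 0" using assms by (intro coeff_eq_0) linarith
      with greater show ?thesis by simp
    qed simp
  qed simp
  finally show ?thesis by simp
qed

lemma degree_pderiv_le: "degree (pderiv p) \<le> degree p - 1"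
  by (rule degree_le) (auto simp: coeff_pderiv coeff_eq_0)

text \<open>Comparing top coefficients forces the two degrees to agree in the field, hence as
  numbers, because they are at most N. Subtracting the multiple of B that cancels the leading term
  leaves a solution of the same equation whose degree is not that of B, so it is zero. In small
  characteristic the claim fails, for instance for x^p and 1.\<close>

lemma wronskian_zero:
  fixes A B :: "'a::field poly"
  assumes ch: "\<And>n. 0 < n \<Longrightarrow> n \<le> N \<Longrightarrow> (of_nat n :: 'a) \<noteq> 0"
    and deg: "degree A \<le> N" "degree B \<le> N" and B: "B \<noteq> 0"
    and w: "pderiv A * B = A * pderiv B"
  shows "\<exists>c. A = smult c B"
proof -
  have *: "degree A = degree B" if "A \<noteq> 0" "degree A \<le> N" "pderiv A * B = A * pderiv B" for A
  proof (rule ccontr)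
    assume ne: "degree A \<noteq> degree B"
    \<comment> \<open>Multiplying P' by x realigns it with the degree of P, so that constant and
      nonconstant P enter the comparison in the same way.\<close>
    have X: "degree (pCons 0 (pderiv P)) \<le> degree P \<and> coeff (pCons 0 (pderiv P)) (degree P) = of_nat (degree P) * lead_coeff P" for P :: "'a poly"
    proof (cases "degree P")
      case 0 
      then have "pderiv P = 0" by (metis degree_eq_zeroE pderiv_singleton)
      then show ?thesis using 0 by simp
    next
      case (Suc n)
      have "degree (pCons 0 (pderiv P)) \<le> degree P"
        using degree_pderiv_le[of P] Suc degree_pCons_le[of 0 "pderiv P"] by linarith
      then show ?thesis using Suc by (simp add: coeff_pderiv)
    qed
    have "pCons 0 (pderiv A) * B = A * pCons 0 (pderiv B)" using that(3) by simp
    then have "coeff (pCons 0 (pderiv A) * B) (degree A + degree B) = coeff (A * pCons 0 (pderiv B)) (degree A + degree B)" by simp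
    then have "of_nat (degree A) * lead_coeff A * lead_coeff B = lead_coeff A * (of_nat (degree B) * lead_coeff B)"
      using X[of A] X[of B] coeff_mult_top[of "pCons 0 (pderiv A)" "degree A" B "degree B"]
        coeff_mult_top[of A "degree A" "pCons 0 (pderiv B)" "degree B"] by simp
    then have eq: "(of_nat (degree A) :: 'a) = of_nat (degree B)" using that(1) B by simp
    show False
    proof (cases "degree A < degree B")
      case True
      then have "(of_nat (degree B - degree A) :: 'a) = 0" using eq by (simp add: of_nat_diff)
      then show False using ch[of "degree B - degree A"] True order_trans[OF diff_le_self deg(2)] by simp
    next
      case False
      then have "(of_nat (degree A - degree B) :: 'a) = 0" using eq by (simp add: of_nat_diff)
      then show False using ch[of "degree A - degree B"] False ne order_trans[OF diff_le_self that(2)] by simp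
    qed
  qed
  show ?thesis
  proof (cases "A = 0")
    case False
    have dAB: "degree A = degree B" using * False deg w by blast
    define c where "c = lead_coeff A / lead_coeff B"
    define R where "R = A - smult c B"
    have lc: "coeff R (degree B) = 0" using B dAB by (simp add: R_def c_def)
    have dR: "degree R \<le> degree B" unfolding R_def using dAB by (intro degree_diff_le) auto
    have "R = 0"
    proof (rule ccontr)
      assume "R \<noteq> 0"
      have "pderiv R * B = R * pderiv B" using w by (simp add: R_def pderiv_diff pderiv_smult algebra_simps)
      then have "degree R = degree B" using *[OF \<open>R \<noteq> 0\<close>] dR deg by simp
      then show False using lc \<open>R \<noteq> 0\<close> by (metis leading_coeff_0_iff)
    qed
    then show ?thesis by (auto simp: R_def)
  qed (auto intro: exI[of _ 0])
qed

text \<open>The left-hand side of \<open>eq\<close> is \<psi>^4 times the second derivative of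
  \<phi>/\<psi>. With W the numerator of (\<phi>/\<psi>)', the Wronskian lemma first makes
  W/\<psi>^2 a constant c and then makes \<phi>/\<psi> - c x a constant. The sign is chosen so that
  the slope -\<phi>/\<psi> becomes g + h x.\<close>

lemma quotient_linear:
  fixes \<phi> \<psi> :: "'a::field poly"
  assumes ch: "\<And>n. 0 < n \<Longrightarrow> n \<le> 2 * s + 1 \<Longrightarrow> (of_nat n :: 'a) \<noteq> 0"
    and deg: "degree \<phi> \<le> s" "degree \<psi> \<le> s" and \<psi>: "\<psi> \<noteq> 0"
    and eq: "\<psi> * (pderiv (pderiv \<phi>) * \<psi> * \<psi> - 2 * pderiv \<phi> * pderiv \<psi> * \<psi> - \<phi> * \<psi> * pderiv (pderiv \<psi>)
     + 2 * \<phi> * pderiv \<psi> * pderiv \<psi>) = 0"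
  shows "\<exists>g h. \<phi> = - ([:g, h:] * \<psi>)"
proof -
  define W where "W = pderiv \<phi> * \<psi> - \<phi> * pderiv \<psi>"
  have "pderiv W * (\<psi> * \<psi>) - W * pderiv (\<psi> * \<psi>) = \<psi> * (pderiv (pderiv \<phi>) * \<psi> * \<psi> - 2 * pderiv \<phi> * pderiv \<psi> * \<psi> - \<phi> * \<psi> * pderiv (pderiv \<psi>)
     + 2 * \<phi> * pderiv \<psi> * pderiv \<psi>)"
    unfolding W_def by (simp add: pderiv_diff pderiv_mult) Groebner_Basis.algebra
  then have w: "pderiv W * (\<psi> * \<psi>) = W * pderiv (\<psi> * \<psi>)" using eq by simp
  have d1: "degree (\<psi> * \<psi>) \<le> 2 * s + 1" using degree_mult_le[of \<psi> \<psi>] deg by linarith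
  have d2: "degree W \<le> 2 * s + 1" unfolding W_def
    using degree_mult_le[of "pderiv \<phi>" \<psi>] degree_mult_le[of \<phi> "pderiv \<psi>"] degree_pderiv_le[of \<phi>] degree_pderiv_le[of \<psi>] deg
    by (intro degree_diff_le) linarith+
  obtain c where c: "W = smult c (\<psi> * \<psi>)" using wronskian_zero[OF ch d2 d1 _ w] \<psi> by auto
  define \<phi>' where "\<phi>' = \<phi> - [:0, c:] * \<psi>"
  have "pderiv \<phi>' * \<psi> - \<phi>' * pderiv \<psi> = W - [:c:] * (\<psi> * \<psi>)"
    unfolding \<phi>'_def W_def by (simp add: pderiv_diff pderiv_mult pderiv_pCons algebra_simps del: mult_pCons_left mult_pCons_right)
  then have w': "pderiv \<phi>' * \<psi> = \<phi>' * pderiv \<psi>" using c by simp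
  have d3: "degree \<phi>' \<le> 2 * s + 1"
    unfolding \<phi>'_def using degree_mult_le[of "[:0, c:]" \<psi>] deg degree_pCons_le[of 0 "[:c:]"]
    by (intro degree_diff_le) auto
  have "degree \<psi> \<le> 2 * s + 1" using deg by linarith
  then obtain c' where "\<phi>' = smult c' \<psi>" using wronskian_zero[OF ch d3 _ \<psi> w'] by auto
  then have "\<phi> = - ([:- c', - c:] * \<psi>)" by (simp add: \<phi>'_def algebra_simps)
  then show ?thesis by blast
qed

section \<open>Lines common to two surfaces\<close>

text \<open>A substitute for the resultant with respect to h: the number of unknown coefficients of A and B exceeds by one the number of conditions that make A P + B G free of h.\<close>

lemma eliminant:
  fixes P G :: "'a::field poly3"
  assumes P: "prime_elem P" "\<not> P dvd G" and dp: "degree P > 0" and dg: "degree G > 0"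
  shows "\<exists>R A B. R \<noteq> 0 \<and> degree R \<le> degree G * tdeg P + degree P * tdeg G \<and> [:R:] = A * P + B * G"
proof -
  define n m s g where "n = degree G" and "m = degree P" and "s = tdeg P" and "g = tdeg G"
  \<comment> \<open>The unknowns, polynomials in u, are the coefficients of A and B at h^i v^j, with
    v-degrees limited so that both products have v-degree at most Z. There are (m + n)(Z + 1) - (n s
    + m g) of them against (m + n - 1)(Z + 1) conditions, and this Z makes the difference exactly
    one.\<close>
  define Z where "Z = n * s + m * g"
  have nm: "n > 0" "m > 0" using dp dg by (auto simp: n_def m_def)
  have sZ: "s \<le> Z" "g \<le> Z" using nm by (auto simp: Z_def trans_le_add1 trans_le_add2)
  define UA where "UA = {..<n} \<times> {..Z - s}"
  define UB where "UB = {..<m} \<times> {..Z - g}"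
  define U where "U = Inl ` UA \<union> Inr ` UB"
  define E where "E = {1..<m + n} \<times> {..Z}"
  define bas where "bas = (\<lambda>u. case u of Inl (i, j) \<Rightarrow> monom (monom 1 j) i * P | Inr (i, j) \<Rightarrow> monom (monom 1 j) i * G)"
  have fin: "finite UA" "finite UB" "finite E" by (auto simp: UA_def UB_def E_def)
  then have finU: "finite U" by (simp add: U_def)
  have cE: "card E = (m + n - 1) * (Z + 1)" by (simp add: E_def)
  have "card U = card (Inl ` UA :: (nat \<times> nat + nat \<times> nat) set) + card (Inr ` UB :: (nat \<times> nat + nat \<times> nat) set)"
    unfolding U_def using fin by (intro card_Un_disjoint) auto
  also have "\<dots> = n * (Z - s + 1) + m * (Z - g + 1)"
    by (simp add: card_image UA_def UB_def card_cartesian_product)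
  finally have cU: "card U = n * (Z - s + 1) + m * (Z - g + 1)" .
  have "int (card U) = int n * (int Z - int s + 1) + int m * (int Z - int g + 1)"
    unfolding cU of_nat_add of_nat_mult of_nat_diff[OF sZ(1)] of_nat_diff[OF sZ(2)] by simp
  moreover have "int (card E) = (int m + int n - 1) * (int Z + 1)"
  proof -
    have m1: "int (m + n - 1) = int m + int n - 1" using nm by linarith
    show ?thesis unfolding cE of_nat_mult m1 by simp
  qed
  moreover have "int Z = int n * int s + int m * int g" by (simp add: Z_def)
  ultimately have "int (card U) = int (card E) + 1" by Groebner_Basis.algebra
  then have "card E < card U" by linarith
  then obtain x where x: "\<exists>u\<in>U. x u \<noteq> 0"
    "\<And>e. e \<in> E \<Longrightarrow> (\<Sum>u\<in>U. (case e of (k, l) \<Rightarrow> coeff (coeff (bas u) k) l) * x u) = 0"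
    using homogeneous_system_nontrivial[OF fin(3) finU, of "\<lambda>e u. case e of (k, l) \<Rightarrow> coeff (coeff (bas u) k) l"] by blast
  define A where "A = (\<Sum>(i, j)\<in>UA. monom (monom (x (Inl (i, j))) j) i)"
  define B where "B = (\<Sum>(i, j)\<in>UB. monom (monom (x (Inr (i, j))) j) i)"
  have cA: "coeff (coeff A i) j = (if (i, j) \<in> UA then x (Inl (i, j)) else 0)" for i j
  proof -
    have "coeff (coeff A i) j = (\<Sum>u\<in>UA. if u = (i, j) then x (Inl (i, j)) else 0)"
      unfolding A_def coeff_sum by (intro sum.cong) (auto split: if_splits)
    then show ?thesis using fin by simp
  qed
  have cB: "coeff (coeff B i) j = (if (i, j) \<in> UB then x (Inr (i, j)) else 0)" for i j
  proof -
    have "coeff (coeff B i) j = (\<Sum>u\<in>UB. if u = (i, j) then x (Inr (i, j)) else 0)"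
      unfolding B_def coeff_sum by (intro sum.cong) (auto split: if_splits)
    then show ?thesis using fin by simp
  qed
  have AB: "A \<noteq> 0 \<or> B \<noteq> 0"
  proof -
    obtain u where u: "u \<in> U" "x u \<noteq> 0" using x by blast
    show ?thesis
    proof (cases u)
      case (Inl ij)
      then obtain i j where "u = Inl (i, j)" by (cases ij) auto
      then show ?thesis using u cA[of i j] by (auto simp: U_def)
    next
      case (Inr ij)
      then obtain i j where "u = Inr (i, j)" by (cases ij) auto
      then show ?thesis using u cB[of i j] by (auto simp: U_def)
    qed
  qed
  define S where "S = A * P + B * G"
  have sm: "smult [:y:] (monom (monom 1 j) i * Q) = monom (monom y j) i * Q" for y :: "'a poly" and i j Q
    by (simp add: smult_monom flip: mult_smult_left)
  have S: "S = (\<Sum>u\<in>U. smult [:x u:] (bas u))"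
  proof -
    have "(\<Sum>u\<in>U. smult [:x u:] (bas u)) = (\<Sum>u\<in>Inl ` UA. smult [:x u:] (bas u)) + (\<Sum>u\<in>Inr ` UB. smult [:x u:] (bas u))"
      unfolding U_def using fin by (intro sum.union_disjoint) auto
    also have "(\<Sum>u\<in>Inl ` UA. smult [:x u:] (bas u)) = (\<Sum>(i, j)\<in>UA. monom (monom (x (Inl (i, j))) j) i * P)"
      by (subst sum.reindex) (auto intro!: sum.cong simp: bas_def sm)
    also have "\<dots> = A * P" by (simp add: A_def sum_distrib_right case_prod_unfold)
    also have "(\<Sum>u\<in>Inr ` UB. smult [:x u:] (bas u)) = (\<Sum>(i, j)\<in>UB. monom (monom (x (Inr (i, j))) j) i * G)"
      by (subst sum.reindex) (auto intro!: sum.cong simp: bas_def sm)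
    also have "\<dots> = B * G" by (simp add: B_def sum_distrib_right case_prod_unfold)
    finally show ?thesis by (simp add: S_def)
  qed
  have Szero: "coeff (coeff S k) l = 0" if "(k, l) \<in> E" for k l
  proof -
    have "coeff (coeff S k) l = (\<Sum>u\<in>U. coeff (coeff (bas u) k) l * x u)"
      by (simp add: S coeff_sum mult.commute)
    also have "\<dots> = 0" using x(2)[OF that] by simp
    finally show ?thesis .
  qed
  have dA: "degree A \<le> n - 1" and dB: "degree B \<le> m - 1"
    using nm by (auto intro!: degree_le simp: poly_eq_iff cA cB UA_def UB_def)
  have dAj: "degree (coeff A i) \<le> Z - s" and dBj: "degree (coeff B i) \<le> Z - g" for i
    by (auto intro!: degree_le simp: cA cB UA_def UB_def)
  have dS: "degree S \<le> m + n - 1"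
    unfolding S_def using degree_mult_le[of A P] degree_mult_le[of B G] dA dB nm
    by (intro degree_add_le) (auto simp: m_def n_def)
  have dprod: "degree (coeff (X * Y) k) \<le> Z" if "\<And>i. degree (coeff X i) \<le> a" "\<And>i. degree (coeff Y i) \<le> b" "a + b \<le> Z"
    for X Y :: "'a poly3" and k a b
    unfolding coeff_mult
  proof (intro degree_sum_le)
    fix i show "degree (coeff X i * coeff Y (k - i)) \<le> Z"
      using degree_mult_le[of "coeff X i" "coeff Y (k - i)"] that(1)[of i] that(2)[of "k - i"] that(3) by linarith
  qed simp
  have dSk: "degree (coeff S k) \<le> Z" for k
    unfolding S_def coeff_add
    by (intro degree_add_le dprod[OF dAj degree_coeff_le_tdeg] dprod[OF dBj degree_coeff_le_tdeg])
      (use sZ in \<open>auto simp: s_def g_def\<close>)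
  have Sk: "coeff S k = 0" if "k > 0" for k
  proof (rule poly_eqI)
    fix l
    have "(k, l) \<in> E \<or> k > degree S \<or> l > degree (coeff S k)"
      using that dS dSk[of k] nm by (auto simp: E_def)
    then show "coeff (coeff S k) l = coeff 0 l" using Szero by (auto simp: coeff_eq_0)
  qed
  have S0: "S = [:coeff S 0:]"
    by (rule poly_eqI) (auto simp: Sk coeff_pCons split: nat.split)
  \<comment> \<open>If S were zero, the prime P would divide B, whose h-degree is smaller than that
    of P; then B and with it A would vanish.\<close>
  have "S \<noteq> 0"
  proof
    assume "S = 0"
    then have "A * P = - (B * G)" by (simp add: S_def eq_neg_iff_add_eq_0)
    then have "P dvd B * G" by (metis dvd_minus_iff dvd_triv_right)
    then have "P dvd B" using P prime_elem_dvd_mult_iff by blast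
    then have "B = 0" using dB nm dvd_imp_degree_le[of P B] by (cases "B = 0") (auto simp: m_def)
    with \<open>A * P = - (B * G)\<close> have "A * P = 0" by simp
    then have "A = 0" using P by auto
    with \<open>B = 0\<close> AB show False by simp
  qed
  then have "coeff S 0 \<noteq> 0" using S0 by (metis pCons_0_0)
  moreover have "degree (coeff S 0) \<le> degree G * tdeg P + degree P * tdeg G"
    using dSk[of 0] by (simp add: Z_def n_def m_def s_def g_def)
  ultimately show ?thesis using S0 unfolding S_def by metis
qed

lemma on2_const: "on2 m [:R:] = poly R [:fst m:]"
proof -
  have id: "evp (\<lambda>c. [:c:]) [:0, 1:] r = r" for r :: "'a poly"
    by (induction r) (auto simp: evp_pCons)
  obtain d e f where m: "m = (d, e, f)" by (cases m)
  have 0: "evp (evp (\<lambda>c. [:c:]) [:0, 1:]) [:d:] 0 = (0 :: 'a poly)" by simp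
  show ?thesis unfolding m on2_def sub3_def ev3_def
    by (simp add: evp_pCons[of "evp (evp (\<lambda>c. [:c:]) [:0, 1:]) [:d:]", OF 0] id evp_def[of "\<lambda>r. r"] cong: map_poly_cong)
      (simp add: evp_def[of "evp (\<lambda>c. [:c:]) [:0, 1:]"] id cong: map_poly_cong)
qed

text \<open>A line in the plane v = d lies on a surface free of h exactly when the constant d is a
  root of R, viewed as a polynomial in v over the polynomials in u.\<close>

lemma card_lines_root_bound:
  fixes R :: "'a::field poly poly"
  assumes "R \<noteq> 0" "finite M" "inj_on fst M" "\<And>m. m \<in> M \<Longrightarrow> on2 m [:R:] = 0"
  shows "card M \<le> degree R"
proof -
  have "card M = card ((\<lambda>m. [:fst m:]) ` M)"
    using assms(3) by (intro card_image[symmetric]) (auto simp: inj_on_def)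
  also have "\<dots> \<le> card {x. poly R x = 0}"
    using assms by (intro card_mono poly_roots_finite) (auto simp: on2_const)
  also have "\<dots> \<le> degree R" using assms(1) by (rule card_poly_roots_bound)
  finally show ?thesis .
qed

text \<open>A line on both surfaces lies on every combination A P + B G, in particular on the
  eliminant. The v-degree of the latter is bounded by a sum of two products of degrees, whence the
  factor 2. A surface free of h serves as its own eliminant.\<close>

lemma bezout_lines:
  fixes P G :: "'a::field poly3"
  assumes P: "prime_elem P" "\<not> P dvd G" and M: "finite M" "inj_on fst M"
    and on: "\<And>m. m \<in> M \<Longrightarrow> on2 m P = 0" "\<And>m. m \<in> M \<Longrightarrow> on2 m G = 0"
  shows "card M \<le> 2 * tdeg P * tdeg G"
proof (cases "M = {}")
  case False
  then obtain m where m: "m \<in> M" by blast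
  \<comment> \<open>A nonzero constant vanishes on no line, so both total degrees are positive as
    soon as M contains a line.\<close>
  have pos: "tdeg F > 0" if "on2 m F = 0" "F \<noteq> 0" for F :: "'a poly3"
  proof (rule ccontr)
    assume "\<not> tdeg F > 0"
    then have z: "degree F = 0" "degree (coeff F 0) = 0" "degree (coeff (coeff F 0) 0) = 0"
      using degree_le_tdeg[of F] degree_coeff_le_tdeg[of F 0] degree_coeff_coeff_le_tdeg[of F 0 0] by auto
    obtain r where r: "F = [:r:]" using z(1) by (metis degree_eq_zeroE)
    obtain q where q: "r = [:q:]" using z(2) r by (metis degree_eq_zeroE coeff_pCons_0)
    have "on2 m F = q" unfolding r q on2_const by simp
    then show False using that r q by simp
  qed
  have G0: "G \<noteq> 0" and P0: "P \<noteq> 0" using P by auto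
  have s: "tdeg P > 0" and g: "tdeg G > 0" using pos m on P0 G0 by auto
  show ?thesis
  proof (cases "degree P = 0 \<or> degree G = 0")
    case True
    then obtain R F where R: "F = [:R:]" "F = P \<or> F = G" by (metis degree_eq_zeroE)
    then have "R \<noteq> 0" using P0 G0 by auto
    then have "card M \<le> degree R" using R on by (intro card_lines_root_bound[OF _ M]) auto
    also have "\<dots> \<le> tdeg F" using degree_coeff_le_tdeg[of F 0] R by simp
    also have "\<dots> \<le> 2 * tdeg P * tdeg G"
      using R(2) mult_le_mono[of "tdeg P" "tdeg P" 1 "2 * tdeg G"] mult_le_mono[of 1 "2 * tdeg P" "tdeg G" "tdeg G"] s g by auto
    finally show ?thesis .
  next
    case False
    then obtain R A B where R: "R \<noteq> 0" "degree R \<le> degree G * tdeg P + degree P * tdeg G" "[:R:] = A * P + B * G"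
      using eliminant[OF P] by blast
    have "card M \<le> degree R" using R on by (intro card_lines_root_bound[OF _ M]) (auto simp: on2_simps)
    also have "\<dots> \<le> tdeg G * tdeg P + tdeg P * tdeg G"
      using R(2) degree_le_tdeg[of G] degree_le_tdeg[of P] by (meson add_mono le_refl mult_le_mono order_trans)
    finally show ?thesis by (simp add: mult.commute)
  qed
qed simp

section \<open>Lines on a surface\<close>

text \<open>The lines lie in the planes u = a and v = d, so they can cross only above the point (a,
  d), where the two values of h must agree.\<close>

definition meets :: "'a::idom \<times> 'a \<times> 'a \<Rightarrow> 'a \<times> 'a \<times> 'a \<Rightarrow> bool" where
  "meets l m \<longleftrightarrow> (case l of (a, b, c) \<Rightarrow> case m of (d, e, f) \<Rightarrow> b * d + c = e * a + f)"

text \<open>A line (a, b, c) stands for a point of 3-space and (d, e, f) for a plane; lines meeting a fixed m with b = g + h a stand for points on a common line inside a plane.\<close>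

definition collinear_bound :: "nat \<Rightarrow> ('a::idom \<times> 'a \<times> 'a) set \<Rightarrow> ('a \<times> 'a \<times> 'a) set \<Rightarrow> bool" where
  "collinear_bound k L M \<longleftrightarrow> (\<forall>m\<in>M. \<forall>g h. card {l \<in> L. meets l m \<and> fst (snd l) = g + h * fst l} \<le> k)"

lemma collinear_bound_mono:
  assumes "collinear_bound k L M" "finite L" "L' \<subseteq> L" "M' \<subseteq> M"
  shows "collinear_bound k L' M'"
  unfolding collinear_bound_def
proof (intro ballI allI)
  fix m g h assume "m \<in> M'"
  have "card {l \<in> L'. meets l m \<and> fst (snd l) = g + h * fst l} \<le> card {l \<in> L. meets l m \<and> fst (snd l) = g + h * fst l}"
    using assms(2,3) by (intro card_mono) auto
  also have "\<dots> \<le> k" using assms(1,4) \<open>m \<in> M'\<close> by (auto simp: collinear_bound_def)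
  finally show "card {l \<in> L'. meets l m \<and> fst (snd l) = g + h * fst l} \<le> k" .
qed

lemma poly_on_meets: "meets l m \<Longrightarrow> poly (on1 l F) (fst m) = poly (on2 m F) (fst l)"
  unfolding meets_def by (cases l; cases m) (simp add: poly_on1_on2)

lemma card_fst_roots:
  fixes q :: "'a::idom poly"
  assumes "q \<noteq> 0" "inj_on fst L" "\<And>l. l \<in> L \<Longrightarrow> poly q (fst l) = 0"
  shows "finite L \<and> card L \<le> degree q"
proof -
  have sub: "fst ` L \<subseteq> {x. poly q x = 0}" using assms(3) by auto
  have fin: "finite {x. poly q x = 0}" using assms(1) by (rule poly_roots_finite)
  have "finite L" using finite_subset[OF sub fin] assms(2) by (rule finite_imageD)
  moreover have "card L = card (fst ` L)" using assms(2) by (simp add: card_image)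
  moreover have "\<dots> \<le> card {x. poly q x = 0}" using sub fin by (rule card_mono[rotated])
  moreover have "\<dots> \<le> degree q" using assms(1) by (rule card_poly_roots_bound)
  ultimately show ?thesis by linarith
qed

text \<open>Each line of L that meets m contributes its u-coordinate as a root of the restriction of
  F to m.\<close>

lemma card_meets_le_tdeg:
  assumes "on2 m F \<noteq> 0" "inj_on fst L" "\<And>l. l \<in> L \<Longrightarrow> on1 l F = 0"
  shows "card {l \<in> L. meets l m} \<le> tdeg F"
proof -
  have "card {l \<in> L. meets l m} \<le> degree (on2 m F)"
    using assms(3) poly_on_meets[of _ m F]
    by (intro card_fst_roots[THEN conjunct2] assms inj_on_subset[OF assms(2)]) fastforce+
  then show ?thesis using degree_on(2)[of m F] by linarith
qed

text \<open>Along the line h is linear in u, so its second derivative is zero there. Algebraically,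
  this is P_u + e P_h = 0 together with its derivative.\<close>

lemma flec_on_line:
  fixes P :: "'a::idom poly3"
  assumes "on2 m P = 0" shows "on2 m (flec P) = 0"
proof -
  obtain d e f where m: "m = (d, e, f)" by (cases m)
  let ?E = "on2 (d, e, f)"
  define e' where "e' = [:e:]"
  have e': "pderiv e' = 0" by (simp add: e'_def)
  note D = pderiv_on2[of d e f, folded e'_def]
  have pu: "?E (du P) = - (e' * ?E (dh P))" using D[of P] assms m by (simp add: eq_neg_iff_add_eq_0)
  have "pderiv (?E (du P)) = - (e' * pderiv (?E (dh P)))" unfolding pu by (simp add: pderiv_minus pderiv_mult e')
  then have puu: "?E (du (du P)) = - (e' * ?E (du (dh P))) - e' * (?E (du (dh P)) + e' * ?E (dh (dh P)))"
    unfolding D partials_commute by Groebner_Basis.algebra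
  show ?thesis unfolding m flec_def on2_simps puu pu by Groebner_Basis.algebra
qed

lemma on1_const_coeff: "coeff (on1 (a, b, c) [:R:]) j = poly (coeff R j) a"
proof -
  have id: "evp (\<lambda>c. [:c:]) [:a:] r = [:poly r a:]" for r :: "'a poly"
    by (induction r) (auto simp: evp_pCons)
  have 0: "evp (evp (\<lambda>c. [:c:]) [:a:]) [:0, 1:] 0 = (0 :: 'a poly)" by simp
  have "on1 (a, b, c) [:R:] = evp (evp (\<lambda>c. [:c:]) [:a:]) [:0, 1:] R"
    unfolding on1_def sub3_def ev3_def by (simp add: evp_pCons[of "evp (evp (\<lambda>c. [:c:]) [:a:]) [:0, 1:]", OF 0])
  also have "\<dots> = (\<Sum>i\<le>max j (degree R). [:poly (coeff R i) a:] * [:0, 1:] ^ i)"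
    by (subst evp_sum[where n = "max j (degree R)"]) (auto simp: id)
  finally have "coeff (on1 (a, b, c) [:R:]) j = (\<Sum>i\<le>max j (degree R). coeff ([:poly (coeff R i) a:] * [:0, 1:] ^ i) j)"
    by (simp add: coeff_sum)
  also have "\<dots> = (\<Sum>i\<le>max j (degree R). if i = j then poly (coeff R j) a else 0)"
    by (intro sum.cong) (auto simp: monom_altdef[of 1, simplified, symmetric])
  finally show ?thesis by simp
qed

text \<open>There are three types of irreducible surface. One free of h contains lines of the first
  family in at most deg P planes u = a. If P does not divide \<open>flec P\<close>, the lines of the
  second family on the surface lie on both, and Bezout bounds their number. Otherwise the
  exceptional lines are those on which P_h vanishes as well; along any other line of the second
  family in the surface the slopes obey one linear law. A line off the surface meets at most deg P
  lines of L.\<close>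

lemma prime_surface:
  fixes P :: "'a::field poly3"
  assumes ch: "\<And>n. 0 < n \<Longrightarrow> n \<le> 2 * tdeg P + 1 \<Longrightarrow> (of_nat n :: 'a) \<noteq> 0"
    and P: "prime_elem P" and L: "finite L" "inj_on fst L" "\<And>l. l \<in> L \<Longrightarrow> on1 l P = 0"
    and M: "finite M" "inj_on fst M" and k: "collinear_bound k L M"
  shows "\<exists>bad\<subseteq>M. card bad \<le> 8 * (tdeg P)\<^sup>2 \<and> (\<forall>m\<in>M - bad. card {l \<in> L. meets l m} \<le> 2 * tdeg P + k)"
proof -
  define s where "s = tdeg P"
  have P0: "P \<noteq> 0" using P by auto
  have off: "card {l \<in> L. meets l m} \<le> 2 * s + k" if "on2 m P \<noteq> 0" for m
    using card_meets_le_tdeg[OF that L(2,3)] by (simp add: s_def)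
  note bz = bezout_lines[OF P]
  consider (0) "degree P = 0" | (1) "degree P > 0" "\<not> P dvd flec P" | (2) "degree P > 0" "P dvd flec P" by blast
  then show ?thesis
  proof cases
    case 0
    then obtain R where R: "P = [:R:]" by (metis degree_eq_zeroE)
    obtain j where j: "coeff R j \<noteq> 0" using R P0 by (metis leading_coeff_0_iff pCons_0_0)
    have "card L \<le> degree (coeff R j)"
    proof (intro card_fst_roots[THEN conjunct2] j L(2))
      fix l assume "l \<in> L"
      then show "poly (coeff R j) (fst l) = 0" using L(3)[of l] R on1_const_coeff[of "fst l" "fst (snd l)" "snd (snd l)" R j] by simp
    qed
    also have "\<dots> \<le> s" using degree_coeff_coeff_le_tdeg[of P 0 j] by (simp add: R s_def)
    finally have "card {l \<in> L. meets l m} \<le> s" for m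
      using card_mono[of L "{l \<in> L. meets l m}"] L(1) by fastforce
    then show ?thesis by (intro exI[of _ "{}"]) (auto simp: s_def trans_le_add1 mult_2)
  next
    case 1
    define bad where "bad = {m \<in> M. on2 m P = 0}"
    have "card bad \<le> 2 * tdeg P * tdeg (flec P)"
      using M flec_on_line by (intro bz[OF 1(2)]) (auto simp: bad_def intro: inj_on_subset)
    also have "\<dots> \<le> 2 * tdeg P * (3 * tdeg P)" by (intro mult_le_mono tdeg_flec le_refl)
    also have "\<dots> \<le> 8 * (tdeg P)\<^sup>2" by (simp add: power2_eq_square)
    finally show ?thesis using off by (intro exI[of _ bad]) (auto simp: bad_def s_def)
  next
    case 2
    \<comment> \<open>P_h has smaller h-degree than P, so divisibility would mean P_h = 0; but the
      h-degree of P is positive and nonzero in the field.\<close>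
    have ndvd: "\<not> P dvd dh P"
    proof
      assume "P dvd dh P"
      moreover have "degree (dh P) < degree P" using degree_pderiv_le[of P] 2(1) by linarith
      ultimately have "dh P = 0" using dvd_imp_degree_le[of P "dh P"] by fastforce
      then have "coeff (dh P) (degree P - 1) = 0" by simp
      then have "of_nat (degree P) * lead_coeff P = 0" using 2(1) by (simp add: coeff_pderiv)
      then have "(of_nat (degree P) :: 'a poly poly) = 0" using P0 by simp
      then have "(of_nat (degree P) :: 'a) = 0" by (simp add: of_nat_poly)
      then show False using ch[of "degree P"] 2(1) degree_le_tdeg[of P] by linarith
    qed
    define bad where "bad = {m \<in> M. on2 m P = 0 \<and> on2 m (dh P) = 0}"
    have "card bad \<le> 2 * tdeg P * tdeg (dh P)"
      using M by (intro bz[OF ndvd]) (auto simp: bad_def intro: inj_on_subset)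
    also have "\<dots> \<le> 2 * tdeg P * tdeg P" by (intro mult_le_mono tdeg_partials le_refl)
    also have "\<dots> \<le> 8 * (tdeg P)\<^sup>2" by (simp add: power2_eq_square)
    finally have cb: "card bad \<le> 8 * (tdeg P)\<^sup>2" .
    have "card {l \<in> L. meets l m} \<le> 2 * s + k" if m: "m \<in> M - bad" for m
    proof (cases "on2 m P = 0")
      case True
      define \<phi> where "\<phi> = on2 m (dv P)"
      define \<psi> where "\<psi> = on2 m (dh P)"
      have \<psi>0: "\<psi> \<noteq> 0" using m True by (auto simp: bad_def \<psi>_def)
      obtain d e f where def: "m = (d, e, f)" by (cases m)
      have deg: "degree \<phi> \<le> tdeg P" "degree \<psi> \<le> tdeg P"
        using degree_on(2) tdeg_partials order_trans unfolding \<phi>_def \<psi>_def by blast+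
      obtain g h where gh: "\<phi> = - ([:g, h:] * \<psi>)"
        using quotient_linear[OF ch deg \<psi>0] second_order_along_line[OF 2(2), of d e f] True
        unfolding \<phi>_def \<psi>_def def by blast
      \<comment> \<open>P vanishes on l, so P_v + b P_h = 0 there. At the crossing point with m
        these partials are the values of \<phi> and \<psi> at a, and \<phi> = -(g + h u) \<psi>
        gives b = g + h a unless \<psi>(a) = 0.\<close>
      have *: "poly \<psi> (fst l) = 0 \<or> fst (snd l) = g + h * fst l" if "l \<in> L" "meets l m" for l
      proof -
        obtain a b c where l: "l = (a, b, c)" by (cases l)
        have "on1 (a, b, c) (dv P) + [:b:] * on1 (a, b, c) (dh P) = 0"
          using L(3)[OF that(1)] pderiv_on1[of a b c P] by (simp add: l)
        then have "poly (on1 (a, b, c) (dv P) + [:b:] * on1 (a, b, c) (dh P)) d = 0" by simp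
        then have "poly (on1 l (dv P)) (fst m) + b * poly (on1 l (dh P)) (fst m) = 0" by (simp add: l def)
        then have "poly \<phi> a + b * poly \<psi> a = 0"
          unfolding poly_on_meets[OF that(2)] by (simp add: \<phi>_def \<psi>_def l)
        then have "(b - (g + h * a)) * poly \<psi> a = 0" unfolding gh by (simp add: algebra_simps)
        then show ?thesis by (auto simp: l)
      qed
      have "{l \<in> L. meets l m} \<subseteq> {l \<in> L. poly \<psi> (fst l) = 0} \<union> {l \<in> L. meets l m \<and> fst (snd l) = g + h * fst l}"
        using * by auto
      then have "card {l \<in> L. meets l m} \<le> card ({l \<in> L. poly \<psi> (fst l) = 0} \<union> {l \<in> L. meets l m \<and> fst (snd l) = g + h * fst l})"
        using L(1) by (intro card_mono) auto
      also have "\<dots> \<le> card {l \<in> L. poly \<psi> (fst l) = 0} + card {l \<in> L. meets l m \<and> fst (snd l) = g + h * fst l}"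
        by (rule card_Un_le)
      also have "\<dots> \<le> s + k"
      proof (rule add_mono)
        have "card {l \<in> L. poly \<psi> (fst l) = 0} \<le> degree \<psi>"
          by (intro card_fst_roots[THEN conjunct2] \<psi>0 inj_on_subset[OF L(2)]) auto
        then show "card {l \<in> L. poly \<psi> (fst l) = 0} \<le> s" using deg by (simp add: s_def)
        show "card {l \<in> L. meets l m \<and> fst (snd l) = g + h * fst l} \<le> k"
          using k m by (auto simp: collinear_bound_def)
      qed
      finally show ?thesis by simp
    qed (rule off)
    then show ?thesis using cb by (intro exI[of _ bad]) (auto simp: bad_def s_def)
  qed
qed

text \<open>The collinearity bound k must be charged only once, although each component could cost
  k. A line off one of the two parts P and F meets at most as many lines of that part as its degree;
  the lines on both parts are few by Bezout and are declared exceptional. A repeated factor adds no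
  lines.\<close>

lemma surface:
  fixes F :: "'a::field_gcd poly3"
  assumes "F \<noteq> 0"
    and "\<And>n. 0 < n \<Longrightarrow> n \<le> 2 * tdeg F + 1 \<Longrightarrow> (of_nat n :: 'a) \<noteq> 0"
    and "finite L" "inj_on fst L" "\<And>l. l \<in> L \<Longrightarrow> on1 l F = 0"
    and "finite M" "inj_on fst M" and "collinear_bound k L M"
  shows "\<exists>bad\<subseteq>M. card bad \<le> 8 * (tdeg F)\<^sup>2 \<and> (\<forall>m\<in>M - bad. card {l \<in> L. meets l m} \<le> 2 * tdeg F + k)"
  using assms
proof (induction F arbitrary: L rule: prime_divisors_induct)
  case zero
  then show ?case by simp
next
  case (unit F)
  then obtain G where "F * G = 1" by (metis dvdE)
  \<comment> \<open>The restriction of a unit to a line is again a unit, hence not zero.\<close>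
  have "L = {}"
  proof (rule ccontr)
    assume "L \<noteq> {}"
    then obtain l where "l \<in> L" by blast
    then have "on1 l F * on1 l G = 0" using unit by simp
    then show False using \<open>F * G = 1\<close> by (metis on1_simps(2,4) zero_neq_one)
  qed
  then show ?case by (intro exI[of _ "{}"]) auto
next
  case (factor P F)
  have F0: "F \<noteq> 0" and P0: "P \<noteq> 0" using factor.prems by auto
  define s where "s = tdeg P"
  define t where "t = tdeg F"
  have st: "tdeg (P * F) = s + t" using tdeg_mult[OF P0 F0] by (simp add: s_def t_def)
  have prime: "prime_elem P" using factor.hyps by blast
  have ch: "(of_nat n :: 'a) \<noteq> 0" if "0 < n" "n \<le> 2 * (s + t) + 1" for n
    using factor.prems(2)[OF that(1)] that(2) st by simp
  note L = factor.prems(3,4) and M = factor.prems(6,7) and k = factor.prems(8)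
  have or: "on1 l P = 0 \<or> on1 l F = 0" if "l \<in> L" for l
    using factor.prems(5)[OF that] by (simp add: on1_simps)
  \<comment> \<open>The term 2 s t counts the lines common to both parts; it fits inside the mixed
    term of the square.\<close>
  have sq: "8 * s\<^sup>2 + 8 * t\<^sup>2 + 2 * s * t \<le> 8 * (s + t)\<^sup>2"
    by (simp add: power2_eq_square algebra_simps)
  show ?case
  proof (cases "P dvd F")
    case True
    then have "on1 l F = 0" if "l \<in> L" for l
      using or[OF that] by (auto simp: dvd_def on1_simps)
    then obtain bad where bad: "bad \<subseteq> M" "card bad \<le> 8 * t\<^sup>2" "\<forall>m\<in>M - bad. card {l \<in> L. meets l m} \<le> 2 * t + k"
      using factor.IH[OF F0 _ L _ M k] ch by (auto simp: t_def)
    have "card {l \<in> L. meets l m} \<le> 2 * (s + t) + k" if "m \<in> M - bad" for m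
    proof -
      have "card {l \<in> L. meets l m} \<le> 2 * t + k" using bad(3) that by blast
      then show ?thesis by simp
    qed
    moreover have "card bad \<le> 8 * (s + t)\<^sup>2" using bad(2) sq by linarith
    ultimately show ?thesis unfolding st using bad(1) by (intro exI[of _ bad]) auto
  next
    case False
    define L1 where "L1 = {l \<in> L. on1 l P = 0}"
    define L2 where "L2 = {l \<in> L. on1 l F = 0}"
    have L1: "finite L1" "inj_on fst L1" "collinear_bound k L1 M"
      using L k by (auto simp: L1_def intro: inj_on_subset collinear_bound_mono)
    have L2: "finite L2" "inj_on fst L2" "collinear_bound k L2 M"
      using L k by (auto simp: L2_def intro: inj_on_subset collinear_bound_mono)
    obtain bad1 where bad1: "bad1 \<subseteq> M" "card bad1 \<le> 8 * s\<^sup>2" "\<forall>m\<in>M - bad1. card {l \<in> L1. meets l m} \<le> 2 * s + k"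
      using prime_surface[OF _ prime L1(1,2) _ M L1(3)] ch by (auto simp: s_def L1_def)
    obtain bad2 where bad2: "bad2 \<subseteq> M" "card bad2 \<le> 8 * t\<^sup>2" "\<forall>m\<in>M - bad2. card {l \<in> L2. meets l m} \<le> 2 * t + k"
      using factor.IH[OF F0 _ L2(1,2) _ M L2(3)] ch by (auto simp: t_def L2_def)
    define bad3 where "bad3 = {m \<in> M. on2 m P = 0 \<and> on2 m F = 0}"
    have b3: "card bad3 \<le> 2 * s * t" unfolding s_def t_def
      using M by (intro bezout_lines[OF prime False]) (auto simp: bad3_def intro: inj_on_subset)
    define bad where "bad = bad1 \<union> bad2 \<union> bad3"
    have "card bad \<le> card bad1 + card bad2 + card bad3"
      unfolding bad_def by (meson add_mono_thms_linordered_semiring(3) card_Un_le order_trans)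
    then have c: "card bad \<le> 8 * (s + t)\<^sup>2" using bad1(2) bad2(2) b3 sq by linarith
    have "card {l \<in> L. meets l m} \<le> 2 * (s + t) + k" if m: "m \<in> M - bad" for m
    proof -
      have "{l \<in> L. meets l m} \<subseteq> {l \<in> L1. meets l m} \<union> {l \<in> L2. meets l m}"
        using or by (auto simp: L1_def L2_def)
      then have "card {l \<in> L. meets l m} \<le> card ({l \<in> L1. meets l m} \<union> {l \<in> L2. meets l m})"
        using L1(1) L2(1) by (intro card_mono) auto
      also have "\<dots> \<le> card {l \<in> L1. meets l m} + card {l \<in> L2. meets l m}" by (rule card_Un_le)
      finally have sum: "card {l \<in> L. meets l m} \<le> card {l \<in> L1. meets l m} + card {l \<in> L2. meets l m}" .
      have b: "card {l \<in> L1. meets l m} \<le> 2 * s + k" "card {l \<in> L2. meets l m} \<le> 2 * t + k"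
        using bad1(3) bad2(3) m by (auto simp: bad_def)
      have arith: "X \<le> 2 * (s + t) + k" if "X \<le> Y + Z" "Y \<le> s \<and> Z \<le> 2 * t + k \<or> Y \<le> 2 * s + k \<and> Z \<le> t" for X Y Z :: nat
        using that by (elim disjE conjE) (auto simp: distrib_left mult_2)
      have "on2 m P \<noteq> 0 \<or> on2 m F \<noteq> 0" using m by (auto simp: bad_def bad3_def)
      then show ?thesis
      proof
        assume "on2 m P \<noteq> 0"
        then have "card {l \<in> L1. meets l m} \<le> s" unfolding s_def
          by (rule card_meets_le_tdeg[OF _ L1(2)]) (simp add: L1_def)
        then show ?thesis using arith[OF sum] b by blast
      next
        assume "on2 m F \<noteq> 0"
        then have "card {l \<in> L2. meets l m} \<le> t" unfolding t_def
          by (rule card_meets_le_tdeg[OF _ L2(2)]) (simp add: L2_def)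
        then show ?thesis using arith[OF sum] b by blast
      qed
    qed
    moreover have "bad \<subseteq> M" using bad1(1) bad2(1) by (auto simp: bad_def bad3_def)
    ultimately show ?thesis unfolding st using c by (intro exI[of _ bad]) auto
  qed
qed

section \<open>The incidence bound\<close>

lemma on1_sum: "on1 l (sum f A) = (\<Sum>a\<in>A. on1 l (f a))"
  by (induction A rule: infinite_finite_induct) (auto simp: on1_simps)

text \<open>Parameter counting: (t + 1)^3 monomials with every exponent at most t, against 3 t + 1
  \<le> 3 (t + 1) coefficients to kill on each line.\<close>

lemma vanishing_surface:
  fixes L :: "('a::field \<times> 'a \<times> 'a) set"
  assumes "finite L" "3 * card L < (t + 1)\<^sup>2"
  shows "\<exists>F. F \<noteq> 0 \<and> tdeg F \<le> 3 * t \<and> (\<forall>l\<in>L. on1 l F = 0)"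
proof -
  define U where "U = {..t} \<times> {..t} \<times> {..t}"
  define E where "E = L \<times> {..3 * t}"
  define mo :: "'a \<Rightarrow> nat \<times> nat \<times> nat \<Rightarrow> 'a poly3" where
    "mo = (\<lambda>x (i, j, k). monom (monom (monom x i) j) k)"
  have fin: "finite U" "finite E" using assms(1) by (auto simp: U_def E_def)
  have "card E = card L * (3 * t + 1)" by (simp add: E_def card_cartesian_product)
  also have "\<dots> \<le> 3 * card L * (t + 1)" by simp
  also have "\<dots> < (t + 1)\<^sup>2 * (t + 1)" using assms(2) by (intro mult_strict_right_mono) auto
  also have "\<dots> = card U" by (simp add: U_def card_cartesian_product power2_eq_square)
  finally obtain x where x: "\<exists>u\<in>U. x u \<noteq> 0"
      "\<And>e. e \<in> E \<Longrightarrow> (\<Sum>u\<in>U. (case e of (l, r) \<Rightarrow> coeff (on1 l (mo 1 u)) r) * x u) = 0"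
    using homogeneous_system_nontrivial[OF fin(2,1), of "\<lambda>e u. case e of (l, r) \<Rightarrow> coeff (on1 l (mo 1 u)) r"] by blast
  define F where "F = (\<Sum>u\<in>U. mo (x u) u)"
  have c3F: "c3 F i j k = (if (i, j, k) \<in> U then x (i, j, k) else 0)" for i j k
  proof -
    have "c3 F i j k = (\<Sum>u\<in>U. if u = (i, j, k) then x (i, j, k) else 0)"
      unfolding F_def c3_sum by (intro sum.cong) (auto simp: mo_def c3_def split: if_splits)
    then show ?thesis using fin by simp
  qed
  have "F \<noteq> 0"
  proof
    assume "F = 0"
    then have "x (i, j, k) = 0" if "(i, j, k) \<in> U" for i j k using that c3F[of i j k] by (simp add: c3_def)
    then show False using x by (metis prod_cases3)
  qed
  moreover have td: "tdeg F \<le> 3 * t"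
    unfolding tdeg_le_iff c3F by (auto simp: U_def)
  moreover have "on1 l F = 0" if l: "l \<in> L" for l
  proof (rule poly_eqI)
    fix r
    have mo: "on1 l (mo y u) = [:y:] * on1 l (mo 1 u)" for y u
    proof -
      have "mo y u = [:[:[:y:]:]:] * mo 1 u" by (cases u) (simp add: mo_def smult_monom)
      moreover have "on1 l [:[:[:y:]:]:] = [:y:]"
      proof (rule poly_eqI)
        fix n show "coeff (on1 l [:[:[:y:]:]:]) n = coeff [:y:] n"
          using on1_const_coeff[of "fst l" "fst (snd l)" "snd (snd l)" "[:[:y:]:]" n]
          by (cases n) auto
      qed
      ultimately show ?thesis by (simp only: on1_simps)
    qed
    show "coeff (on1 l F) r = coeff 0 r"
    proof (cases "r \<le> 3 * t")
      case True
      have "coeff (on1 l F) r = (\<Sum>u\<in>U. coeff (on1 l (mo 1 u)) r * x u)"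
        unfolding F_def on1_sum mo[of "x _"] by (simp add: coeff_sum mult.commute)
      also have "\<dots> = 0" using x(2)[of "(l, r)"] l True by (simp add: E_def)
      finally show ?thesis by simp
    next
      case False
      then show ?thesis using degree_on(1)[of l F] td by (simp add: coeff_eq_0)
    qed
  qed
  ultimately show ?thesis by blast
qed

text \<open>The surface through all of L has degree at most 3 t with t^2 \<le> 3 |L|. This gives 216
  = 8 * 9 * 3 for the exceptional lines, and 6 t \<le> 6 sqrt 3 sqrt |L| \<le> 11 sqrt |L| for the
  others.\<close>

lemma incidence_step:
  fixes L M :: "('a::field_gcd \<times> 'a \<times> 'a) set"
  assumes ch: "\<And>j. 0 < j \<Longrightarrow> real j \<le> 11 * sqrt (card L) + 1 \<Longrightarrow> (of_nat j :: 'a) \<noteq> 0"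
    and L: "finite L" "inj_on fst L" and M: "finite M" "inj_on fst M" and k: "collinear_bound k L M"
  shows "\<exists>bad\<subseteq>M. card bad \<le> 216 * card L \<and> (\<forall>m\<in>M - bad. real (card {l \<in> L. meets l m}) \<le> 11 * sqrt (card L) + k)"
proof -
  define t where "t = nat \<lfloor>sqrt (3 * card L)\<rfloor>"
  have t1: "real t \<le> sqrt (3 * card L)" by (simp add: t_def)
  have t2: "sqrt (3 * card L) < real (t + 1)" unfolding t_def by simp linarith
  have "real (3 * card L) < (real (t + 1))\<^sup>2"
    using power_strict_mono[OF t2, of 2] by simp
  then have "3 * card L < (t + 1)\<^sup>2" by (metis of_nat_less_iff of_nat_power)
  then obtain F where F: "F \<noteq> 0" "tdeg F \<le> 3 * t" "\<And>l. l \<in> L \<Longrightarrow> on1 l F = 0"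
    using vanishing_surface[OF L(1)] by blast
  have "(real t)\<^sup>2 \<le> 3 * card L" using power_mono[OF t1, of 2] by simp
  then have tt: "t\<^sup>2 \<le> 3 * card L" by (metis of_nat_le_iff of_nat_power)
  have "sqrt 3 * 6 \<le> 11" by (rule power2_le_imp_le) (auto simp: power_mult_distrib)
  then have "6 * sqrt (3 * card L) \<le> 11 * sqrt (card L)"
    using mult_right_mono[of "sqrt 3 * 6" 11 "sqrt (card L)"] by (simp add: real_sqrt_mult)
  then have t6: "6 * real t \<le> 11 * sqrt (card L)" using t1 by linarith
  have "\<exists>bad\<subseteq>M. card bad \<le> 8 * (tdeg F)\<^sup>2 \<and> (\<forall>m\<in>M - bad. card {l \<in> L. meets l m} \<le> 2 * tdeg F + k)"
  proof (intro surface[OF F(1) _ L F(3) M k])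
    fix n assume "0 < n" "n \<le> 2 * tdeg F + 1"
    then have "real n \<le> 6 * real t + 1" using F(2) by linarith
    then show "(of_nat n :: 'a) \<noteq> 0" using ch[OF \<open>0 < n\<close>] t6 by linarith
  qed
  then obtain bad where bad: "bad \<subseteq> M" "card bad \<le> 8 * (tdeg F)\<^sup>2"
      "\<And>m. m \<in> M - bad \<Longrightarrow> card {l \<in> L. meets l m} \<le> 2 * tdeg F + k" by blast
  have "(tdeg F)\<^sup>2 \<le> (3 * t)\<^sup>2" using F(2) by (intro power_mono) auto
  then have "card bad \<le> 216 * card L" using bad(2) tt by (simp add: power_mult_distrib)
  moreover have "real (card {l \<in> L. meets l m}) \<le> 11 * sqrt (card L) + k" if "m \<in> M - bad" for m
    using bad(3)[OF that] F(2) t6 by linarith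
  ultimately show ?thesis using bad(1) by blast
qed

definition incidences :: "('a::idom \<times> 'a \<times> 'a) set \<Rightarrow> ('a \<times> 'a \<times> 'a) set \<Rightarrow> nat" where
  "incidences L M = (\<Sum>m\<in>M. card {l \<in> L. meets l m})"

lemma incidences_le: "finite L \<Longrightarrow> incidences L M \<le> card L * card M"
proof -
  assume "finite L"
  then have "card {l \<in> L. meets l m} \<le> card L" for m by (intro card_mono) auto
  then have "incidences L M \<le> (\<Sum>m\<in>M. card L)" unfolding incidences_def by (intro sum_mono)
  then show ?thesis by (simp add: mult.commute)
qed

text \<open>The bound on the exceptional lines is proportional to the number of lines put on the
  surface, so L has to be cut into small pieces before the recursion makes progress.\<close>

lemma incidences_split:
  assumes "finite L" "finite M" "card L \<le> q * x" "\<And>L'. L' \<subseteq> L \<Longrightarrow> card L' \<le> x \<Longrightarrow> real (incidences L' M) \<le> Y" "0 \<le> Y"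
  shows "real (incidences L M) \<le> q * Y"
  using assms
proof (induction q arbitrary: L)
  case 0
  then show ?case by (simp add: incidences_def)
next
  case (Suc q)
  obtain L1 where L1: "L1 \<subseteq> L" "card L1 = min x (card L)"
    by (metis min.cobounded2 obtain_subset_with_card_n)
  have f1: "finite L1" using L1(1) Suc.prems(1) finite_subset by blast
  have "card {l \<in> L. meets l m} \<le> card {l \<in> L1. meets l m} + card {l \<in> L - L1. meets l m}" for m
  proof -
    have "card {l \<in> L. meets l m} \<le> card ({l \<in> L1. meets l m} \<union> {l \<in> L - L1. meets l m})"
      using L1(1) Suc.prems(1) f1 by (intro card_mono) auto
    then show ?thesis using card_Un_le order_trans by blast
  qed
  then have "incidences L M \<le> incidences L1 M + incidences (L - L1) M"
    unfolding incidences_def sum.distrib[symmetric] by (intro sum_mono)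
  moreover have "real (incidences L1 M) \<le> Y" using Suc.prems(4)[OF L1(1)] L1(2) by simp
  moreover have "real (incidences (L - L1) M) \<le> q * Y"
  proof (rule Suc.IH)
    show "card (L - L1) \<le> q * x" using L1 f1 Suc.prems(3) by (simp add: card_Diff_subset)
  qed (use Suc.prems in auto)
  ultimately show ?case by (simp add: algebra_simps)
qed

text \<open>The exponent 7/6 instead of 1 absorbs the loss of a constant factor in the k-term at every level of the recursion, in which n shrinks by a much larger constant factor.\<close>

theorem incidence_bound:
  fixes L M :: "('a::field_gcd \<times> 'a \<times> 'a) set" and n k :: nat
  defines "K \<equiv> 22 * (432 * 864 ^ 6) :: real"
  assumes "\<And>j. 0 < j \<Longrightarrow> real j \<le> 11 * sqrt n + 1 \<Longrightarrow> (of_nat j :: 'a) \<noteq> 0"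
    and "finite L" "inj_on fst L" "finite M" "inj_on fst M" "collinear_bound k L M"
    and "card L \<le> n" "card M \<le> n"
  shows "real (incidences L M) \<le> K * real n powr (3/2) + K * k * real n powr (7/6)"
  using assms(2-)
proof (induction n arbitrary: L M rule: less_induct)
  case (less n)
  \<comment> \<open>Cutting into q pieces shrinks n to at most w n with w = 432/q = 864^(-6). Then q
    w^(7/6) = 1/2 and q w^(3/2) \<le> 1/2, so the recursion uses up half of K, while K/2 = 11 q pays
    for the unexceptional lines.\<close>
  define q :: nat where "q = 432 * 864 ^ 6"
  have Kq: "K = 22 * real q" by (simp add: K_def q_def)
  have n32: "real n powr (3/2) = n * sqrt n" if "n > 0"
    using that powr_add[of "real n" 1 "1/2"] by (simp add: powr_half_sqrt)
  have n76: "real n \<le> real n powr (7/6)" if "n > 0"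
    using that powr_mono[of 1 "7/6" "real n"] by simp
  consider "n = 0" | "0 < n" "n < q" | "n \<ge> q" by linarith
  then show ?case
  proof cases
    case 1
    then have "M = {}" using less.prems by simp
    then show ?thesis by (simp add: incidences_def K_def)
  next
    case 2
    \<comment> \<open>Below q the trivial bound suffices, as n^2 \<le> q n^(3/2).\<close>
    have "incidences L M \<le> n * n"
      using incidences_le[OF less.prems(2), of M] mult_le_mono[OF less.prems(7,8)] by linarith
    then have "real (incidences L M) \<le> n * n" by (metis of_nat_le_iff of_nat_mult)
    also have "\<dots> \<le> q * (n * sqrt n)"
    proof -
      have "real n * (real n * 1) \<le> real q * (real n * sqrt n)" using 2 by (intro mult_mono) auto
      then show ?thesis by simp
    qed
    also have "\<dots> \<le> K * real n powr (3/2)" using 2 n32 by (simp add: Kq)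
    also have "\<dots> \<le> K * real n powr (3/2) + K * k * real n powr (7/6)" by (simp add: K_def)
    finally show ?thesis .
  next
    case 3
    have q0: "q > 0" by (simp add: q_def)
    have n0: "n > 0" using 3 q0 by linarith
    \<comment> \<open>The added 1 rounds up, so that q pieces cover L. Since n div q is at least 1,
      it costs a factor of at most 2, hence 432 = 2 * 216.\<close>
    define x where "x = n div q + 1"
    have xq: "n \<le> q * x"
    proof -
      have "n = q * (n div q) + n mod q" by simp
      moreover have "n mod q < q" using q0 by simp
      ultimately show ?thesis unfolding x_def distrib_left by linarith
    qed
    have "n div q \<ge> 1" using 3 q0 by (simp add: div_greater_zero_iff Suc_le_eq)
    then have "real x \<le> 2 * real (n div q)" by (simp add: x_def)
    also have "\<dots> \<le> 2 * (real n / real q)" using of_nat_div_le_of_nat[of n q, where ?'a = real] by simp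
    finally have xn: "real x \<le> 2 * real n / q" by simp
    define w :: real where "w = (1/864) powr 6"
    have w6: "w = (1/864) ^ 6" unfolding w_def by (subst powr_numeral) auto
    have wq: "w * q = 432" unfolding w6 q_def by (simp add: power_divide)
    define n' where "n' = 216 * x"
    have n'w: "real n' \<le> w * n"
    proof -
      have "real n' \<le> 432 * real n / q" using xn by (simp add: n'_def)
      also have "\<dots> = w * n" using wq[symmetric] q0 by (simp add: field_simps)
      finally show ?thesis .
    qed
    have "w * n < 1 * real n" using n0 by (intro mult_strict_right_mono) (auto simp: w6 power_divide)
    then have n'n: "n' < n" using n'w by linarith
    define Y where "Y = n * (11 * sqrt n + k) + (K * real n' powr (3/2) + K * k * real n' powr (7/6))"
    have "real (incidences L' M) \<le> Y" if L': "L' \<subseteq> L" "card L' \<le> x" for L'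
    proof -
      have fL': "finite L'" "inj_on fst L'" "collinear_bound k L' M"
        using finite_subset[OF L'(1) less.prems(2)] inj_on_subset[OF less.prems(3) L'(1)]
          collinear_bound_mono[OF less.prems(6,2) L'(1)] by auto
      have xle: "card L' \<le> n" using L' n'n by (simp add: n'_def)
      have sq: "sqrt (card L') \<le> sqrt n" using xle by simp
      obtain bad where bad: "bad \<subseteq> M" "card bad \<le> 216 * card L'"
        "\<And>m. m \<in> M - bad \<Longrightarrow> real (card {l \<in> L'. meets l m}) \<le> 11 * sqrt (card L') + k"
      proof -
        have "(of_nat j :: 'a) \<noteq> 0" if "0 < j" "real j \<le> 11 * sqrt (card L') + 1" for j
          using less.prems(1)[OF that(1)] that(2) sq by linarith
        from incidence_step[OF this fL'(1,2) less.prems(4,5) fL'(3)] that show ?thesis by blast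
      qed
      have fb: "finite bad" by (rule finite_subset[OF bad(1) less.prems(4)])
      have sn': "sqrt (real n') \<le> sqrt (real n)" using n'n by simp
      have "real (incidences L' bad) \<le> K * real n' powr (3/2) + K * k * real n' powr (7/6)"
      proof (rule less.IH[OF n'n])
        show "(of_nat j :: 'a) \<noteq> 0" if "0 < j" "real j \<le> 11 * sqrt n' + 1" for j
          using less.prems(1)[OF that(1)] that(2) sn' by linarith
        show "card L' \<le> n'" "card bad \<le> n'" using L'(2) bad(2) by (auto simp: n'_def)
        show "inj_on fst bad" by (rule inj_on_subset[OF less.prems(5) bad(1)])
        show "collinear_bound k L' bad" by (rule collinear_bound_mono[OF fL'(3,1) order_refl bad(1)])
      qed (use fL' fb in auto)
      moreover have "real (incidences L' (M - bad)) \<le> n * (11 * sqrt n + k)"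
      proof -
        have "real (incidences L' (M - bad)) \<le> (\<Sum>m\<in>M - bad. 11 * sqrt n + k)"
          unfolding incidences_def of_nat_sum
        proof (rule sum_mono)
          fix m assume "m \<in> M - bad"
          then show "real (card {l \<in> L'. meets l m}) \<le> 11 * sqrt n + k" using bad(3)[of m] sq by linarith
        qed
        also have "\<dots> = card (M - bad) * (11 * sqrt n + k)" by simp
        also have "\<dots> \<le> n * (11 * sqrt n + k)"
          using less.prems(8) card_mono[of M "M - bad"] less.prems(4) by (intro mult_right_mono) auto
        finally show ?thesis .
      qed
      moreover have "incidences L' M = incidences L' bad + incidences L' (M - bad)"
        unfolding incidences_def using bad(1) less.prems(4) by (simp add: sum.subset_diff add.commute)
      ultimately show ?thesis by (simp add: Y_def)
    qed
    moreover have "Y \<ge> 0" by (simp add: Y_def K_def)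
    ultimately have "real (incidences L M) \<le> q * Y"
      using incidences_split[OF less.prems(2,4), of q x Y] xq less.prems(7) by force
    also have "\<dots> \<le> K * real n powr (3/2) + K * k * real n powr (7/6)"
    proof -
      have p1: "real n' powr (3/2) \<le> (1/864)^9 * real n powr (3/2)"
      proof -
        have "real n' powr (3/2) \<le> (w * n) powr (3/2)" using n'w by (intro powr_mono2) auto
        also have "\<dots> = w powr (3/2) * real n powr (3/2)" by (simp only: powr_mult)
        also have "w powr (3/2) = (1/864) powr 9" unfolding w_def powr_powr by simp
        also have "(1/864 :: real) powr 9 = (1/864)^9" by (subst powr_numeral) auto
        finally show ?thesis .
      qed
      have p2: "real n' powr (7/6) \<le> (1/864)^7 * real n powr (7/6)"
      proof -
        have "real n' powr (7/6) \<le> (w * n) powr (7/6)" using n'w by (intro powr_mono2) auto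
        also have "\<dots> = w powr (7/6) * real n powr (7/6)" by (simp only: powr_mult)
        also have "w powr (7/6) = (1/864) powr 7" unfolding w_def powr_powr by simp
        also have "(1/864 :: real) powr 7 = (1/864)^7" by (subst powr_numeral) auto
        finally show ?thesis .
      qed
      define N3 where "N3 = real n powr (3/2)"
      define N7 where "N7 = real n powr (7/6)"
      have N: "N3 \<ge> 0" "N7 \<ge> 0" "n * sqrt n = N3" "real n \<le> N7"
        using n32[OF n0] n76[OF n0] by (auto simp: N3_def N7_def)
      have a: "q * (K * real n' powr (3/2)) \<le> 1/2 * (K * N3)"
      proof -
        have "q * (K * real n' powr (3/2)) \<le> q * (K * ((1/864)^9 * N3))"
          using p1 by (intro mult_left_mono) (auto simp: K_def N3_def)
        also have "\<dots> = (q * (1/864)^9) * (K * N3)" by simp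
        also have "\<dots> \<le> 1/2 * (K * N3)" using N by (intro mult_right_mono) (auto simp: q_def K_def power_divide)
        finally show ?thesis .
      qed
      have b: "q * (K * k * real n' powr (7/6)) \<le> 1/2 * (K * k * N7)"
      proof -
        have "q * (K * k * real n' powr (7/6)) \<le> q * (K * k * ((1/864)^7 * N7))"
          using p2 by (intro mult_left_mono) (auto simp: K_def N7_def)
        also have "\<dots> = (q * (1/864)^7) * (K * k * N7)" by simp
        also have "\<dots> = 1/2 * (K * k * N7)" by (simp add: q_def power_divide)
        finally show ?thesis by simp
      qed
      have c: "q * (n * (11 * sqrt n + k)) \<le> 1/2 * (K * N3) + 1/2 * (K * k * N7)"
      proof -
        have e1: "q * (n * (11 * sqrt n + k)) = 11 * q * N3 + q * k * n" by (simp add: N(3)[symmetric] algebra_simps)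
        have e2: "q * k * real n \<le> 11 * q * k * N7"
          using mult_mono[of "real (q * k)" "11 * real (q * k)" "real n" N7] N by simp
        show ?thesis unfolding e1 using e2 by (simp add: Kq algebra_simps)
      qed
      have "q * Y = q * (n * (11 * sqrt n + k)) + (q * (K * real n' powr (3/2)) + q * (K * k * real n' powr (7/6)))"
        by (simp add: Y_def algebra_simps)
      also have "\<dots> \<le> K * N3 + K * k * N7" using a b c by linarith
      finally show ?thesis by (simp add: N3_def N7_def)
    qed
    finally show ?thesis .
  qed
qed

section \<open>Expansion of x + (y - z)^2 over a field\<close>

lemma exists_non_root:
  fixes Q :: "'a::idom poly set"
  assumes "infinite (UNIV :: 'a set)" "finite Q" "0 \<notin> Q"
  shows "\<exists>t. \<forall>q\<in>Q. poly q t \<noteq> 0"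
proof -
  have "prod id Q \<noteq> 0" using assms(2,3) by (simp add: prod_zero_iff)
  then have "finite {t. poly (prod id Q) t = 0}" by (rule poly_roots_finite)
  then obtain t where "poly (prod id Q) t \<noteq> 0" using assms(1) by (metis (mono_tags, lifting) ex_new_if_finite mem_Collect_eq)
  then show ?thesis using assms(2) by (auto simp: poly_prod prod_zero_iff)
qed

text \<open>A projective change of coordinates depending on a parameter t, under which the point (y, z, x + y^2 - z^2) becomes a line of the first family and the dual plane one of the second. A generic t separates the planes u = const and v = const containing them.\<close>

definition line1 :: "'a::field \<Rightarrow> 'a \<times> 'a \<times> 'a \<Rightarrow> 'a \<times> 'a \<times> 'a" where
  "line1 t = (\<lambda>(x, y, z). ((x + y\<^sup>2 - z\<^sup>2 + t * z + t ^ 4) / (y + t\<^sup>2), z / (y + t\<^sup>2), 1 / (y + t\<^sup>2)))"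

definition den2 :: "'a::field \<Rightarrow> 'a \<times> 'a \<times> 'a \<Rightarrow> 'a" where
  "den2 t = (\<lambda>(x, y, z). - (x + y\<^sup>2 - z\<^sup>2) + 2 * z * t\<^sup>2 - t ^ 4)"

definition line2 :: "'a::field \<Rightarrow> 'a \<times> 'a \<times> 'a \<Rightarrow> 'a \<times> 'a \<times> 'a" where
  "line2 t q = (case q of (x, y, z) \<Rightarrow> ((2 * y - t) / den2 t q, - 1 / den2 t q, 2 * z / den2 t q))"

text \<open>These are the coefficients in t of the cross-multiplied difference of two first
  coordinates, after the t^6 terms cancel. The powers of t in \<open>line1\<close> are spread so
  that the differences of X, z and y each appear as a coefficient of their own.\<close>

lemma line1_fst_inj_poly:
  fixes x y z x' y' z' :: "'a::field"
  assumes "(x, y, z) \<noteq> (x', y', z')"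
  defines "X \<equiv> x + y\<^sup>2 - z\<^sup>2" and "X' \<equiv> x' + y'\<^sup>2 - z'\<^sup>2"
  shows "[:X * y' - X' * y, z * y' - z' * y, X - X', z - z', y' - y:] \<noteq> 0"
proof
  assume "[:X * y' - X' * y, z * y' - z' * y, X - X', z - z', y' - y:] = 0"
  then have "X = X'" "z = z'" "y = y'" by (simp_all only: pCons_eq_0_iff right_minus_eq)
  then show False using assms by simp
qed

text \<open>The same separation for the dual family: the t^5 terms cancel, and the coefficients at
  t, t^3 and t^4 are the differences of X, z and y up to signs and factors 2.\<close>

lemma line2_fst_inj_poly:
  fixes x y z x' y' z' :: "'a::field"
  assumes "(x, y, z) \<noteq> (x', y', z')" "(2::'a) \<noteq> 0"
  defines "X \<equiv> x + y\<^sup>2 - z\<^sup>2" and "X' \<equiv> x' + y'\<^sup>2 - z'\<^sup>2"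
  shows "[:2 * (y' * X - y * X'), X' - X, 4 * (y * z' - y' * z), 2 * (z - z'), 2 * (y' - y):] \<noteq> 0"
proof
  assume "[:2 * (y' * X - y * X'), X' - X, 4 * (y * z' - y' * z), 2 * (z - z'), 2 * (y' - y):] = 0"
  then have "X' = X" "z = z'" "y' = y" using assms(2) by (simp_all only: pCons_eq_0_iff right_minus_eq mult_eq_0_iff) auto
  then show False using assms by simp
qed

text \<open>Every requirement on t excludes the roots of finitely many nonzero polynomials, one per
  point or per pair of distinct points, and an infinite field has an element outside all of
  them.\<close>

lemma generic_parameter:
  fixes S :: "('a::field \<times> 'a \<times> 'a) set"
  assumes inf: "infinite (UNIV :: 'a set)" and S: "finite S" and two: "(2::'a) \<noteq> 0"
  shows "\<exists>t. (\<forall>(x, y, z)\<in>S. y + t\<^sup>2 \<noteq> 0) \<and> (\<forall>q\<in>S. den2 t q \<noteq> 0)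
     \<and> inj_on (fst \<circ> line1 t) S \<and> inj_on (fst \<circ> line2 t) S"
proof -
  define Q1 :: "'a poly set" where "Q1 = (\<lambda>(x, y, z). [:y, 0, 1:]) ` S"
  define Q2 :: "'a poly set" where "Q2 = (\<lambda>(x, y, z). [:- (x + y\<^sup>2 - z\<^sup>2), 0, 2 * z, 0, - 1:]) ` S"
  define D where "D = {(p, q) \<in> S \<times> S. p \<noteq> q}"
  define f3 :: "('a \<times> 'a \<times> 'a) \<times> ('a \<times> 'a \<times> 'a) \<Rightarrow> 'a poly" where "f3 = (\<lambda>((x, y, z), (x', y', z')). [:(x + y\<^sup>2 - z\<^sup>2) * y' - (x' + y'\<^sup>2 - z'\<^sup>2) * y, z * y' - z' * y,
      (x + y\<^sup>2 - z\<^sup>2) - (x' + y'\<^sup>2 - z'\<^sup>2), z - z', y' - y:])"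
  define f4 :: "('a \<times> 'a \<times> 'a) \<times> ('a \<times> 'a \<times> 'a) \<Rightarrow> 'a poly" where "f4 = (\<lambda>((x, y, z), (x', y', z')). [:2 * (y' * (x + y\<^sup>2 - z\<^sup>2) - y * (x' + y'\<^sup>2 - z'\<^sup>2)),
      (x' + y'\<^sup>2 - z'\<^sup>2) - (x + y\<^sup>2 - z\<^sup>2), 4 * (y * z' - y' * z), 2 * (z - z'), 2 * (y' - y):])"
  have "finite D" by (rule finite_subset[of _ "S \<times> S"]) (auto simp: D_def S)
  then have finQ: "finite (Q1 \<union> Q2 \<union> f3 ` D \<union> f4 ` D)" using S by (simp add: Q1_def Q2_def)
  have f34: "f3 (p, q) \<noteq> 0 \<and> f4 (p, q) \<noteq> 0" if "p \<noteq> q" for p q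
  proof -
    obtain x y z x' y' z' where e: "p = (x, y, z)" "q = (x', y', z')" by (cases p; cases q)
    show ?thesis unfolding e f3_def f4_def prod.case
      using line1_fst_inj_poly[of x y z x' y' z'] line2_fst_inj_poly[of x y z x' y' z', OF _ two] that e by blast
  qed
  have "0 \<notin> f3 ` D" "0 \<notin> f4 ` D" unfolding D_def using f34 by (force simp: image_iff)+
  moreover have "0 \<notin> Q1" "0 \<notin> Q2" unfolding Q1_def Q2_def by auto
  ultimately have nz: "0 \<notin> Q1 \<union> Q2 \<union> f3 ` D \<union> f4 ` D" by (simp only: Un_iff simp_thms)
  obtain t where t0: "\<forall>q\<in>Q1 \<union> Q2 \<union> f3 ` D \<union> f4 ` D. poly q t \<noteq> 0"
    using exists_non_root[OF inf finQ nz] ..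
  note t = bspec[OF t0]
  have 1: "y + t\<^sup>2 \<noteq> 0" if "(x, y, z) \<in> S" for x y z
  proof -
    have "[:y, 0, 1:] \<in> Q1" using that by (force simp: Q1_def)
    then show ?thesis using t[of "[:y, 0, 1:]"] by (simp add: power2_eq_square)
  qed
  have 2: "den2 t q \<noteq> 0" if "q \<in> S" for q
  proof -
    obtain x y z where q: "q = (x, y, z)" by (cases q)
    have "[:- (x + y\<^sup>2 - z\<^sup>2), 0, 2 * z, 0, - 1:] \<in> Q2" using that q by (force simp: Q2_def)
    then show ?thesis using t[of "[:- (x + y\<^sup>2 - z\<^sup>2), 0, 2 * z, 0, - 1:]"]
      by (simp add: q den2_def power2_eq_square power4_eq_xxxx algebra_simps)
  qed
  have 3: "inj_on (fst \<circ> line1 t) S"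
  proof (rule inj_onI, rule ccontr)
    fix p q assume pq: "p \<in> S" "q \<in> S" "(fst \<circ> line1 t) p = (fst \<circ> line1 t) q" "p \<noteq> q"
    obtain x y z x' y' z' where e: "p = (x, y, z)" "q = (x', y', z')" by (cases p; cases q)
    have n: "y + t\<^sup>2 \<noteq> 0" "y' + t\<^sup>2 \<noteq> 0" using 1 pq e by blast+
    have "(x + y\<^sup>2 - z\<^sup>2 + t * z + t ^ 4) * (y' + t\<^sup>2) = (x' + y'\<^sup>2 - z'\<^sup>2 + t * z' + t ^ 4) * (y + t\<^sup>2)"
      using pq(3) n by (simp add: e line1_def frac_eq_eq)
    then have "poly (f3 (p, q)) t = 0" unfolding e f3_def by (simp add: power2_eq_square power4_eq_xxxx) Groebner_Basis.algebra
    moreover have "f3 (p, q) \<in> f3 ` D" using pq by (auto simp: D_def)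
    ultimately show False using t[of "f3 (p, q)"] by (simp only: Un_iff simp_thms)
  qed
  have 4: "inj_on (fst \<circ> line2 t) S"
  proof (rule inj_onI, rule ccontr)
    fix p q assume pq: "p \<in> S" "q \<in> S" "(fst \<circ> line2 t) p = (fst \<circ> line2 t) q" "p \<noteq> q"
    obtain x y z x' y' z' where e: "p = (x, y, z)" "q = (x', y', z')" by (cases p; cases q)
    have n: "den2 t p \<noteq> 0" "den2 t q \<noteq> 0" using 2 pq by blast+
    have "(2 * y - t) * den2 t q = (2 * y' - t) * den2 t p"
      using pq(3) n by (simp add: e line2_def frac_eq_eq)
    then have "poly (f4 (p, q)) t = 0" unfolding e f4_def den2_def by (simp add: power2_eq_square power4_eq_xxxx) Groebner_Basis.algebra
    moreover have "f4 (p, q) \<in> f4 ` D" using pq by (auto simp: D_def)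
    ultimately show False using t[of "f4 (p, q)"] by (simp only: Un_iff simp_thms)
  qed
  show ?thesis using 1 2 3 4 by (intro exI[of _ t]) auto
qed

text \<open>Expanded, the equation is linear in (y, z, x + y^2 - z^2) and in (y', z', x' + y'^2 -
  z'^2) separately. Pairing y with z' makes this possible: each square can be moved to its own
  triple, and only the products y z' and y' z mix the two.\<close>

lemma meets_line1_line2:
  fixes x y z :: "'a::field"
  assumes "y + t\<^sup>2 \<noteq> 0" "den2 t (x', y', z') \<noteq> 0"
  shows "meets (line1 t (x, y, z)) (line2 t (x', y', z')) \<longleftrightarrow> x + (y - z')\<^sup>2 = x' + (y' - z)\<^sup>2"
proof -
  define n where "n = den2 t (x', y', z')"
  define w where "w = y + t\<^sup>2"
  have nz: "n \<noteq> 0" "w \<noteq> 0" using assms by (auto simp: n_def w_def)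
  have "meets (line1 t (x, y, z)) (line2 t (x', y', z')) \<longleftrightarrow>
      z / w * ((2 * y' - t) / n) + 1 / w = - 1 / n * ((x + y\<^sup>2 - z\<^sup>2 + t * z + t ^ 4) / w) + 2 * z' / n"
    by (simp add: meets_def line1_def line2_def n_def w_def mult.commute)
  also have "\<dots> \<longleftrightarrow> z * (2 * y' - t) + n = - (x + y\<^sup>2 - z\<^sup>2 + t * z + t ^ 4) + 2 * z' * w"
    using nz by (simp add: field_simps)
  also have "\<dots> \<longleftrightarrow> x + (y - z')\<^sup>2 = x' + (y' - z)\<^sup>2"
    unfolding n_def den2_def w_def by (auto simp: power2_eq_square) Groebner_Basis.algebra+
  finally show ?thesis .
qed


text \<open>Inserting the incidence equation into the linear law leaves one relation
  \<open>al\<close> z = \<open>be\<close> y + \<open>ga\<close>. It fixes z by y or y by z, and the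
  incidence equation then fixes x, so at most |A| triples remain. If \<open>al\<close> and
  \<open>be\<close> both vanish, then h is nonzero and \<open>ga\<close> is -h times
  \<open>den2\<close>, which is not zero, so there is no triple at all.\<close>

lemma collinear_bound_lines:
  fixes A D :: "'a::field set"
  assumes fin: "finite A" "finite D"
  defines "S \<equiv> D \<times> A \<times> A"
  assumes den1: "\<And>x y z. (x, y, z) \<in> S \<Longrightarrow> y + t\<^sup>2 \<noteq> 0" and den2: "\<And>q. q \<in> S \<Longrightarrow> den2 t q \<noteq> 0"
  shows "collinear_bound (card A) (line1 t ` S) (line2 t ` S)"
  unfolding collinear_bound_def
proof (intro ballI allI)
  fix m g h assume "m \<in> line2 t ` S"
  then obtain x' y' z' where q: "(x', y', z') \<in> S" "m = line2 t (x', y', z')" by auto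
  define X' where "X' = x' + y'\<^sup>2 - z'\<^sup>2"
  define W where "W = {p \<in> S. meets (line1 t p) m \<and> fst (snd (line1 t p)) = g + h * fst (line1 t p)}"
  define al where "al = 1 - h * t + 2 * h * y'"
  define be where "be = g + 2 * z' * h"
  define ga where "ga = g * t\<^sup>2 + h * (X' + t ^ 4)"
  have W: "x + (y - z')\<^sup>2 = x' + (y' - z)\<^sup>2 \<and> al * z = be * y + ga" if "(x, y, z) \<in> W" for x y z
  proof -
    have S: "(x, y, z) \<in> S" using that by (simp add: W_def)
    have 1: "x + (y - z')\<^sup>2 = x' + (y' - z)\<^sup>2"
      using that q meets_line1_line2[OF den1[OF S] den2[OF q(1)]] by (simp add: W_def)
    have "z / (y + t\<^sup>2) = g + h * ((x + y\<^sup>2 - z\<^sup>2 + t * z + t ^ 4) / (y + t\<^sup>2))"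
      using that by (simp add: W_def line1_def)
    then have "z = g * (y + t\<^sup>2) + h * (x + y\<^sup>2 - z\<^sup>2 + t * z + t ^ 4)"
      using den1[OF S] by (simp add: field_simps)
    moreover have "x + y\<^sup>2 - z\<^sup>2 = X' + 2 * z' * y - 2 * y' * z"
      using 1 unfolding X'_def by (simp add: power2_eq_square) Groebner_Basis.algebra
    ultimately show ?thesis using 1 unfolding al_def be_def ga_def by (simp add: algebra_simps)
  qed
  have finS: "finite S" using fin by (simp add: S_def)
  have WA: "y \<in> A \<and> z \<in> A" if "(x, y, z) \<in> W" for x y z using that by (simp add: W_def S_def)
  have "card W \<le> card A"
  proof (cases "al = 0")
    case False
    have "inj_on (\<lambda>(x, y, z). y) W"
    proof (rule inj_onI)
      fix p q assume a: "p \<in> W" "q \<in> W" "(\<lambda>(x, y, z). y) p = (\<lambda>(x, y, z). y) q"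
      obtain x1 y1 z1 x2 y2 z2 where e: "p = (x1, y1, z1)" "q = (x2, y2, z2)" by (cases p; cases q)
      note w = W[OF a(1)[unfolded e]] W[OF a(2)[unfolded e]]
      have y: "y1 = y2" using a(3) e by simp
      have "al * z1 = al * z2" using w y by simp
      then have z: "z1 = z2" using False by simp
      have "x1 = x2" using w y z by (metis add_right_cancel)
      then show "p = q" using e y z by simp
    qed
    moreover have "(\<lambda>(x, y, z). y) ` W \<subseteq> A" using WA by auto
    ultimately show ?thesis using fin(1) by (rule card_inj_on_le)
  next
    case True
    show ?thesis
    proof (cases "be = 0")
      case False
      have "inj_on (\<lambda>(x, y, z). z) W"
      proof (rule inj_onI)
        fix p q assume a: "p \<in> W" "q \<in> W" "(\<lambda>(x, y, z). z) p = (\<lambda>(x, y, z). z) q"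
        obtain x1 y1 z1 x2 y2 z2 where e: "p = (x1, y1, z1)" "q = (x2, y2, z2)" by (cases p; cases q)
        note w = W[OF a(1)[unfolded e]] W[OF a(2)[unfolded e]]
        have z: "z1 = z2" using a(3) e by simp
        have "be * y1 + ga = be * y2 + ga" using w z by metis
        then have y: "y1 = y2" using False by simp
        have "x1 = x2" using w y z by (metis add_right_cancel)
        then show "p = q" using e y z by simp
      qed
      moreover have "(\<lambda>(x, y, z). z) ` W \<subseteq> A" using WA by auto
      ultimately show ?thesis using fin(1) by (rule card_inj_on_le)
    next
      case be: True
      have "ga = - h * den2 t (x', y', z')"
        using be unfolding ga_def be_def den2_def X'_def prod.case by Groebner_Basis.algebra
      moreover have "h \<noteq> 0" using True by (auto simp: al_def)
      ultimately have "ga \<noteq> 0" using den2[OF q(1)] by simp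
      then have "W = {}" using W True be by fastforce
      then show ?thesis by simp
    qed
  qed
  moreover have "{l \<in> line1 t ` S. meets l m \<and> fst (snd l) = g + h * fst l} = line1 t ` W"
    by (auto simp: W_def)
  moreover have "finite W" using finS by (simp add: W_def)
  ultimately show "card {l \<in> line1 t ` S. meets l m \<and> fst (snd l) = g + h * fst l} \<le> card A"
    by (metis card_image_le order_trans)
qed

text \<open>Cauchy-Schwarz gives N^2 \<le> E |T|, where E counts the pairs among the N triples with
  equal values and T is the set of values. As |A| \<le> 2 N^(1/3), the collinear term of the
  incidence bound is at most 2 K N^(3/2), so E \<le> 3 K N^(3/2); the constant 66 is 3 * 22.\<close>

theorem expansion_field:
  fixes A D :: "'a::field_gcd set"
  defines "N \<equiv> card A ^ 2 * card D"
  assumes inf: "infinite (UNIV :: 'a set)" and two: "(2::'a) \<noteq> 0"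
    and ch: "\<And>j. 0 < j \<Longrightarrow> real j \<le> 11 * sqrt N + 1 \<Longrightarrow> (of_nat j :: 'a) \<noteq> 0"
    and fin: "finite A" "finite D" and AD: "card A \<le> 2 * card D"
  shows "sqrt N \<le> 66 * (432 * 864 ^ 6) * card {x + (y - z)\<^sup>2 | x y z. x \<in> D \<and> y \<in> A \<and> z \<in> A}"
proof (cases "N = 0")
  case False
  define K :: real where "K = 22 * (432 * 864 ^ 6)"
  define S where "S = D \<times> A \<times> A"
  define T where "T = {x + (y - z)\<^sup>2 | x y z. x \<in> D \<and> y \<in> A \<and> z \<in> A}"
  have finS: "finite S" using fin by (simp add: S_def)
  have cS: "card S = N" by (simp add: S_def N_def card_cartesian_product power2_eq_square)
  obtain t where t: "\<And>x y z. (x, y, z) \<in> S \<Longrightarrow> y + t\<^sup>2 \<noteq> 0" "\<And>q. q \<in> S \<Longrightarrow> den2 t q \<noteq> 0"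
     "inj_on (fst \<circ> line1 t) S" "inj_on (fst \<circ> line2 t) S"
    using generic_parameter[OF inf finS two] by blast
  define L where "L = line1 t ` S"
  define M where "M = line2 t ` S"
  have inj: "inj_on (line1 t) S" "inj_on (line2 t) S" using t(3,4) inj_on_imageI2 by blast+
  have LM: "finite L" "inj_on fst L" "finite M" "inj_on fst M" "card L \<le> N" "card M \<le> N"
    using finS t(3,4) inj_on_imageI[of fst] cS card_image_le[OF finS] by (auto simp: L_def M_def)
  have cb: "collinear_bound (card A) L M"
    unfolding L_def M_def S_def by (intro collinear_bound_lines fin t[unfolded S_def])
  have I: "real (incidences L M) \<le> K * real N powr (3/2) + K * card A * real N powr (7/6)"
    unfolding K_def using ch by (intro incidence_bound LM cb)
  define f where "f = (\<lambda>(x, y, z). x + (y - z)\<^sup>2 :: 'a)"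
  have fT: "f ` S = T" by (force simp: f_def S_def T_def)
  have finT: "finite T" using finS fT by (metis finite_imageI)
  define r where "r = (\<lambda>v. card {p \<in> S. f p = v})"
  have "(\<Sum>v\<in>T. r v) = N"
  proof -
    have "card S = (\<Sum>v\<in>T. card {p \<in> S. f p = v})"
      using sum.image_gen[OF finS, of "\<lambda>_. 1 :: nat" f] by (simp add: fT)
    then show ?thesis by (simp add: r_def cS)
  qed
  then have "(real N)\<^sup>2 \<le> (\<Sum>v\<in>T. (real (r v))\<^sup>2) * card T"
    using sum_squared_le_sum_of_squares[of "\<lambda>v. real (r v)" T] by (metis of_nat_sum)
  also have "(\<Sum>v\<in>T. (real (r v))\<^sup>2) = real (incidences L M)"
  proof -
    define PR where "PR = {(p, q) \<in> S \<times> S. f p = f q}"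
    have "PR = (\<Union>v\<in>T. {p \<in> S. f p = v} \<times> {p \<in> S. f p = v})" using fT by (auto simp: PR_def)
    then have "card PR = (\<Sum>v\<in>T. card ({p \<in> S. f p = v} \<times> {p \<in> S. f p = v}))"
      using finT finS by (simp only:, intro card_UN_disjoint) auto
    then have c1: "card PR = (\<Sum>v\<in>T. (r v)\<^sup>2)" by (simp add: r_def card_cartesian_product power2_eq_square)
    define PM where "PM = {(p, q) \<in> S \<times> S. meets (line1 t p) (line2 t q)}"
    \<comment> \<open>Exchanging z and z' turns equality of two values into the incidence relation;
      the pair stays in S \<times> S because both range over A.\<close>
    have "bij_betw (\<lambda>((x, y, z), (x', y', z')). ((x, y, z'), (x', y', z))) PR PM"
      by (rule bij_betw_byWitness[where f' = "\<lambda>((x, y, z), (x', y', z')). ((x, y, z'), (x', y', z))"])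
        (auto simp: PR_def PM_def f_def S_def t meets_line1_line2[OF t(1) t(2)])
    then have "card PR = card PM" by (rule bij_betw_same_card)
    also have "card PM = (\<Sum>q\<in>S. card {p \<in> S. meets (line1 t p) (line2 t q)})"
    proof -
      have "PM = (\<lambda>(q, p). (p, q)) ` (SIGMA q:S. {p \<in> S. meets (line1 t p) (line2 t q)})"
        by (force simp: PM_def)
      then have "card PM = card (SIGMA q:S. {p \<in> S. meets (line1 t p) (line2 t q)})"
        by (simp only:, intro card_image) (auto simp: inj_on_def)
      then show ?thesis using finS by simp
    qed
    also have "\<dots> = (\<Sum>q\<in>S. card {l \<in> L. meets l (line2 t q)})"
    proof (rule sum.cong)
      fix q
      have "{l \<in> L. meets l (line2 t q)} = line1 t ` {p \<in> S. meets (line1 t p) (line2 t q)}" by (auto simp: L_def)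
      then show "card {p \<in> S. meets (line1 t p) (line2 t q)} = card {l \<in> L. meets l (line2 t q)}"
        using inj(1) by (simp add: card_image inj_on_subset)
    qed simp
    also have "\<dots> = incidences L M" unfolding incidences_def M_def using inj(2) by (simp add: sum.reindex)
    finally show ?thesis using c1 by (simp flip: of_nat_power of_nat_sum)
  qed
  also have "\<dots> * card T \<le> (3 * K * real N powr (3/2)) * card T"
  proof (rule mult_right_mono)
    have N0: "real N > 0" using False by simp
    have "card A \<le> 2 * real N powr (1/3)"
    proof -
      have "real (card A) ^ 3 \<le> 8 * real N"
      proof -
        have "real (card A) ^ 3 = real (card A) ^ 2 * real (card A)" by (simp add: power3_eq_cube power2_eq_square)
        also have "\<dots> \<le> real (card A) ^ 2 * (8 * real (card D))" using AD by (intro mult_left_mono) auto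
        finally show ?thesis by (simp add: N_def)
      qed
      then have "(real (card A) ^ 3) powr (1/3) \<le> (8 * real N) powr (1/3)" by (intro powr_mono2) auto
      also have "(8 * real N) powr (1/3) = 8 powr (1/3) * real N powr (1/3)" by (rule powr_mult)
      also have "(8::real) powr (1/3) = 2" using powr_powr[of 2 3 "1/3"] by simp
      also have "(real (card A) ^ 3) powr (1/3) = real (card A)"
      proof (cases "card A = 0")
        case False
        then show ?thesis using powr_powr[of "real (card A)" 3 "1/3"] by (simp add: powr_realpow)
      qed simp
      finally show ?thesis .
    qed
    then have "K * card A * real N powr (7/6) \<le> K * (2 * real N powr (1/3)) * real N powr (7/6)"
      by (intro mult_right_mono mult_left_mono) (auto simp: K_def)
    also have "\<dots> = 2 * K * real N powr (3/2)"
      using powr_add[of "real N" "1/3" "7/6"] by simp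
    finally show "real (incidences L M) \<le> 3 * K * real N powr (3/2)" using I by simp
  qed simp
  finally have "(real N)\<^sup>2 \<le> 3 * K * real N powr (3/2) * card T" .
  moreover have "(real N)\<^sup>2 = real N powr (3/2) * sqrt N"
    using powr_add[of "real N" "3/2" "1/2"] by (simp add: powr_half_sqrt)
  ultimately have "real N powr (3/2) * sqrt N \<le> real N powr (3/2) * (3 * K * card T)" by (simp add: mult_ac)
  then have "sqrt N \<le> 3 * K * card T" using False by (simp add: mult_le_cancel_left)
  then show ?thesis by (simp add: K_def T_def)
qed simp

section \<open>Expansion modulo a prime\<close>

text \<open>The trivial Euclidean structure of a field. It leads to \<open>field_gcd\<close> for
  fraction fields, so that polynomials over them have the prime factorizations on which the
  induction over components rests.\<close>

instantiation fract :: (idom)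
  "{unique_euclidean_ring, normalization_euclidean_semiring, normalization_semidom_multiplicative}"
begin
definition [simp]: "normalize_fract = (normalize_field :: 'a fract \<Rightarrow> _)"
definition [simp]: "unit_factor_fract = (unit_factor_field :: 'a fract \<Rightarrow> _)"
definition [simp]: "modulo_fract = (mod_field :: 'a fract \<Rightarrow> _)"
definition [simp]: "euclidean_size_fract = (euclidean_size_field :: 'a fract \<Rightarrow> _)"
definition [simp]: "division_segment (x :: 'a fract) = 1"
instance by standard (simp_all add: dvd_field_iff field_split_simps split: if_splits)
end

instantiation fract :: (idom) euclidean_ring_gcd
begin
definition "(gcd :: 'a fract \<Rightarrow> _) = Euclidean_Algorithm.gcd"
definition "(lcm :: 'a fract \<Rightarrow> _) = Euclidean_Algorithm.lcm"
definition "(Gcd :: 'a fract set \<Rightarrow> _) = Euclidean_Algorithm.Gcd"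
definition "(Lcm :: 'a fract set \<Rightarrow> _) = Euclidean_Algorithm.Lcm"
instance by standard (simp_all add: gcd_fract_def lcm_fract_def Gcd_fract_def Lcm_fract_def)
end

instance fract :: (idom) field_gcd ..

lemma infinite_rational_functions: "infinite (UNIV :: 'a::idom poly fract set)"
proof -
  have "inj (\<lambda>n. to_fract (monom 1 n) :: 'a poly fract)"
  proof (rule injI)
    fix m n assume "to_fract (monom 1 m :: 'a poly) = to_fract (monom 1 n)"
    then have "degree (monom 1 m :: 'a poly) = degree (monom 1 n :: 'a poly)" by simp
    then show "m = n" by (simp add: degree_monom_eq)
  qed
  then have "infinite (range (\<lambda>n. to_fract (monom 1 n) :: 'a poly fract))" by (rule range_inj_infinite)
  then show ?thesis using finite_subset subset_UNIV by blast
qed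

lemma of_int_rational_function_eq_0_iff:
  "(of_int a :: 'p::prime_card mod_ring poly fract) = 0 \<longleftrightarrow> int CARD('p) dvd a"
proof -
  have nat: "(of_nat n :: 'p mod_ring poly fract) = to_fract (of_nat n)" for n
    by (induction n) simp_all
  obtain m n where "a = int m - int n" by (rule int_diff_cases)
  then have "(of_int a :: 'p mod_ring poly fract) = to_fract (of_int a)" by (simp add: nat)
  then have "(of_int a :: 'p mod_ring poly fract) = 0 \<longleftrightarrow> (of_int a :: 'p mod_ring poly) = 0" by simp
  also have "\<dots> \<longleftrightarrow> (of_int a :: 'p mod_ring) = 0" by (simp add: of_int_poly)
  also have "\<dots> \<longleftrightarrow> int CARD('p) dvd a" by (simp add: of_int_eq_0_iff_char_dvd)
  finally show ?thesis .
qed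

definition expands :: "nat \<Rightarrow> bool" where
  "expands p \<longleftrightarrow> (\<forall>A D. A \<subseteq> {0..<int p} \<longrightarrow> D \<subseteq> {0..<int p} \<longrightarrow> card A \<le> 2 * card D \<longrightarrow>
     11 * sqrt (card A ^ 2 * card D) + 1 < p \<longrightarrow>
     sqrt (card A ^ 2 * card D) \<le> 66 * (432 * 864 ^ 6) * card {(x + (y - z)\<^sup>2) mod int p | x y z. x \<in> D \<and> y \<in> A \<and> z \<in> A})"

text \<open>Types cannot depend on p, so the field of characteristic p is built for one fixed prime, chosen to be a counterexample if there is any. Expansion for this single prime then implies it for all.\<close>

definition critical_prime :: nat where
  "critical_prime = (if \<exists>p. prime p \<and> odd p \<and> \<not> expands p then SOME p. prime p \<and> odd p \<and> \<not> expands p else 3)"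

lemma critical_prime: "prime critical_prime" "odd critical_prime"
proof -
  have "prime critical_prime \<and> odd critical_prime"
  proof (cases "\<exists>p. prime p \<and> odd p \<and> \<not> expands p")
    case True
    then have "critical_prime = (SOME p. prime p \<and> odd p \<and> \<not> expands p)" by (simp only: critical_prime_def if_True)
    then show ?thesis using someI_ex[OF True] by metis
  next
    case False
    show ?thesis unfolding critical_prime_def if_not_P[OF False] by simp
  qed
  then show "prime critical_prime" "odd critical_prime" by auto
qed

typedef critical_residue = "{0..<critical_prime}"
proof
  show "0 \<in> {0..<critical_prime}" using prime_gt_0_nat[OF critical_prime(1)] by simp
qed

lemma CARD_critical_residue: "CARD(critical_residue) = critical_prime"
  using type_definition.card[OF type_definition_critical_residue] by simp

instance critical_residue :: prime_card
  by standard (simp add: CARD_critical_residue critical_prime)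

type_synonym critical_field = "critical_residue mod_ring poly fract"

text \<open>\<open>of_int\<close> into the rational functions kills exactly the multiples of p. It
  is therefore injective on residues and preserves the sizes of the sets and of the set of
  values.\<close>

lemma expands_critical_prime: "expands critical_prime"
  unfolding expands_def
proof (intro allI impI)
  fix A D :: "int set"
  define p where "p = critical_prime"
  assume sub: "A \<subseteq> {0..<int critical_prime}" "D \<subseteq> {0..<int critical_prime}"
    and AD: "card A \<le> 2 * card D" and sm: "11 * sqrt (card A ^ 2 * card D) + 1 < critical_prime"
  note sub = sub[folded p_def]
  have fin: "finite A" "finite D" using finite_subset[OF sub(1)] finite_subset[OF sub(2)] by simp_all
  let ?h = "of_int :: int \<Rightarrow> critical_field"
  have zero: "?h a = 0 \<longleftrightarrow> int p dvd a" for a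
    by (simp add: of_int_rational_function_eq_0_iff CARD_critical_residue p_def)
  have inj: "inj_on ?h {0..<int p}"
  proof (rule inj_onI)
    fix a b assume ab: "a \<in> {0..<int p}" "b \<in> {0..<int p}" "?h a = ?h b"
    then have "?h (a - b) = 0" by simp
    then have "int p dvd a - b" by (simp only: zero)
    then have "a mod int p = b mod int p" by (rule mod_eq_dvd_iff[THEN iffD2])
    then show "a = b" using ab by simp
  qed
  have c: "card (?h ` A) = card A" "card (?h ` D) = card D"
    using card_image[OF inj_on_subset[OF inj sub(1)]] card_image[OF inj_on_subset[OF inj sub(2)]] by simp_all
  have hmod: "?h (a mod int p) = ?h a" for a
  proof -
    have "?h (a mod int p - a) = 0" unfolding zero by (rule mod_eq_dvd_iff[THEN iffD1]) (rule mod_mod_trivial)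
    then show ?thesis by simp
  qed
  define T where "T = {(x + (y - z)\<^sup>2) mod int p | x y z. x \<in> D \<and> y \<in> A \<and> z \<in> A}"
  have "int p > 0" using critical_prime(1) prime_gt_0_nat by (simp add: p_def)
  then have "T \<subseteq> {0..<int p}" by (auto simp: T_def)
  then have finT: "finite T" by (rule finite_subset) simp
  have T: "{x + (y - z)\<^sup>2 | x y z. x \<in> ?h ` D \<and> y \<in> ?h ` A \<and> z \<in> ?h ` A} = ?h ` T"
  proof (intro equalityI subsetI)
    fix v assume "v \<in> {x + (y - z)\<^sup>2 | x y z. x \<in> ?h ` D \<and> y \<in> ?h ` A \<and> z \<in> ?h ` A}"
    then obtain x y z where "x \<in> D" "y \<in> A" "z \<in> A" "v = ?h x + (?h y - ?h z)\<^sup>2" by auto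
    then have "v = ?h ((x + (y - z)\<^sup>2) mod int p)" "(x + (y - z)\<^sup>2) mod int p \<in> T" unfolding hmod by (auto simp: T_def)
    then show "v \<in> ?h ` T" by blast
  next
    fix v assume "v \<in> ?h ` T"
    then obtain x y z where "x \<in> D" "y \<in> A" "z \<in> A" "v = ?h ((x + (y - z)\<^sup>2) mod int p)" by (auto simp: T_def)
    then have "v = ?h x + (?h y - ?h z)\<^sup>2" unfolding hmod by simp
    then show "v \<in> {x + (y - z)\<^sup>2 | x y z. x \<in> ?h ` D \<and> y \<in> ?h ` A \<and> z \<in> ?h ` A}"
      using \<open>x \<in> D\<close> \<open>y \<in> A\<close> \<open>z \<in> A\<close> by blast
  qed
  have ofnat: "(of_nat j :: critical_field) \<noteq> 0" if "0 < j" "j < p" for j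
  proof
    assume "(of_nat j :: critical_field) = 0"
    then have "?h (int j) = 0" by simp
    then have "int p dvd int j" by (simp only: zero)
    then show False using that by (auto dest: dvd_imp_le)
  qed
  have "p \<noteq> 2" "p \<ge> 2" using critical_prime prime_ge_2_nat unfolding p_def by auto
  then have "p > 2" by simp
  then have two: "(2 :: critical_field) \<noteq> 0" using ofnat[of 2] by simp
  have "sqrt (card (?h ` A) ^ 2 * card (?h ` D)) \<le> 66 * (432 * 864 ^ 6) * card (?h ` T)"
    unfolding T[symmetric]
  proof (rule expansion_field)
    show "infinite (UNIV :: critical_field set)" by (rule infinite_rational_functions)
    show "(of_nat j :: critical_field) \<noteq> 0" if "0 < j" "real j \<le> 11 * sqrt (card (?h ` A) ^ 2 * card (?h ` D)) + 1" for j
      using that sm by (intro ofnat) (auto simp: c p_def)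
  qed (use fin two AD c in auto)
  also have "\<dots> \<le> 66 * (432 * 864 ^ 6) * card T" using card_image_le[OF finT, of ?h] by simp
  finally show "sqrt (card A ^ 2 * card D) \<le> 66 * (432 * 864 ^ 6) * card {(x + (y - z)\<^sup>2) mod int critical_prime | x y z. x \<in> D \<and> y \<in> A \<and> z \<in> A}"
    by (simp add: c T_def p_def)
qed

theorem expands: 
  assumes "prime p" "odd p" shows "expands p"
proof (rule ccontr)
  assume "\<not> expands p"
  then have ex: "\<exists>p. prime p \<and> odd p \<and> \<not> expands p" using assms by blast
  then have "critical_prime = (SOME p. prime p \<and> odd p \<and> \<not> expands p)" by (simp only: critical_prime_def if_True)
  then have "\<not> expands critical_prime" using someI_ex[OF ex] by metis
  then show False using expands_critical_prime by simp
qed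

section \<open>Quotients of a sumset\<close>

lemma sum_fiber_products:
  assumes "finite S" "finite S'" "finite T" "h ` S \<subseteq> T"
  shows "(\<Sum>t\<in>T. card {s \<in> S. h s = t} * card {s \<in> S'. h' s = t}) = card {(s, s') \<in> S \<times> S'. h s = h' s'}"
proof -
  have "{(s, s') \<in> S \<times> S'. h s = h' s'} = (\<Union>t\<in>T. {s \<in> S. h s = t} \<times> {s \<in> S'. h' s = t})"
    using assms(4) by auto
  then have "card {(s, s') \<in> S \<times> S'. h s = h' s'} = (\<Sum>t\<in>T. card ({s \<in> S. h s = t} \<times> {s \<in> S'. h' s = t}))"
    using assms by (simp only:, intro card_UN_disjoint) auto
  then show ?thesis by (simp add: card_cartesian_product)
qed

definition fiber :: "nat \<Rightarrow> int set \<Rightarrow> int \<Rightarrow> int \<Rightarrow> nat" where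
  "fiber p Z c t = card {q \<in> Z \<times> Z. (fst q - c * snd q) mod int p = t}"

text \<open>Two distinct pairs in Z \<times> Z agree in z - c z' for at most one residue c, and a
  pair agrees with itself for all p of them.\<close>

lemma fiber_second_moment:
  fixes p :: nat and Z :: "int set"
  assumes p: "prime p" and Z: "Z \<subseteq> {0..<int p}"
  shows "(\<Sum>c\<in>{0..<int p}. \<Sum>t\<in>{0..<int p}. (fiber p Z c t)\<^sup>2) \<le> card Z ^ 4 + p * card Z ^ 2"
proof -
  have finZ: "finite Z" using finite_subset[OF Z] by simp
  define Q where "Q = Z \<times> Z"
  define h where "h = (\<lambda>c q. (fst q - c * snd q) mod int p)"
  have finQ: "finite Q" using finZ by (simp add: Q_def)
  have p0: "int p > 0" using prime_gt_0_nat[OF p] by simp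
  have one: "card {c \<in> {0..<int p}. h c q = h c q'} \<le> 1 + (if q = q' then p else 0)" if "q \<in> Q" "q' \<in> Q" for q q'
  proof (cases "q = q'")
    case True
    have "card {c \<in> {0..<int p}. h c q = h c q'} \<le> card {0..<int p}" by (intro card_mono) auto
    then show ?thesis using True by simp
  next
    case False
    have fC: "finite {c \<in> {0..<int p}. h c q = h c q'}" by (rule finite_subset[of _ "{0..<int p}"]) auto
    have "card {c \<in> {0..<int p}. h c q = h c q'} \<le> Suc 0"
      unfolding card_le_Suc0_iff_eq[OF fC]
    proof (intro ballI)
      fix c c' assume c: "c \<in> {c \<in> {0..<int p}. h c q = h c q'}" "c' \<in> {c \<in> {0..<int p}. h c q = h c q'}"
      have d: "int p dvd (fst q - x * snd q) - (fst q' - x * snd q')" if "h x q = h x q'" for x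
        using that unfolding h_def by (rule mod_eq_dvd_iff[THEN iffD1])
      have "int p dvd ((fst q - c * snd q) - (fst q' - c * snd q')) - ((fst q - c' * snd q) - (fst q' - c' * snd q'))"
        using c by (intro dvd_diff[OF d d]) auto
      also have "\<dots> = (c' - c) * (snd q - snd q')" by (simp add: algebra_simps)
      finally have "int p dvd c' - c \<or> int p dvd snd q - snd q'"
        using p prime_dvd_mult_iff[of "int p"] by simp
      then have "c' mod int p = c mod int p \<or> snd q mod int p = snd q' mod int p"
        by (auto simp only: mod_eq_dvd_iff)
      moreover have "c' mod int p = c'" "c mod int p = c" using c by auto
      moreover have "snd q mod int p = snd q" "snd q' mod int p = snd q'" "fst q mod int p = fst q" "fst q' mod int p = fst q'"
        using that Z by (auto simp: Q_def)
      moreover have "fst q = fst q'" if "snd q = snd q'"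
      proof -
        have "int p dvd fst q - fst q'" using d[of c] c that by simp
        then have "fst q mod int p = fst q' mod int p" by (rule mod_eq_dvd_iff[THEN iffD2])
        then show ?thesis using calculation by simp
      qed
      ultimately show "c = c'" using False by (metis prod_eq_iff)
    qed
    then show ?thesis by simp
  qed
  have "(\<Sum>t\<in>{0..<int p}. (fiber p Z c t)\<^sup>2) = card {(q, q') \<in> Q \<times> Q. h c q = h c q'}" for c
  proof -
    have "h c ` Q \<subseteq> {0..<int p}" using p0 by (auto simp: h_def)
    from sum_fiber_products[OF finQ finQ _ this, of "h c"] show ?thesis
      by (simp add: fiber_def h_def Q_def power2_eq_square)
  qed
  also have "\<And>c. card {(q, q') \<in> Q \<times> Q. h c q = h c q'} = (\<Sum>r\<in>Q \<times> Q. if h c (fst r) = h c (snd r) then 1 else 0)"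
    using finQ by (subst sum.If_cases) (auto intro!: arg_cong[where f = card])
  finally have "(\<Sum>c\<in>{0..<int p}. \<Sum>t\<in>{0..<int p}. (fiber p Z c t)\<^sup>2)
      = (\<Sum>c\<in>{0..<int p}. \<Sum>r\<in>Q \<times> Q. if h c (fst r) = h c (snd r) then 1 else 0)" by simp
  also have "\<dots> = (\<Sum>r\<in>Q \<times> Q. \<Sum>c\<in>{0..<int p}. if h c (fst r) = h c (snd r) then 1 else 0)"
    by (rule sum.swap)
  also have "\<dots> = (\<Sum>r\<in>Q \<times> Q. card {c \<in> {0..<int p}. h c (fst r) = h c (snd r)})"
    by (intro sum.cong refl) (subst sum.If_cases, auto intro!: arg_cong[where f = card])
  also have "\<dots> \<le> (\<Sum>r\<in>Q \<times> Q. 1 + (if fst r = snd r then p else 0))"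
  proof (rule sum_mono)
    fix r assume "r \<in> Q \<times> Q"
    then show "card {c \<in> {0..<int p}. h c (fst r) = h c (snd r)} \<le> 1 + (if fst r = snd r then p else 0)"
      unfolding mem_Times_iff by (intro one) blast+
  qed
  also have "\<dots> = (\<Sum>q\<in>Q. \<Sum>q'\<in>Q. 1 + (if q = q' then p else 0))"
    by (subst sum.cartesian_product) (simp add: case_prod_unfold)
  also have "\<dots> = (\<Sum>q\<in>Q. card Q + p)" using finQ by (intro sum.cong refl) (simp only: sum.distrib, simp)
  also have "\<dots> = card Q * card Q + p * card Q" by (simp add: algebra_simps)
  also have "\<dots> = card Z ^ 4 + p * card Z ^ 2"
    by (simp add: Q_def card_cartesian_product power4_eq_xxxx power2_eq_square)
  finally show ?thesis .
qed

lemma fiber_sum: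
  assumes "p > 0" "finite Z" shows "(\<Sum>t\<in>{0..<int p}. fiber p Z c t) = card Z ^ 2"
proof -
  have "(\<lambda>q. (fst q - c * snd q) mod int p) ` (Z \<times> Z) \<subseteq> {0..<int p}" using assms(1) by auto
  from sum.group[OF _ _ this, of "\<lambda>_. 1 :: nat"] assms(2)
  have "(\<Sum>t\<in>{0..<int p}. fiber p Z c t) = card (Z \<times> Z)" by (simp add: fiber_def)
  then show ?thesis by (simp add: card_cartesian_product power2_eq_square)
qed

text \<open>The mean over t is |Z|^2/p for every c, so centering removes exactly the term |Z|^4 of
  the second moment.\<close>

lemma fiber_variance:
  fixes p :: nat and Z :: "int set"
  assumes p: "prime p" and Z: "Z \<subseteq> {0..<int p}"
  shows "(\<Sum>c\<in>{0..<int p}. \<Sum>t\<in>{0..<int p}. (real (fiber p Z c t) - real (card Z ^ 2) / p)\<^sup>2) \<le> p * real (card Z ^ 2)"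
proof -
  define z where "z = real (card Z)"
  have p0: "p > 0" using prime_gt_0_nat[OF p] .
  have s1: "(\<Sum>t\<in>{0..<int p}. real (fiber p Z c t)) = z ^ 2" for c
    using fiber_sum[OF p0 finite_subset[OF Z]] by (simp add: z_def flip: of_nat_sum)
  have s2: "(\<Sum>c\<in>{0..<int p}. \<Sum>t\<in>{0..<int p}. (real (fiber p Z c t))\<^sup>2) \<le> z ^ 4 + p * z ^ 2"
  proof -
    have "real (\<Sum>c\<in>{0..<int p}. \<Sum>t\<in>{0..<int p}. (fiber p Z c t)\<^sup>2) \<le> real (card Z ^ 4 + p * card Z ^ 2)"
      using fiber_second_moment[OF p Z] by (rule of_nat_mono)
    then show ?thesis by (simp add: z_def)
  qed
  have "(\<Sum>t\<in>{0..<int p}. (real (fiber p Z c t) - z ^ 2 / p)\<^sup>2)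
     = (\<Sum>t\<in>{0..<int p}. (real (fiber p Z c t))\<^sup>2) - z ^ 4 / p" for c
  proof -
    have "(\<Sum>t\<in>{0..<int p}. (real (fiber p Z c t) - z ^ 2 / p)\<^sup>2)
       = (\<Sum>t\<in>{0..<int p}. (real (fiber p Z c t))\<^sup>2 - 2 * (z ^ 2 / p) * real (fiber p Z c t) + (z ^ 2 / p)\<^sup>2)"
      by (intro sum.cong) (auto simp: power2_eq_square algebra_simps)
    also have "\<dots> = (\<Sum>t\<in>{0..<int p}. (real (fiber p Z c t))\<^sup>2) - 2 * (z ^ 2 / p) * z ^ 2 + p * (z ^ 2 / p)\<^sup>2"
      unfolding sum.distrib sum_subtractf sum_distrib_left[symmetric] s1 by simp
    also have "p * (z ^ 2 / p)\<^sup>2 = z ^ 4 / p" using p0 by (simp add: power2_eq_square power4_eq_xxxx field_simps)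
    also have "2 * (z ^ 2 / p) * z ^ 2 = 2 * (z ^ 4 / p)" by (simp add: power2_eq_square power4_eq_xxxx)
    finally show ?thesis by simp
  qed
  then have "(\<Sum>c\<in>{0..<int p}. \<Sum>t\<in>{0..<int p}. (real (fiber p Z c t) - z ^ 2 / p)\<^sup>2)
     = (\<Sum>c\<in>{0..<int p}. \<Sum>t\<in>{0..<int p}. (real (fiber p Z c t))\<^sup>2) - p * (z ^ 4 / p)"
    by (simp add: sum_subtractf)
  also have "\<dots> \<le> p * z ^ 2" using s2 p0 by simp
  finally show ?thesis by (simp add: z_def)
qed

text \<open>With w = -y the equation c (x' + y') = x + y becomes x - c x' = w - c w', whose
  solutions are counted by the two fiber functions. For a bad c only x = w, x' = w' remains, which
  gives at most |X||Y| solutions, while the expected number (|X||Y|)^2/p is at least three times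
  that. The deficit appears as a negative covariance, and the variances allow it for at most p/2
  values of c.\<close>

theorem quotients_of_sumset:
  fixes p :: nat and X Y :: "int set"
  assumes p: "prime p" and X: "X \<subseteq> {0..<int p}" and Y: "Y \<subseteq> {0..<int p}" and big: "3 * p \<le> card X * card Y"
  shows "real p / 3 \<le> card {c \<in> {0..<int p}. \<exists>x\<in>X. \<exists>y\<in>Y. \<exists>x'\<in>X. \<exists>y'\<in>Y.
     (x' + y') mod int p \<noteq> 0 \<and> (c * (x' + y')) mod int p = (x + y) mod int p}"
proof -
  define I where "I = {0..<int p}"
  have p0: "p > 0" using prime_gt_0_nat[OF p] .
  have finX: "finite X" and finY: "finite Y" using finite_subset[OF X] finite_subset[OF Y] by simp_all
  define W where "W = (\<lambda>y. (- y) mod int p) ` Y"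
  have W: "W \<subseteq> {0..<int p}" using p0 by (auto simp: W_def)
  have finW: "finite W" using finY by (simp add: W_def)
  have cW: "card W = card Y" unfolding W_def
  proof (intro card_image inj_onI)
    fix y y' assume y: "y \<in> Y" "y' \<in> Y" "(- y) mod int p = (- y') mod int p"
    then have "int p dvd - y - - y'" by (intro mod_eq_dvd_iff[THEN iffD1])
    then have "int p dvd y' - y" by simp
    then have "y' mod int p = y mod int p" by (rule mod_eq_dvd_iff[THEN iffD2])
    moreover have "y' mod int p = y'" "y mod int p = y" using y Y by auto
    ultimately show "y = y'" by simp
  qed
  define Good where "Good = {c \<in> I. \<exists>x\<in>X. \<exists>y\<in>Y. \<exists>x'\<in>X. \<exists>y'\<in>Y.
     (x' + y') mod int p \<noteq> 0 \<and> (c * (x' + y')) mod int p = (x + y) mod int p}"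
  define Bad where "Bad = I - Good"
  have finI: "finite I" by (simp add: I_def)
  define a where "a = real (card X)"
  define b where "b = real (card W)"
  have ab: "3 * real p \<le> a * b" using big by (simp add: a_def b_def cW flip: of_nat_mult of_nat_le_iff)
  have pos: "a > 0" "b > 0" using ab p0 by (auto simp: a_def b_def intro: gr0I simp: zero_less_mult_iff)
  define F where "F = (\<lambda>c t. real (fiber p X c t) - a\<^sup>2 / p)"
  define G where "G = (\<lambda>c t. real (fiber p W c t) - b\<^sup>2 / p)"
  have VF: "(\<Sum>c\<in>I. \<Sum>t\<in>I. (F c t)\<^sup>2) \<le> p * a\<^sup>2" and VG: "(\<Sum>c\<in>I. \<Sum>t\<in>I. (G c t)\<^sup>2) \<le> p * b\<^sup>2"
    using fiber_variance[OF p X] fiber_variance[OF p W] by (simp_all add: F_def G_def a_def b_def I_def)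
  have bad: "2 * a * b \<le> - (\<Sum>t\<in>I. F c t * G c t)" if c: "c \<in> Bad" for c
  proof -
    have sF: "(\<Sum>t\<in>I. real (fiber p X c t)) = a\<^sup>2" and sG: "(\<Sum>t\<in>I. real (fiber p W c t)) = b\<^sup>2"
      using fiber_sum[OF p0 finX] fiber_sum[OF p0 finW] by (simp_all add: a_def b_def I_def flip: of_nat_sum)
    define R where "R = {(q, q') \<in> (X \<times> X) \<times> (W \<times> W). (fst q - c * snd q) mod int p = (fst q' - c * snd q') mod int p}"
    define N where "N = card R"
    have N: "(\<Sum>t\<in>I. fiber p X c t * fiber p W c t) = N"
      unfolding fiber_def N_def R_def I_def using finX finW p0 by (intro sum_fiber_products) auto
    have "N \<le> card ((X \<inter> W) \<times> (X \<inter> W))" unfolding N_def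
    proof (rule card_inj_on_le[of fst])
      \<comment> \<open>For a bad c a solution must have x' + y' = 0, and then the equation makes x
        + y zero too.\<close>
      have eq: "q = q'" if "(q, q') \<in> R" for q q'
      proof -
        have q: "fst q \<in> X" "snd q \<in> X" "fst q' \<in> W" "snd q' \<in> W" "(fst q - c * snd q) mod int p = (fst q' - c * snd q') mod int p"
          using that by (auto simp: R_def)
        obtain y y' where y: "y \<in> Y" "y' \<in> Y" "fst q' = (- y) mod int p" "snd q' = (- y') mod int p"
          using q(3,4) by (auto simp: W_def)
        have r: "fst q mod int p = fst q" "snd q mod int p = snd q" "fst q' mod int p = fst q'" "snd q' mod int p = snd q'"
          using q(1-4) X W by auto
        have d1: "int p dvd fst q' - (- y)" "int p dvd snd q' - (- y')"
          unfolding y(3,4) by (rule mod_eq_dvd_iff[THEN iffD1], rule mod_mod_trivial)+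
        have d2: "int p dvd (fst q - c * snd q) - (fst q' - c * snd q')"
          using q(5) by (rule mod_eq_dvd_iff[THEN iffD1])
        have "(fst q + y) - c * (snd q + y') = (fst q - c * snd q) - (fst q' - c * snd q') + ((fst q' - (- y)) - c * (snd q' - (- y')))"
          by (simp add: algebra_simps)
        then have dv: "int p dvd (fst q + y) - c * (snd q + y')"
          using d1 d2 by (metis dvd_add dvd_diff dvd_mult)
        then have "(c * (snd q + y')) mod int p = (fst q + y) mod int p" by (rule mod_eq_dvd_iff[THEN iffD2, symmetric])
        moreover have "c \<in> I" "c \<notin> Good" using c by (auto simp: Bad_def)
        ultimately have z: "(snd q + y') mod int p = 0" using q y by (auto simp: Good_def)
        then have "int p dvd snd q - (- y')" by (simp add: mod_eq_0_iff_dvd)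
        then have "snd q mod int p = (- y') mod int p" by (rule mod_eq_dvd_iff[THEN iffD2])
        then have s: "snd q = snd q'" using r(2) y(4) by simp
        have "int p dvd c * (snd q + y')" using z by (simp add: mod_eq_0_iff_dvd)
        then have "int p dvd fst q + y" using dv dvd_add[of "int p" "(fst q + y) - c * (snd q + y')" "c * (snd q + y')"] by simp
        then have "int p dvd fst q - (- y)" by simp
        then have "fst q mod int p = (- y) mod int p" by (rule mod_eq_dvd_iff[THEN iffD2])
        then have "fst q = fst q'" using r(1) y(3) by simp
        then show "q = q'" using s by (simp add: prod_eq_iff)
      qed
      show "inj_on fst R"
      proof (rule inj_onI)
        fix r r' assume r: "r \<in> R" "r' \<in> R" "fst r = fst r'"
        have "fst r = snd r" "fst r' = snd r'" using r(1,2) by (intro eq; simp)+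
        then show "r = r'" using r(3) by (simp add: prod_eq_iff)
      qed
      show "fst ` R \<subseteq> (X \<inter> W) \<times> (X \<inter> W)"
      proof
        fix q assume "q \<in> fst ` R"
        then obtain q' where q': "(q, q') \<in> R" by force
        then have "q = q'" by (rule eq)
        then show "q \<in> (X \<inter> W) \<times> (X \<inter> W)" using q' by (auto simp: R_def)
      qed
    qed (use finX finW in auto)
    also have "\<dots> \<le> card X * card W"
      unfolding card_cartesian_product using finX finW by (intro mult_le_mono card_mono) auto
    finally have Nab: "real N \<le> a * b" unfolding a_def b_def by (metis of_nat_le_iff of_nat_mult)
    have "(\<Sum>t\<in>I. F c t * G c t) = (\<Sum>t\<in>I. real (fiber p X c t * fiber p W c t) - b\<^sup>2 / p * real (fiber p X c t)
         - a\<^sup>2 / p * real (fiber p W c t) + a\<^sup>2 / p * (b\<^sup>2 / p))"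
      by (intro sum.cong) (auto simp: F_def G_def algebra_simps)
    also have "\<dots> = real N - b\<^sup>2 / p * a\<^sup>2 - a\<^sup>2 / p * b\<^sup>2 + p * (a\<^sup>2 / p * (b\<^sup>2 / p))"
    proof -
      have sN: "(\<Sum>t\<in>I. real (fiber p X c t * fiber p W c t)) = real N" using N by (metis of_nat_sum)
      have sc: "(\<Sum>t\<in>I. a\<^sup>2 / p * (b\<^sup>2 / p)) = p * (a\<^sup>2 / p * (b\<^sup>2 / p))" by (simp add: I_def)
      show ?thesis unfolding sum.distrib sum_subtractf sc sN unfolding sum_distrib_left[symmetric] sF sG ..
    qed
    also have "p * (a\<^sup>2 / p * (b\<^sup>2 / p)) = a\<^sup>2 * b\<^sup>2 / p" using p0 by simp
    finally have "(\<Sum>t\<in>I. F c t * G c t) = real N - a\<^sup>2 * b\<^sup>2 / p" by simp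
    moreover have "3 * (a * b) \<le> a\<^sup>2 * b\<^sup>2 / p"
    proof -
      have "(3 * real p) * (a * b) \<le> (a * b) * (a * b)" using ab pos by (intro mult_right_mono) auto
      then show ?thesis using p0 by (simp add: pos_le_divide_eq power2_eq_square mult_ac)
    qed
    ultimately show ?thesis using Nab by linarith
  qed
  have BI: "Bad \<subseteq> I" by (simp add: Bad_def)
  have "card Bad * (2 * a * b) \<le> (\<Sum>c\<in>Bad. - (\<Sum>t\<in>I. F c t * G c t))"
    using sum_mono[of Bad "\<lambda>_. 2 * a * b", OF bad] by simp
  also have "\<dots> \<le> (\<Sum>c\<in>Bad. \<Sum>t\<in>I. (b / a * (F c t)\<^sup>2 + a / b * (G c t)\<^sup>2) / 2)"
  proof (rule sum_mono)
    fix c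
    \<comment> \<open>Weighted AM-GM; the weights b/a and a/b give both variance bounds the same
      size p a b.\<close>
    have "- (F c t * G c t) \<le> (b / a * (F c t)\<^sup>2 + a / b * (G c t)\<^sup>2) / 2" for t
    proof -
      define f g where "f = F c t" and "g = G c t"
      have e1: "b / a * f\<^sup>2 * (a * b) = b\<^sup>2 * f\<^sup>2" and e2: "a / b * g\<^sup>2 * (a * b) = a\<^sup>2 * g\<^sup>2"
        using pos by (simp_all add: power2_eq_square)
      have "0 \<le> (b * f + a * g)\<^sup>2" by simp
      also have "\<dots> = b\<^sup>2 * f\<^sup>2 + a\<^sup>2 * g\<^sup>2 + 2 * (f * g) * (a * b)" by (simp add: power2_eq_square algebra_simps)
      also have "\<dots> = (b / a * f\<^sup>2 + a / b * g\<^sup>2 + 2 * (f * g)) * (a * b)" by (simp only: distrib_right e1 e2)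
      finally have "0 \<le> b / a * f\<^sup>2 + a / b * g\<^sup>2 + 2 * (f * g)"
        using mult_neg_pos[OF _ mult_pos_pos[OF pos]] by (meson not_le)
      then show ?thesis by (simp add: f_def g_def)
    qed
    then show "- (\<Sum>t\<in>I. F c t * G c t) \<le> (\<Sum>t\<in>I. (b / a * (F c t)\<^sup>2 + a / b * (G c t)\<^sup>2) / 2)"
      unfolding sum_negf[symmetric] by (intro sum_mono)
  qed
  also have "\<dots> \<le> (\<Sum>c\<in>I. \<Sum>t\<in>I. (b / a * (F c t)\<^sup>2 + a / b * (G c t)\<^sup>2) / 2)"
    using BI finI pos by (intro sum_mono2 sum_nonneg) auto
  also have "\<dots> = (b / a * (\<Sum>c\<in>I. \<Sum>t\<in>I. (F c t)\<^sup>2) + a / b * (\<Sum>c\<in>I. \<Sum>t\<in>I. (G c t)\<^sup>2)) / 2"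
    by (simp add: sum_divide_distrib[symmetric] sum.distrib sum_distrib_left[symmetric])
  also have "\<dots> \<le> (b / a * (p * a\<^sup>2) + a / b * (p * b\<^sup>2)) / 2"
    using VF VG pos by (intro divide_right_mono add_mono mult_left_mono) auto
  also have "\<dots> = real p * (a * b)" using pos by (simp add: power2_eq_square)
  finally have "(2 * card Bad) * (a * b) \<le> real p * (a * b)" by (simp add: mult_ac)
  then have "2 * real (card Bad) \<le> real p" using pos by (simp add: mult_le_cancel_right)
  moreover have "card Good + card Bad = p"
  proof -
    have "Good \<subseteq> I" by (auto simp: Good_def)
    then have "card Bad = card I - card Good" unfolding Bad_def using finI finite_subset by (intro card_Diff_subset) auto
    moreover have "card Good \<le> card I" using \<open>Good \<subseteq> I\<close> finI by (rule card_mono[rotated])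
    ultimately show ?thesis by (simp add: I_def)
  qed
  ultimately have "real p / 3 \<le> card Good" by linarith
  then show ?thesis by (simp add: Good_def I_def)
qed

section \<open>Distance sets\<close>

abbreviation dists :: "nat \<Rightarrow> int set \<Rightarrow> nat \<Rightarrow> int set" where
  "dists p A j \<equiv> dist_set (int p) j (PiE {0..<j} (\<lambda>_. A))"

lemma dists_add:
  assumes "x \<in> dists p A m" "y \<in> dists p A n"
  shows "(x + y) mod int p \<in> dists p A (m + n)"
proof -
  obtain u v where uv: "u \<in> PiE {0..<m} (\<lambda>_. A)" "v \<in> PiE {0..<m} (\<lambda>_. A)" "x = fp_dist (int p) m u v"
    using assms(1) by (auto simp: dist_set_def)
  obtain u' v' where uv': "u' \<in> PiE {0..<n} (\<lambda>_. A)" "v' \<in> PiE {0..<n} (\<lambda>_. A)" "y = fp_dist (int p) n u' v'"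
    using assms(2) by (auto simp: dist_set_def)
  \<comment> \<open>Beyond m + n coordinates the value \<open>undefined\<close> keeps the
    concatenation extensional, as \<open>PiE\<close> demands.\<close>
  define cc :: "(nat \<Rightarrow> int) \<Rightarrow> (nat \<Rightarrow> int) \<Rightarrow> nat \<Rightarrow> int" where
    "cc = (\<lambda>f g i. if i < m then f i else if i < m + n then g (i - m) else undefined)"
  have cc: "cc f g \<in> PiE {0..<m + n} (\<lambda>_. A)" if "f \<in> PiE {0..<m} (\<lambda>_. A)" "g \<in> PiE {0..<n} (\<lambda>_. A)" for f g
    using that by (auto simp: cc_def PiE_iff extensional_def)
  have "(\<Sum>i<m + n. (cc u u' i - cc v v' i)\<^sup>2) = (\<Sum>i<m. (u i - v i)\<^sup>2) + (\<Sum>i<n. (u' i - v' i)\<^sup>2)"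
  proof -
    have "(\<Sum>i<m + n. (cc u u' i - cc v v' i)\<^sup>2) = (\<Sum>i\<in>{0..<m}. (cc u u' i - cc v v' i)\<^sup>2) + (\<Sum>i\<in>{m..<m + n}. (cc u u' i - cc v v' i)\<^sup>2)"
      unfolding lessThan_atLeast0 by (rule sum.atLeastLessThan_concat[symmetric]) auto
    also have "(\<Sum>i\<in>{m..<m + n}. (cc u u' i - cc v v' i)\<^sup>2) = (\<Sum>i\<in>{0..<n}. (cc u u' (i + m) - cc v v' (i + m))\<^sup>2)"
      using sum.shift_bounds_nat_ivl[of "\<lambda>i. (cc u u' i - cc v v' i)\<^sup>2" 0 m n] by (simp add: add.commute)
    also have "(\<Sum>i\<in>{0..<m}. (cc u u' i - cc v v' i)\<^sup>2) = (\<Sum>i<m. (u i - v i)\<^sup>2)"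
      by (intro sum.cong) (auto simp: cc_def)
    also have "(\<Sum>i\<in>{0..<n}. (cc u u' (i + m) - cc v v' (i + m))\<^sup>2) = (\<Sum>i<n. (u' i - v' i)\<^sup>2)"
      by (intro sum.cong) (auto simp: cc_def)
    finally show ?thesis .
  qed
  then have "fp_dist (int p) (m + n) (cc u u') (cc v v') = (x + y) mod int p"
    by (simp add: fp_dist_def uv uv' mod_add_eq)
  then show ?thesis unfolding dist_set_def using cc[OF uv(1) uv'(1)] cc[OF uv(2) uv'(2)]
    by (intro CollectI exI[of _ "cc u u'"] exI[of _ "cc v v'"]) simp
qed

lemma dists_1:
  assumes "y \<in> A" "z \<in> A" shows "(y - z)\<^sup>2 mod int p \<in> dists p A 1"
proof -
  define c where "c = (\<lambda>x i. if i = (0::nat) then x else undefined :: int)"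
  have "c y \<in> PiE {0..<1} (\<lambda>_. A)" "c z \<in> PiE {0..<1} (\<lambda>_. A)"
    using assms by (auto simp: c_def PiE_iff extensional_def)
  moreover have "fp_dist (int p) 1 (c y) (c z) = (y - z)\<^sup>2 mod int p" by (simp add: fp_dist_def c_def)
  ultimately show ?thesis unfolding dist_set_def
    by (intro CollectI exI[of _ "c y"] exI[of _ "c z"]) simp
qed

lemma dists_subset: "p > 0 \<Longrightarrow> dists p A j \<subseteq> {0..<int p}"
  by (auto simp: dist_set_def fp_dist_def)

lemma finite_dists: "p > 0 \<Longrightarrow> finite (dists p A j)"
  by (rule finite_subset[OF dists_subset]) auto

lemma dists_mono: "A' \<subseteq> A \<Longrightarrow> dists p A' j \<subseteq> dists p A j"
  using PiE_mono[of "{0..<j}" "\<lambda>_. A'" "\<lambda>_. A"] unfolding dist_set_def by blast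

text \<open>For fixed z the function (y - z)^2 of y takes each value at most twice, at some w and at
  2 z - w.\<close>

lemma card_dists_1:
  assumes p: "prime p" and A: "A \<subseteq> {0..<int p}"
  shows "card A \<le> 2 * card (dists p A 1)"
proof (cases "A = {}")
  case False
  then obtain z where z: "z \<in> A" by blast
  have finA: "finite A" using finite_subset[OF A] by simp
  define f where "f = (\<lambda>y. (y - z)\<^sup>2 mod int p)"
  have fib: "card {y \<in> A. f y = v} \<le> 2" for v
  proof (cases "{y \<in> A. f y = v} = {}")
    case False
    then obtain w where w: "w \<in> A" "f w = v" by blast
    have "{y \<in> A. f y = v} \<subseteq> {w, (2 * z - w) mod int p}"
    proof
      fix y assume y: "y \<in> {y \<in> A. f y = v}"
      then have "f y = f w" using w by simp
      then have "int p dvd (y - z)\<^sup>2 - (w - z)\<^sup>2" unfolding f_def by (rule mod_eq_dvd_iff[THEN iffD1])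
      also have "(y - z)\<^sup>2 - (w - z)\<^sup>2 = (y - w) * (y - (2 * z - w))" by (simp add: power2_eq_square algebra_simps)
      finally have "int p dvd y - w \<or> int p dvd y - (2 * z - w)"
        using p prime_dvd_mult_iff[of "int p"] by simp
      then have "y mod int p = w mod int p \<or> y mod int p = (2 * z - w) mod int p"
        by (auto simp only: mod_eq_dvd_iff)
      moreover have "y mod int p = y" "w mod int p = w" using y w A by auto
      ultimately show "y \<in> {w, (2 * z - w) mod int p}" by auto
    qed
    then have "card {y \<in> A. f y = v} \<le> card {w, (2 * z - w) mod int p}" by (intro card_mono) auto
    also have "\<dots> \<le> 2" by (simp add: card_insert_if)
    finally show ?thesis .
  next
    case True
    show ?thesis unfolding True by simp
  qed
  have "card A = (\<Sum>v\<in>f ` A. card {y \<in> A. f y = v})"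
    using sum.image_gen[OF finA, of "\<lambda>_. 1 :: nat" f] by simp
  also have "\<dots> \<le> (\<Sum>v\<in>f ` A. 2)" by (intro sum_mono fib)
  also have "\<dots> = 2 * card (f ` A)" by simp
  also have "\<dots> \<le> 2 * card (dists p A 1)"
  proof (intro mult_le_mono card_mono)
    show "finite (dists p A 1)" by (rule finite_dists[OF prime_gt_0_nat[OF p]])
    show "f ` A \<subseteq> dists p A 1" using dists_1[OF _ z] by (auto simp: f_def)
  qed simp
  finally show ?thesis .
qed simp

definition expansion_const :: real where "expansion_const = 66 * (432 * 864 ^ 6)"

text \<open>One expansion step sends an exponent e to 1 + e/2; starting from 1, this gives 2 -
  2/2^j. It sends a constant C to \<open>expansion_const\<close> times sqrt C, which reproduces the
  square of \<open>expansion_const\<close>. The smallness of A permits the step as long as |D| \<le>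
  |A|^2; a larger D already exceeds the claim.\<close>

lemma dists_growth:
  fixes p j :: nat and A :: "int set"
  assumes p: "prime p" "odd p" and A: "A \<subseteq> {0..<int p}" "A \<noteq> {}" and small: "11 * (real (card A))\<^sup>2 + 1 < p"
  shows "real (card A) powr (2 - 2 / 2 ^ Suc j) \<le> expansion_const\<^sup>2 * card (dists p A (Suc j))"
proof (induction j)
  case 0
  have "card A \<le> 2 * card (dists p A 1)" by (rule card_dists_1[OF p(1) A(1)])
  moreover have "(2::real) \<le> expansion_const\<^sup>2" by (simp add: expansion_const_def power2_eq_square)
  then have "2 * real (card (dists p A 1)) \<le> expansion_const\<^sup>2 * card (dists p A 1)" by (intro mult_right_mono) auto
  ultimately have "real (card A) \<le> expansion_const\<^sup>2 * card (dists p A 1)" by linarith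
  then show ?case by simp
next
  case (Suc j)
  define a where "a = real (card A)"
  define D where "D = dists p A (Suc j)"
  define D' where "D' = dists p A (Suc (Suc j))"
  have finA: "finite A" using finite_subset[OF A(1)] by simp
  have a1: "a \<ge> 1" using A(2) finA by (simp add: a_def card_gt_0_iff Suc_le_eq)
  have p0: "p > 0" using prime_gt_0_nat[OF p(1)] .
  have DI: "D \<subseteq> {0..<int p}" "D' \<subseteq> {0..<int p}" unfolding D_def D'_def by (rule dists_subset[OF p0])+
  have finD: "finite D" "finite D'" using finite_subset[OF DI(1)] finite_subset[OF DI(2)] by simp_all
  have step: "(x + (y - z)\<^sup>2) mod int p \<in> D'" if "x \<in> D" "y \<in> A" "z \<in> A" for x y z
    using dists_add[of x p "Suc j" A "(y - z)\<^sup>2 mod int p" 1] dists_1[of y A z p] that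
    by (simp add: D_def D'_def mod_add_right_eq)
  have DD': "D \<subseteq> D'"
  proof
    fix x assume x: "x \<in> D"
    obtain z where "z \<in> A" using A(2) by blast
    then have "x mod int p \<in> D'" using step[OF x, of z z] by simp
    then show "x \<in> D'" using x DI(1) by auto
  qed
  have K1: "expansion_const \<ge> 1" by (simp add: expansion_const_def)
  show ?case
  proof (cases "card D \<le> card A ^ 2")
    case False
    have "a powr (2 - 2 / 2 ^ Suc (Suc j)) \<le> a powr 2" using a1 by (intro powr_mono) auto
    also have "\<dots> = real (card A ^ 2)" using a1 by (simp add: a_def)
    also have "\<dots> \<le> card D'" using False card_mono[OF finD(2) DD'] by linarith
    also have "\<dots> \<le> expansion_const\<^sup>2 * card D'"
      using mult_right_mono[of 1 "expansion_const\<^sup>2" "real (card D')"] K1 by simp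
    finally show ?thesis by (simp add: a_def D'_def)
  next
    case True
    \<comment> \<open>Adding the distance 0 embeds each distance set into the next, so the lower
      bound from one coordinate passes to D.\<close>
    have D1: "card (dists p A 1) \<le> card D"
    proof -
      have "card (dists p A 1) \<le> card (dists p A (Suc i))" for i
      proof (induction i)
        case (Suc i)
        have "dists p A (Suc i) \<subseteq> dists p A (Suc (Suc i))"
        proof
          fix x assume x: "x \<in> dists p A (Suc i)"
          obtain z where "z \<in> A" using A(2) by blast
          then have "(x + 0) mod int p \<in> dists p A (Suc i + 1)"
            using dists_add[OF x, of 0 1] dists_1[of z A z p] by simp
          then show "x \<in> dists p A (Suc (Suc i))" using x dists_subset[OF p0, of "Suc i" A] by auto
        qed
        moreover have "finite (dists p A (Suc (Suc i)))" by (rule finite_dists[OF p0])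
        ultimately show ?case using Suc card_mono order_trans by blast
      qed simp
      then show ?thesis by (simp add: D_def)
    qed
    have AD: "card A \<le> 2 * card D" using card_dists_1[OF p(1) A(1)] D1 by linarith
    have "sqrt (card A ^ 2 * card D) \<le> sqrt ((a\<^sup>2)\<^sup>2)"
    proof (rule real_sqrt_le_mono)
      have "card A ^ 2 * card D \<le> card A ^ 2 * card A ^ 2" by (rule mult_le_mono2[OF True])
      then show "real (card A ^ 2 * card D) \<le> (a\<^sup>2)\<^sup>2"
        by (metis a_def of_nat_le_iff of_nat_power power2_eq_square)
    qed
    also have "sqrt ((a\<^sup>2)\<^sup>2) = a\<^sup>2" by (simp only: real_sqrt_abs) simp
    finally have "11 * sqrt (card A ^ 2 * card D) + 1 < p" using small unfolding a_def by linarith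
    then have "sqrt (card A ^ 2 * card D) \<le> expansion_const * card {(x + (y - z)\<^sup>2) mod int p | x y z. x \<in> D \<and> y \<in> A \<and> z \<in> A}"
      using expands[OF p] A(1) DI(1) AD unfolding expands_def expansion_const_def by simp
    also have "\<dots> \<le> expansion_const * card D'"
      using step finD(2) K1 by (intro mult_left_mono of_nat_mono card_mono) auto
    finally have e: "a * sqrt (card D) \<le> expansion_const * card D'" by (simp add: real_sqrt_mult a_def)
    have "a powr (2 - 2 / 2 ^ Suc (Suc j)) = a * sqrt (a powr (2 - 2 / 2 ^ Suc j))"
    proof -
      have "sqrt (a powr (2 - 2 / 2 ^ Suc j)) = a powr ((2 - 2 / 2 ^ Suc j) / 2)"
        using a1 by (simp add: powr_half_sqrt[symmetric] powr_powr)
      moreover have "a * a powr ((2 - 2 / 2 ^ Suc j) / 2) = a powr (1 + (2 - 2 / 2 ^ Suc j) / 2)"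
        using a1 by (simp add: powr_add)
      moreover have "1 + (2 - 2 / 2 ^ Suc j) / 2 = (2 - 2 / 2 ^ Suc (Suc j) :: real)" by (simp add: field_simps)
      ultimately show ?thesis by (simp only:)
    qed
    also have "\<dots> \<le> a * sqrt (expansion_const\<^sup>2 * card D)"
      using Suc.IH a1 by (intro mult_left_mono real_sqrt_le_mono) (auto simp: a_def D_def)
    also have "\<dots> = expansion_const * (a * sqrt (card D))" using K1 by (simp add: real_sqrt_mult)
    also have "\<dots> \<le> expansion_const * (expansion_const * card D')" using e K1 by (intro mult_left_mono) auto
    finally show ?thesis by (simp add: power2_eq_square a_def D'_def)
  qed
qed

lemma quot_set_dists:
  fixes p k :: nat and A :: "int set"
  assumes p: "prime p" and big: "3 * p \<le> card (dists p A k) * card (dists p A (k + 1))"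
  shows "real p / 3 \<le> card (quot_set (int p) (dists p A (2 * k + 1)))"
proof -
  have p0: "p > 0" using prime_gt_0_nat[OF p] .
  let ?X = "dists p A k" and ?Y = "dists p A (k + 1)"
  have sum: "(x + y) mod int p \<in> dists p A (2 * k + 1)" if "x \<in> ?X" "y \<in> ?Y" for x y
  proof -
    have "k + (k + 1) = 2 * k + 1" by simp
    then show ?thesis using dists_add[OF that] by metis
  qed
  have "real p / 3 \<le> card {c \<in> {0..<int p}. \<exists>x\<in>?X. \<exists>y\<in>?Y. \<exists>x'\<in>?X. \<exists>y'\<in>?Y.
     (x' + y') mod int p \<noteq> 0 \<and> (c * (x' + y')) mod int p = (x + y) mod int p}"
    by (rule quotients_of_sumset[OF p dists_subset[OF p0] dists_subset[OF p0] big])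
  also have "\<dots> \<le> card (quot_set (int p) (dists p A (2 * k + 1)))"
  proof (intro of_nat_mono card_mono subsetI)
    show "finite (quot_set (int p) (dists p A (2 * k + 1)))"
      by (rule finite_subset[of _ "{0..<int p}"]) (auto simp: quot_set_def)
    fix c assume "c \<in> {c \<in> {0..<int p}. \<exists>x\<in>?X. \<exists>y\<in>?Y. \<exists>x'\<in>?X. \<exists>y'\<in>?Y.
     (x' + y') mod int p \<noteq> 0 \<and> (c * (x' + y')) mod int p = (x + y) mod int p}"
    then obtain x y x' y' where c: "c \<in> {0..<int p}" "x \<in> ?X" "y \<in> ?Y" "x' \<in> ?X" "y' \<in> ?Y"
      "(x' + y') mod int p \<noteq> 0" "(c * (x' + y')) mod int p = (x + y) mod int p" by blast
    then have "(c * ((x' + y') mod int p)) mod int p = (x + y) mod int p" by (simp add: mod_mult_right_eq)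
    then show "c \<in> quot_set (int p) (dists p A (2 * k + 1))"
      unfolding quot_set_def using c sum[OF c(2,3)] sum[OF c(4,5)] by blast
  qed
  finally show ?thesis .
qed

lemma quot_set_mono: "p > 0 \<Longrightarrow> D \<subseteq> D' \<Longrightarrow> card (quot_set (int p) D) \<le> card (quot_set (int p) D')"
proof (rule card_mono)
  show "finite (quot_set (int p) D')"
    by (rule finite_subset[of _ "{0..<int p}"]) (auto simp: quot_set_def)
  show "D \<subseteq> D' \<Longrightarrow> quot_set (int p) D \<subseteq> quot_set (int p) D'" unfolding quot_set_def by blast
qed

theorem theorem1p4:
  fixes k :: nat
  assumes "k \<ge> 2"
  shows "\<exists>C::real. C > 0 \<and>
    (\<forall>(p::nat) (A::int set). prime p \<and> odd p \<and> A \<subseteq> {0..<int p} \<longrightarrow>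
      (let d = 2*k+1;
           E = PiE {0..<d} (\<lambda>_. A);
           \<epsilon> = real d * (2^(k+2) - 2^(k+1) - 3) / (2^(k+3) - 6)
       in real (card E) \<ge> C * real p powr (real d / 2 - \<epsilon>) \<longrightarrow>
          real (card (quot_set (int p) (dist_set (int p) d E))) \<ge> real p / 3))"
proof -
  \<comment> \<open>The fourth power pays for two growth bounds, each losing the square of
    \<open>expansion_const\<close>; the 3 is the one in 3 p.\<close>
  define C1 where "C1 = 3 * expansion_const ^ 4"
  \<comment> \<open>Chosen so that p > C2 implies 45 C1^2 < p^(1/4). Here 45 = 11 * 4 + 1, where 4
    is the square of the factor 2 lost in rounding \<open>a0\<close>.\<close>
  define C2 where "C2 = (45 * C1\<^sup>2) ^ 4"
  define d where "d = 2 * k + 1"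
  define dd where "dd = d"
  define \<epsilon> where "\<epsilon> = real d * (2^(k+2) - 2^(k+1) - 3) / (2^(k+3) - 6)"
  define \<beta> where "\<beta> = 2 ^ k / (4 * 2 ^ k - 3 :: real)"
  have K1: "expansion_const \<ge> 1" by (simp add: expansion_const_def)
  have C1: "C1 \<ge> 3" using K1 by (simp add: C1_def)
  have "45 * C1\<^sup>2 \<ge> 45 * 1" using C1 by (intro mult_left_mono) auto
  then have C45: "45 * C1\<^sup>2 \<ge> 1" by simp
  have C2: "C2 \<ge> C1"
  proof -
    have "C1 \<le> 45 * C1\<^sup>2" using C1 by (simp add: power2_eq_square)
    also have "\<dots> = (45 * C1\<^sup>2) ^ 1" by simp
    also have "\<dots> \<le> C2" unfolding C2_def using C45 by (intro power_increasing) auto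
    finally show ?thesis .
  qed
  have k4: "(2::real) ^ k \<ge> 4" using power_increasing[OF assms, of "2::real"] by simp
  have \<beta>0: "\<beta> > 0" and \<beta>38: "\<beta> \<le> 3 / 8" using k4 by (auto simp: \<beta>_def field_simps)
  have expo: "real d / 2 - \<epsilon> = real d * \<beta>"
  proof -
    define t where "t = (2::real) ^ k"
    have t: "t \<ge> 4" using k4 by (simp add: t_def)
    have "\<epsilon> = real d * ((2 * t - 3) / (8 * t - 6))"
      unfolding \<epsilon>_def t_def by (simp add: power_add)
    moreover have "1 / 2 - (2 * t - 3) / (8 * t - 6) = t / (4 * t - 3)" using t by (simp add: field_simps)
    moreover have "real d / 2 - real d * ((2 * t - 3) / (8 * t - 6)) = real d * (1 / 2 - (2 * t - 3) / (8 * t - 6))"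
      by (simp add: algebra_simps)
    ultimately show ?thesis by (simp add: \<beta>_def t_def)
  qed
  have main: "real p / 3 \<le> card (quot_set (int p) (dists p A d))"
    if p: "prime p" "odd p" and A: "A \<subseteq> {0..<int p}" and big: "C2 ^ d * real p powr (real d / 2 - \<epsilon>) \<le> card (PiE {0..<d} (\<lambda>_. A))"
    for p :: nat and A
  proof -
    have p1: "p > 1" using prime_gt_1_nat[OF p(1)] .
    have finA: "finite A" using finite_subset[OF A] by simp
    have "(C2 * real p powr \<beta>) ^ d \<le> real (card A) ^ d"
    proof -
      have "(C2 * real p powr \<beta>) ^ d = C2 ^ d * real p powr (real d * \<beta>)"
        using p1 by (simp add: power_mult_distrib powr_realpow[symmetric] powr_powr mult.commute)
      also have "\<dots> \<le> card (PiE {0..<d} (\<lambda>_. A))" using big by (simp add: expo)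
      also have "\<dots> = real (card A) ^ d" by (simp add: card_PiE)
      finally show ?thesis .
    qed
    then have Abig: "C2 * real p powr \<beta> \<le> card A"
      using power_mono_iff[of "C2 * real p powr \<beta>" "real (card A)" d] C1 C2 by (simp add: d_def)
    have pb: "real p powr \<beta> > 1" using p1 \<beta>0 by (simp add: gr_one_powr)
    have Ap: "card A \<le> p" using card_mono[OF _ A] by simp
    \<comment> \<open>The hypothesis forces C2 p^\<beta> \<le> |A| \<le> p, so it can hold only for
      primes above C2.\<close>
    have pC2: "real p > C2"
    proof -
      have "C2 * 1 < C2 * real p powr \<beta>" using pb C1 C2 by (intro mult_strict_left_mono) auto
      then show ?thesis using Abig Ap by linarith
    qed
    \<comment> \<open>The size to which A is thinned: large enough for the product of the two
      distance sets to reach 3 p, yet with 11 \<open>a0\<close>^2 + 1 < p.\<close>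
    define a0 where "a0 = nat \<lceil>C1 * real p powr \<beta>\<rceil>"
    have a0: "C1 * real p powr \<beta> \<le> a0" unfolding a0_def by linarith
    have a0u: "real a0 \<le> 2 * (C1 * real p powr \<beta>)"
    proof -
      have "1 * 1 \<le> C1 * real p powr \<beta>" using C1 pb by (intro mult_mono) auto
      then show ?thesis unfolding a0_def by linarith
    qed
    have "C1 * real p powr \<beta> \<le> C2 * real p powr \<beta>" using C2 by (intro mult_right_mono) auto
    then have "a0 \<le> card A" using Abig unfolding a0_def by linarith
    then obtain A' where A': "A' \<subseteq> A" "card A' = a0" by (meson obtain_subset_with_card_n)
    have A'I: "A' \<subseteq> {0..<int p}" using A' A by blast
    have a01: "real a0 \<ge> 1"
    proof -
      have "1 * 1 \<le> C1 * real p powr \<beta>" using C1 pb by (intro mult_mono) auto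
      then show ?thesis using a0 by linarith
    qed
    then have A'0: "A' \<noteq> {}" using A' by auto
    have small: "11 * (real (card A'))\<^sup>2 + 1 < p"
    proof -
      have sq: "(real p powr \<beta>)\<^sup>2 = real p powr (2 * \<beta>)" using p1 by (simp add: power2_eq_square powr_add[symmetric])
      have ge1: "1 \<le> C1\<^sup>2 * (real p powr \<beta>)\<^sup>2"
        using mult_mono[of 1 "C1\<^sup>2" 1 "(real p powr \<beta>)\<^sup>2"] C1 pb by simp
      have "(real a0)\<^sup>2 \<le> (2 * (C1 * real p powr \<beta>))\<^sup>2" using a0u by (intro power_mono) auto
      then have "11 * (real (card A'))\<^sup>2 + 1 \<le> 45 * (C1\<^sup>2 * (real p powr \<beta>)\<^sup>2)"
        using ge1 by (simp add: A'(2) power_mult_distrib)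
      also have "\<dots> = 45 * C1\<^sup>2 * real p powr (2 * \<beta>)" by (simp add: sq)
      also have "\<dots> < real p powr (1 / 4) * real p powr (2 * \<beta>)"
      proof (rule mult_strict_right_mono)
        have "C2 powr (1 / 4) < real p powr (1 / 4)" using pC2 C1 C2 by (intro powr_less_mono2) auto
        moreover have "C2 powr (1 / 4) = 45 * C1\<^sup>2"
        proof -
          have "C2 = (45 * C1\<^sup>2) powr 4" unfolding C2_def using C45 by simp
          then have "C2 powr (1 / 4) = (45 * C1\<^sup>2) powr (4 * (1 / 4))" by (simp only: powr_powr)
          then show ?thesis using C45 by simp
        qed
        ultimately show "45 * C1\<^sup>2 < real p powr (1 / 4)" by simp
      qed (use p1 in simp)
      also have "\<dots> = real p powr (1 / 4 + 2 * \<beta>)" by (simp add: powr_add)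
      also have "\<dots> \<le> real p powr 1" using p1 \<beta>38 by (intro powr_mono) auto
      finally show ?thesis using p1 by simp
    qed
    obtain j where j: "k = Suc j" using assms by (cases k) auto
    define s where "s = (2::real) ^ k"
    have g1: "real a0 powr (2 - 2 / s) \<le> expansion_const\<^sup>2 * card (dists p A' k)"
      using dists_growth[OF p A'I A'0 small, of j] by (simp add: A'(2) j s_def)
    have g2: "real a0 powr (2 - 1 / s) \<le> expansion_const\<^sup>2 * card (dists p A' (k + 1))"
      using dists_growth[OF p A'I A'0 small, of k] by (simp add: A'(2) s_def)
    have "real a0 powr (4 - 3 / s) = real a0 powr (2 - 2 / s) * real a0 powr (2 - 1 / s)"
      by (simp add: powr_add[symmetric] add_divide_distrib[symmetric])
    also have "\<dots> \<le> (expansion_const\<^sup>2 * card (dists p A' k)) * (expansion_const\<^sup>2 * card (dists p A' (k + 1)))"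
      by (intro mult_mono g1 g2) auto
    also have "\<dots> = expansion_const ^ 4 * real (card (dists p A' k) * card (dists p A' (k + 1)))"
      by (simp add: power2_eq_square power4_eq_xxxx)
    finally have up: "real a0 powr (4 - 3 / s) \<le> expansion_const ^ 4 * real (card (dists p A' k) * card (dists p A' (k + 1)))" .
    have s4: "s \<ge> 4" using k4 by (simp add: s_def)
    have th: "4 - 3 / s \<ge> 1" using s4 by (simp add: field_simps)
    \<comment> \<open>This identity determines \<beta>: raising p^\<beta> to the combined exponent
      of the two distance sets gives p.\<close>
    have \<beta>th: "\<beta> * (4 - 3 / s) = 1" using s4 by (simp add: \<beta>_def s_def[symmetric] field_simps)
    have "C1 * p = C1 powr 1 * real p powr (\<beta> * (4 - 3 / s))" using C1 p1 by (simp add: \<beta>th)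
    also have "\<dots> \<le> C1 powr (4 - 3 / s) * real p powr (\<beta> * (4 - 3 / s))"
      using C1 th by (intro mult_right_mono powr_mono) auto
    also have "\<dots> = (C1 * real p powr \<beta>) powr (4 - 3 / s)" by (simp add: powr_mult powr_powr)
    also have "\<dots> \<le> real a0 powr (4 - 3 / s)" using a0 C1 th by (intro powr_mono2) auto
    finally have "expansion_const ^ 4 * (3 * real p) \<le> expansion_const ^ 4 * real (card (dists p A' k) * card (dists p A' (k + 1)))"
      using up by (simp add: C1_def mult_ac)
    then have "3 * real p \<le> real (card (dists p A' k) * card (dists p A' (k + 1)))"
      using K1 by (simp add: mult_le_cancel_left)
    then have "3 * p \<le> card (dists p A' k) * card (dists p A' (k + 1))"
      by (metis of_nat_le_iff of_nat_mult of_nat_numeral)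
    then have "real p / 3 \<le> card (quot_set (int p) (dists p A' d))"
      unfolding d_def by (rule quot_set_dists[OF p(1)])
    also have "\<dots> \<le> card (quot_set (int p) (dists p A d))"
      using quot_set_mono[OF _ dists_mono[OF A'(1), of p d]] p1 by simp
    finally show ?thesis .
  qed
  show ?thesis
  proof (intro exI[of _ "C2 ^ dd"] conjI allI impI)
    show "C2 ^ dd > 0" using C1 C2 by simp
    fix p :: nat and A :: "int set"
    assume "prime p \<and> odd p \<and> A \<subseteq> {0..<int p}"
    then show "let d = 2*k+1; E = PiE {0..<d} (\<lambda>_. A); \<epsilon> = real d * (2^(k+2) - 2^(k+1) - 3) / (2^(k+3) - 6)
       in real (card E) \<ge> C2 ^ dd * real p powr (real d / 2 - \<epsilon>) \<longrightarrow>
          real (card (quot_set (int p) (dist_set (int p) d E))) \<ge> real p / 3"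
      using main[of p A] unfolding Let_def dd_def d_def \<epsilon>_def by blast
  qed
qed

end
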